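(* Suppose $V\subseteq\overline{V}$ (transitive class models of ZFC) satisfies the $\delta$ approximation and $\delta$ cover properties for some $\delta<\kappa$. If $\kappa$ is weakly compact in $\overline{V}$ and the cardinal $(2^{\theta^{<\kappa}})^V$ has cardinality $\kappa$ in $\overline{V}$, then $\kappa$ was $\theta$ supercompact in $V$.
   Context: A pair $M\subseteq N$ satisfies the $\delta$ approximation property if whenever $A\subseteq M$ is a set in $N$ and $A\cap a\in M$ for every $a\in M$ of size less than $\delta$ in $M$, then $A\in M$; it satisfies the $\delta$ cover property if for every $A\in N$ with $A\subseteq M$ and $|A|^N<\delta$ there is $B\in M$ with $A\subseteq B$ and $|B|^M<\delta$. *)

theory Defs
  imports Main
begin

section \<open>First-order formulas in the language of set theory\<close>

datatype fm = Mem nat nat | Equal nat nat | Neg fm | Conj fm fm | All nat fm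

primrec sat :: "'a set \<Rightarrow> ('a \<Rightarrow> 'a \<Rightarrow> bool) \<Rightarrow> (nat \<Rightarrow> 'a) \<Rightarrow> fm \<Rightarrow> bool" where
  "sat M E v (Mem i j) \<longleftrightarrow> E (v i) (v j)"
| "sat M E v (Equal i j) \<longleftrightarrow> v i = v j"
| "sat M E v (Neg p) \<longleftrightarrow> \<not> sat M E v p"
| "sat M E v (Conj p q) \<longleftrightarrow> sat M E v p \<and> sat M E v q"
| "sat M E v (All i p) \<longleftrightarrow> (\<forall>x\<in>M. sat M E (v(i := x)) p)"

section \<open>Set-theoretic notions relativized to a class\<close>

text \<open>
  The type \<open>'a\<close> with the relation \<open>E\<close> is the ambient universe of sets, and a class is a set of
  elements of \<open>'a\<close>.  A constant of the locale is the relativization of its set-theoretic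
  definition to the class \<open>M\<close>: all quantifiers are bounded by \<open>M\<close>, and functions, families
  and so on are elements of \<open>M\<close>, never functions or sets of the logic.
\<close>

locale model =
  fixes M :: "'a set"
    and E :: "'a \<Rightarrow> 'a \<Rightarrow> bool"  (infix "\<epsilon>" 50)
begin

definition sub :: "'a \<Rightarrow> 'a \<Rightarrow> bool" where
  "sub x y \<longleftrightarrow> (\<forall>z\<in>M. z \<epsilon> x \<longrightarrow> z \<epsilon> y)"

definition is_empty :: "'a \<Rightarrow> bool" where
  "is_empty x \<longleftrightarrow> (\<forall>z\<in>M. \<not> z \<epsilon> x)"

definition is_upair :: "'a \<Rightarrow> 'a \<Rightarrow> 'a \<Rightarrow> bool" where
  "is_upair p x y \<longleftrightarrow> (\<forall>z\<in>M. z \<epsilon> p \<longleftrightarrow> z = x \<or> z = y)"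

definition is_opair :: "'a \<Rightarrow> 'a \<Rightarrow> 'a \<Rightarrow> bool" where
  "is_opair p x y \<longleftrightarrow> (\<exists>a\<in>M. \<exists>b\<in>M. is_upair a x x \<and> is_upair b x y \<and> is_upair p a b)"

definition is_succ :: "'a \<Rightarrow> 'a \<Rightarrow> bool" where
  "is_succ s x \<longleftrightarrow> (\<forall>z\<in>M. z \<epsilon> s \<longleftrightarrow> z \<epsilon> x \<or> z = x)"

definition is_two :: "'a \<Rightarrow> bool" where
  "is_two t \<longleftrightarrow> (\<exists>z\<in>M. \<exists>u\<in>M. is_empty z \<and> is_succ u z \<and> is_succ t u)"


subsection \<open>The axioms of ZFC\<close>

definition extensionality :: bool where
  "extensionality \<longleftrightarrow> (\<forall>x\<in>M. \<forall>y\<in>M. (\<forall>z\<in>M. z \<epsilon> x \<longleftrightarrow> z \<epsilon> y) \<longrightarrow> x = y)"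

definition foundation :: bool where
  "foundation \<longleftrightarrow>
    (\<forall>x\<in>M. \<not> is_empty x \<longrightarrow> (\<exists>y\<in>M. y \<epsilon> x \<and> \<not> (\<exists>z\<in>M. z \<epsilon> x \<and> z \<epsilon> y)))"

definition pairing :: bool where
  "pairing \<longleftrightarrow> (\<forall>x\<in>M. \<forall>y\<in>M. \<exists>p\<in>M. is_upair p x y)"

definition union :: bool where
  "union \<longleftrightarrow> (\<forall>x\<in>M. \<exists>u\<in>M. \<forall>z\<in>M. z \<epsilon> u \<longleftrightarrow> (\<exists>y\<in>M. y \<epsilon> x \<and> z \<epsilon> y))"

definition powerset :: bool where
  "powerset \<longleftrightarrow> (\<forall>x\<in>M. \<exists>p\<in>M. \<forall>z\<in>M. z \<epsilon> p \<longleftrightarrow> sub z x)"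

definition infinity :: bool where
  "infinity \<longleftrightarrow>
    (\<exists>I\<in>M. (\<exists>z\<in>M. is_empty z \<and> z \<epsilon> I) \<and> (\<forall>x\<in>M. x \<epsilon> I \<longrightarrow> (\<exists>s\<in>M. is_succ s x \<and> s \<epsilon> I)))"

definition separation :: bool where
  "separation \<longleftrightarrow>
    (\<forall>p v. range v \<subseteq> M \<longrightarrow>
      (\<forall>A\<in>M. \<exists>B\<in>M. \<forall>x\<in>M. x \<epsilon> B \<longleftrightarrow> x \<epsilon> A \<and> sat M E (v(0 := x)) p))"

definition replacement :: bool where
  "replacement \<longleftrightarrow>
    (\<forall>p v. range v \<subseteq> M \<longrightarrow>
      (\<forall>A\<in>M.
        (\<forall>x\<in>M. x \<epsilon> A \<longrightarrow>
          (\<forall>y\<in>M. \<forall>z\<in>M. sat M E (v(0 := x, 1 := y)) p \<and> sat M E (v(0 := x, 1 := z)) p \<longrightarrow> y = z))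
        \<longrightarrow> (\<exists>B\<in>M. \<forall>y\<in>M. y \<epsilon> B \<longleftrightarrow> (\<exists>x\<in>M. x \<epsilon> A \<and> sat M E (v(0 := x, 1 := y)) p))))"

definition choice :: bool where
  "choice \<longleftrightarrow>
    (\<forall>x\<in>M.
      (\<forall>y\<in>M. y \<epsilon> x \<longrightarrow> \<not> is_empty y) \<and>
      (\<forall>y\<in>M. \<forall>z\<in>M. y \<epsilon> x \<and> z \<epsilon> x \<and> y \<noteq> z \<longrightarrow> \<not> (\<exists>w\<in>M. w \<epsilon> y \<and> w \<epsilon> z))
      \<longrightarrow> (\<exists>c\<in>M. \<forall>y\<in>M. y \<epsilon> x \<longrightarrow> (\<exists>!w. w \<in> M \<and> w \<epsilon> y \<and> w \<epsilon> c)))"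

definition ZFC :: bool where
  "ZFC \<longleftrightarrow> extensionality \<and> foundation \<and> pairing \<and> union \<and> powerset \<and> infinity \<and>
    separation \<and> replacement \<and> choice"


subsection \<open>Functions, ordinals and cardinals\<close>

definition app :: "'a \<Rightarrow> 'a \<Rightarrow> 'a \<Rightarrow> bool" where
  "app f x y \<longleftrightarrow> (\<exists>p\<in>M. p \<epsilon> f \<and> is_opair p x y)"

definition is_fun :: "'a \<Rightarrow> 'a \<Rightarrow> 'a \<Rightarrow> bool" where
  "is_fun f A B \<longleftrightarrow>
    (\<forall>p\<in>M. p \<epsilon> f \<longrightarrow> (\<exists>x\<in>M. \<exists>y\<in>M. x \<epsilon> A \<and> y \<epsilon> B \<and> is_opair p x y)) \<and>
    (\<forall>x\<in>M. x \<epsilon> A \<longrightarrow> (\<exists>!y. y \<in> M \<and> app f x y))"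

definition is_bij :: "'a \<Rightarrow> 'a \<Rightarrow> 'a \<Rightarrow> bool" where
  "is_bij f A B \<longleftrightarrow> is_fun f A B \<and> (\<forall>y\<in>M. y \<epsilon> B \<longrightarrow> (\<exists>!x. x \<in> M \<and> app f x y))"

definition equipotent :: "'a \<Rightarrow> 'a \<Rightarrow> bool" where
  "equipotent A B \<longleftrightarrow> (\<exists>f\<in>M. is_bij f A B)"

definition trans_set :: "'a \<Rightarrow> bool" where
  "trans_set x \<longleftrightarrow> (\<forall>y\<in>M. y \<epsilon> x \<longrightarrow> sub y x)"

text \<open>In the presence of foundation, these are the von Neumann ordinals.\<close>

definition is_ord :: "'a \<Rightarrow> bool" where
  "is_ord x \<longleftrightarrow> trans_set x \<and> (\<forall>y\<in>M. y \<epsilon> x \<longrightarrow> trans_set y)"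

definition is_limit :: "'a \<Rightarrow> bool" where
  "is_limit x \<longleftrightarrow>
    is_ord x \<and> \<not> is_empty x \<and> (\<forall>y\<in>M. y \<epsilon> x \<longrightarrow> (\<exists>s\<in>M. is_succ s y \<and> s \<epsilon> x))"

definition is_omega :: "'a \<Rightarrow> bool" where
  "is_omega w \<longleftrightarrow> is_limit w \<and> (\<forall>x\<in>M. x \<epsilon> w \<longrightarrow> \<not> is_limit x)"

definition is_card :: "'a \<Rightarrow> bool" where
  "is_card k \<longleftrightarrow> is_ord k \<and> (\<forall>a\<in>M. a \<epsilon> k \<longrightarrow> \<not> equipotent a k)"

definition uncountable_card :: "'a \<Rightarrow> bool" where
  "uncountable_card k \<longleftrightarrow> is_card k \<and> (\<exists>w\<in>M. is_omega w \<and> w \<epsilon> k)"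

definition has_card :: "'a \<Rightarrow> 'a \<Rightarrow> bool" where
  "has_card A m \<longleftrightarrow> is_card m \<and> equipotent A m"

definition size_less :: "'a \<Rightarrow> 'a \<Rightarrow> bool" where
  "size_less A d \<longleftrightarrow> (\<exists>m\<in>M. has_card A m \<and> m \<epsilon> d)"

text \<open>\<open>m = |B|\<^bsup>|A|\<^esup>\<close>, the cardinality of the set of functions from \<open>A\<close> to \<open>B\<close>.\<close>

definition card_exp :: "'a \<Rightarrow> 'a \<Rightarrow> 'a \<Rightarrow> bool" where
  "card_exp B A m \<longleftrightarrow> (\<exists>F\<in>M. (\<forall>f\<in>M. f \<epsilon> F \<longleftrightarrow> is_fun f A B) \<and> has_card F m)"

text \<open>\<open>m = |B|\<^bsup><k\<^esup>\<close>, the cardinality of the set of functions to \<open>B\<close> from an ordinal below \<open>k\<close>.\<close>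

definition card_exp_less :: "'a \<Rightarrow> 'a \<Rightarrow> 'a \<Rightarrow> bool" where
  "card_exp_less B k m \<longleftrightarrow>
    (\<exists>F\<in>M. (\<forall>f\<in>M. f \<epsilon> F \<longleftrightarrow> (\<exists>b\<in>M. b \<epsilon> k \<and> is_fun f b B)) \<and> has_card F m)"

definition two_exp :: "'a \<Rightarrow> 'a \<Rightarrow> bool" where
  "two_exp l m \<longleftrightarrow> (\<exists>t\<in>M. is_two t \<and> card_exp t l m)"


subsection \<open>Weakly compact cardinals\<close>

text \<open>\<open>P = [A]\<^sup>2\<close>, the set of two-element subsets of \<open>A\<close>.\<close>

definition is_doubletons :: "'a \<Rightarrow> 'a \<Rightarrow> bool" where
  "is_doubletons P A \<longleftrightarrow>
    (\<forall>p\<in>M. p \<epsilon> P \<longleftrightarrow> (\<exists>x\<in>M. \<exists>y\<in>M. x \<epsilon> A \<and> y \<epsilon> A \<and> x \<noteq> y \<and> is_upair p x y))"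

definition homogeneous :: "'a \<Rightarrow> 'a \<Rightarrow> bool" where
  "homogeneous f H \<longleftrightarrow>
    (\<exists>i\<in>M. \<forall>x\<in>M. \<forall>y\<in>M. \<forall>p\<in>M. x \<epsilon> H \<and> y \<epsilon> H \<and> x \<noteq> y \<and> is_upair p x y \<longrightarrow> app f p i)"

text \<open>\<open>k\<close> is uncountable and \<open>k \<rightarrow> (k)\<^sup>2\<^sub>2\<close>.\<close>

definition weakly_compact :: "'a \<Rightarrow> bool" where
  "weakly_compact k \<longleftrightarrow>
    uncountable_card k \<and>
    (\<forall>P\<in>M. \<forall>t\<in>M. \<forall>f\<in>M. is_doubletons P k \<and> is_two t \<and> is_fun f P t \<longrightarrow>
      (\<exists>H\<in>M. sub H k \<and> has_card H k \<and> homogeneous f H))"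


subsection \<open>Supercompactness\<close>

text \<open>\<open>S = P\<^sub>k A\<close>, the set of subsets of \<open>A\<close> of size less than \<open>k\<close>.\<close>

definition is_Pk :: "'a \<Rightarrow> 'a \<Rightarrow> 'a \<Rightarrow> bool" where
  "is_Pk S k A \<longleftrightarrow> (\<forall>x\<in>M. x \<epsilon> S \<longleftrightarrow> sub x A \<and> size_less x k)"

definition ultrafilter_on :: "'a \<Rightarrow> 'a \<Rightarrow> bool" where
  "ultrafilter_on S U \<longleftrightarrow>
    S \<epsilon> U \<and>
    (\<forall>X\<in>M. X \<epsilon> U \<longrightarrow> sub X S \<and> \<not> is_empty X) \<and>
    (\<forall>X\<in>M. \<forall>Y\<in>M. X \<epsilon> U \<and> sub X Y \<and> sub Y S \<longrightarrow> Y \<epsilon> U) \<and>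
    (\<forall>X\<in>M. \<forall>Y\<in>M. \<forall>Z\<in>M. X \<epsilon> U \<and> Y \<epsilon> U \<and> (\<forall>s\<in>M. s \<epsilon> Z \<longleftrightarrow> s \<epsilon> X \<and> s \<epsilon> Y) \<longrightarrow> Z \<epsilon> U) \<and>
    (\<forall>X\<in>M. \<forall>Y\<in>M. sub X S \<and> (\<forall>s\<in>M. s \<epsilon> Y \<longleftrightarrow> s \<epsilon> S \<and> \<not> s \<epsilon> X) \<longrightarrow> X \<epsilon> U \<or> Y \<epsilon> U)"

definition complete :: "'a \<Rightarrow> 'a \<Rightarrow> 'a \<Rightarrow> bool" where
  "complete k S U \<longleftrightarrow>
    (\<forall>F\<in>M. \<forall>X\<in>M. sub F U \<and> size_less F k \<and>
      (\<forall>s\<in>M. s \<epsilon> X \<longleftrightarrow> s \<epsilon> S \<and> (\<forall>Y\<in>M. Y \<epsilon> F \<longrightarrow> s \<epsilon> Y)) \<longrightarrow> X \<epsilon> U)"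

definition fine :: "'a \<Rightarrow> 'a \<Rightarrow> 'a \<Rightarrow> bool" where
  "fine A S U \<longleftrightarrow>
    (\<forall>a\<in>M. \<forall>X\<in>M. a \<epsilon> A \<and> (\<forall>s\<in>M. s \<epsilon> X \<longleftrightarrow> s \<epsilon> S \<and> a \<epsilon> s) \<longrightarrow> X \<epsilon> U)"

text \<open>Every function on \<open>S\<close> with \<open>f(s) \<in> s\<close> for almost all \<open>s\<close> is constant on a set in \<open>U\<close>.\<close>

definition normal :: "'a \<Rightarrow> 'a \<Rightarrow> 'a \<Rightarrow> bool" where
  "normal A S U \<longleftrightarrow>
    (\<forall>f\<in>M. \<forall>X\<in>M. is_fun f S A \<and> X \<epsilon> U \<and>
        (\<forall>s\<in>M. s \<epsilon> X \<longleftrightarrow> s \<epsilon> S \<and> (\<exists>a\<in>M. app f s a \<and> a \<epsilon> s)) \<longrightarrow>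
      (\<exists>a\<in>M. \<exists>Y\<in>M. a \<epsilon> A \<and> Y \<epsilon> U \<and> (\<forall>s\<in>M. s \<epsilon> Y \<longleftrightarrow> s \<epsilon> S \<and> app f s a)))"

definition normal_fine_measure :: "'a \<Rightarrow> 'a \<Rightarrow> 'a \<Rightarrow> bool" where
  "normal_fine_measure k A U \<longleftrightarrow>
    (\<exists>S\<in>M. is_Pk S k A \<and> ultrafilter_on S U \<and> complete k S U \<and> fine A S U \<and> normal A S U)"

text \<open>
  \<open>k\<close> is \<open>\<theta>\<close> supercompact if there is a normal fine measure on \<open>P\<^sub>k \<theta>\<close>.  This is meant for
  \<open>k \<le> \<theta>\<close>: if \<open>\<theta> < k\<close>, then \<open>\<theta> \<in> P\<^sub>k \<theta>\<close> generates a principal such measure, whereas an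
  elementary embedding with critical point \<open>k\<close>, \<open>\<theta> < j(k)\<close> and a target closed under
  \<open>\<theta>\<close>-sequences exists just in case \<open>k\<close> is measurable, that is, \<open>k\<close> supercompact.  So the
  measure is required to be on \<open>P\<^sub>k (max \<theta> k)\<close>.
\<close>

definition supercompact :: "'a \<Rightarrow> 'a \<Rightarrow> bool" where
  "supercompact \<theta> k \<longleftrightarrow>
    uncountable_card k \<and>
    (\<exists>U\<in>M. normal_fine_measure k (if sub k \<theta> then \<theta> else k) U)"

end


section \<open>Pairs of transitive classes\<close>

definition transitive_class :: "('a \<Rightarrow> 'a \<Rightarrow> bool) \<Rightarrow> 'a set \<Rightarrow> bool" where
  "transitive_class E M \<longleftrightarrow> (\<forall>x\<in>M. \<forall>y. E y x \<longrightarrow> y \<in> M)"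

definition approximation_property ::
    "('a \<Rightarrow> 'a \<Rightarrow> bool) \<Rightarrow> 'a \<Rightarrow> 'a set \<Rightarrow> 'a set \<Rightarrow> bool" where
  "approximation_property E \<delta> M N \<longleftrightarrow>
    (\<forall>A\<in>N.
      (\<forall>x. E x A \<longrightarrow> x \<in> M) \<and>
      (\<forall>a\<in>M. model.size_less M E a \<delta> \<longrightarrow> (\<exists>b\<in>M. \<forall>x. E x b \<longleftrightarrow> E x A \<and> E x a))
      \<longrightarrow> A \<in> M)"

definition cover_property ::
    "('a \<Rightarrow> 'a \<Rightarrow> bool) \<Rightarrow> 'a \<Rightarrow> 'a set \<Rightarrow> 'a set \<Rightarrow> bool" where
  "cover_property E \<delta> M N \<longleftrightarrow>
    (\<forall>A\<in>N.
      (\<forall>x. E x A \<longrightarrow> x \<in> M) \<and> model.size_less N E A \<delta>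
      \<longrightarrow> (\<exists>B\<in>M. (\<forall>x. E x A \<longrightarrow> E x B) \<and> model.size_less M E B \<delta>))"

end

theory Submission
  imports Defs
begin

text \<open>
  Work in \<open>Vbar\<close>.  The hypothesis on cardinalities provides an enumeration, of length \<open>\<kappa>\<close>, of all
  sets in \<open>V\<close> of functions from ordinals below \<open>\<kappa>\<close> to \<open>\<theta>\<close>.  These code the elements of \<open>\<theta>\<close>, whence
  a surjection \<open>e : \<kappa> \<rightarrow> \<theta>\<close>, and all the subsets of, and regressive functions on, \<open>P\<^sub>\<kappa>\<theta>\<close> in \<open>V\<close>.
  From \<open>\<kappa> \<rightarrow> (\<kappa>)\<^sup>2\<^sub>2\<close> one obtains, for any family of \<open>\<kappa>\<close> many regressive functions on \<open>\<kappa>\<close>, an unbounded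
  \<open>H \<subseteq> \<kappa>\<close> and a function \<open>g\<close> tending to \<open>\<kappa>\<close> on \<open>H\<close> such that each \<open>h \<circ> g\<close> is eventually constant on \<open>H\<close>
  as soon as it is eventually less than \<open>g\<close>.  The measure consists of the \<open>X \<subseteq> P\<^sub>\<kappa>\<theta>\<close> in \<open>V\<close> which contain
  \<open>e ` g(a)\<close> for almost all \<open>a\<close> in \<open>H\<close>.  Here \<open>e ` g(a)\<close> is in \<open>V\<close> by approximation and cover: were it not,
  pick \<open>d\<close> in \<open>V\<close> of size less than \<open>\<delta>\<close> such that \<open>d \<inter> e ` g(a)\<close> is not in \<open>V\<close>.  By regressivity this
  intersection is eventually a fixed set, and intersecting \<open>d\<close> with a cover of that set gives it in \<open>V\<close>.
  Finally the measure is in \<open>V\<close> by approximation, because its trace on a small family of sets \<open>X\<close> is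
  \<open>{X. s \<in> X}\<close> for a single \<open>s = e ` g(a)\<close>.
\<close>

section \<open>Definability with parameters\<close>

text \<open>Separation and replacement hold only for formulas with parameters, so every set and
  every recursion below needs a proof that the predicate or operation behind it is definable;
  functions of the logic with such a certificate serve as class functions. In terms of an embedding
  j with critical point \<kappa>: the end segments of H replace the ultrafilter and decide only what
  \<kappa> many functions can express. A function g that is minimal among those exceeding all
  constants represents \<kappa>, so the image of g(a) under e represents j(e)[\<kappa>] =
  j[\<theta>], and the measure is the usual set of all X with j[\<theta>] in j(X). The cardinal in
  the hypothesis counts what has to be decided: an element of the space together with one of its
  members is coded by functions from an ordinal below \<kappa> to \<theta>, and a relation between
  the two by a set of such functions. The obstacle is that H, g and e exist in the larger model
  only, while the sets in the measure, and the measure, have to be found in the smaller one.\<close>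

fun ren :: "(nat \<Rightarrow> nat) \<Rightarrow> fm \<Rightarrow> fm" where
  "ren f (Mem i j) = Mem (f i) (f j)"
| "ren f (Equal i j) = Equal (f i) (f j)"
| "ren f (Neg p) = Neg (ren f p)"
| "ren f (Conj p q) = Conj (ren f p) (ren f q)"
| "ren f (All i p) = All (f i) (ren f p)"

text \<open>\<open>ren\<close> moves bound indices as well as free ones, so injectivity of
  \<open>f\<close> is what excludes capture.\<close>

lemma sat_ren: "inj f \<Longrightarrow> sat M E v (ren f p) \<longleftrightarrow> sat M E (\<lambda>n. v (f n)) p"
proof (induction p arbitrary: v)
  case (All i p)
  have "(\<lambda>n. (v(f i := x)) (f n)) = (\<lambda>n. v (f n))(i := x)" for x
    using All.prems by (auto simp: fun_eq_iff inj_eq)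
  with All show ?case by simp
qed simp_all

fun bound :: "fm \<Rightarrow> nat" where
  "bound (Mem i j) = Suc (max i j)"
| "bound (Equal i j) = Suc (max i j)"
| "bound (Neg p) = bound p"
| "bound (Conj p q) = max (bound p) (bound q)"
| "bound (All i p) = max (Suc i) (bound p)"

lemma sat_cong: "(\<And>n. n < bound p \<Longrightarrow> v n = w n) \<Longrightarrow> sat M E v p \<longleftrightarrow> sat M E w p"
proof (induction p arbitrary: v w)
  case (All i p)
  have "sat M E (v(i := x)) p \<longleftrightarrow> sat M E (w(i := x)) p" for x
    by (rule All.IH) (use All.prems in auto)
  then show ?case by simp
next
  case (Conj p q)
  have "sat M E v p \<longleftrightarrow> sat M E w p" by (rule Conj.IH(1)) (use Conj.prems in auto)
  moreover have "sat M E v q \<longleftrightarrow> sat M E w q" by (rule Conj.IH(2)) (use Conj.prems in auto)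
  ultimately show ?case by simp
next
  case (Neg p)
  then have "sat M E v p \<longleftrightarrow> sat M E w p" by (metis bound.simps(3))
  then show ?case by simp
qed simp_all

definition env :: "(nat \<Rightarrow> 'a) \<Rightarrow> (nat \<Rightarrow> 'a) \<Rightarrow> nat \<Rightarrow> 'a" where
  "env v w n = (if even n then v (n div 2) else w (n div 2))"

lemma env_simps [simp]: "env v w (2 * n) = v n" "env v w (Suc (2 * n)) = w n"
  by (simp_all add: env_def)

definition par :: "(nat \<Rightarrow> nat) \<Rightarrow> (nat \<Rightarrow> nat) \<Rightarrow> nat \<Rightarrow> nat" where
  "par a b n = (if even n then 2 * a (n div 2) else Suc (2 * b (n div 2)))"

lemma env_par: "(\<lambda>n. env v w (par a b n)) = env (\<lambda>n. v (a n)) (\<lambda>n. w (b n))"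
  by (auto simp: env_def par_def fun_eq_iff)

lemma inj_par: assumes "inj a" "inj b" shows "inj (par a b)"
proof (rule injI)
  fix x y assume *: "par a b x = par a b y"
  have "even (par a b n) = even n" "par a b n div 2 = (if even n then a (n div 2) else b (n div 2))" for n
    by (auto simp: par_def)
  with * assms have "even x = even y" "x div 2 = y div 2" by (metis inj_eq)+
  then show "x = y" by presburger
qed

context model
begin

text \<open>
  A predicate on assignments is definable if it is given by a formula with parameters; the formula
  reads the assignment \<open>v\<close> at the even positions and the parameters \<open>w\<close> at the odd ones.
\<close>

definition D :: "((nat \<Rightarrow> 'a) \<Rightarrow> bool) \<Rightarrow> bool" where
  "D Q \<longleftrightarrow> (\<exists>p w. range w \<subseteq> M \<and> (\<forall>v. range v \<subseteq> M \<longrightarrow> Q v = sat M E (env v w) p))"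

definition Dt :: "((nat \<Rightarrow> 'a) \<Rightarrow> 'a) \<Rightarrow> bool" where
  "Dt t \<longleftrightarrow> (\<forall>v. range v \<subseteq> M \<longrightarrow> t v \<in> M) \<and> D (\<lambda>v. v 0 = t (\<lambda>n. v (Suc n)))"

lemma D_cong: "D P \<Longrightarrow> (\<And>v. range v \<subseteq> M \<Longrightarrow> P v = Q v) \<Longrightarrow> D Q"
  unfolding D_def by auto

lemma D_neg: "D P \<Longrightarrow> D (\<lambda>v. \<not> P v)"
proof -
  assume "D P"
  then obtain p w where "range w \<subseteq> M" "\<forall>v. range v \<subseteq> M \<longrightarrow> P v = sat M E (env v w) p"
    unfolding D_def by blast
  then show ?thesis unfolding D_def by (intro exI[of _ "Neg p"] exI[of _ w]) simp
qed

lemma D_conj: assumes "D P" "D Q" shows "D (\<lambda>v. P v \<and> Q v)"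
proof -
  from assms(1) obtain p w where 1: "range w \<subseteq> M" "\<And>v. range v \<subseteq> M \<Longrightarrow> P v = sat M E (env v w) p"
    unfolding D_def by blast
  from assms(2) obtain q u where 2: "range u \<subseteq> M" "\<And>v. range v \<subseteq> M \<Longrightarrow> Q v = sat M E (env v u) q"
    unfolding D_def by blast
  \<comment> \<open>The parameter sequences are interleaved into \<open>env w u\<close>:
    \<open>p\<close> reads the even parameters, \<open>q\<close> the odd ones, and both share the
    assignment.\<close>
  have i: "inj (par id (\<lambda>k. 2 * k))" "inj (par id (\<lambda>k. Suc (2 * k)))"
    by (rule inj_par; rule injI; simp)+
  have a: "(\<lambda>k. env w u (2 * k)) = w" "(\<lambda>k. env w u (Suc (2 * k))) = u" by (simp_all add: env_def fun_eq_iff)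
  have "range (env w u) \<subseteq> M" using 1(1) 2(1) by (auto simp: env_def)
  then show ?thesis unfolding D_def using 1(2) 2(2)
    by (intro exI[of _ "Conj (ren (par id (\<lambda>k. 2 * k)) p) (ren (par id (\<lambda>k. Suc (2 * k))) q)"]
        exI[of _ "env w u"]) (simp add: sat_ren[OF i(1)] sat_ren[OF i(2)] env_par a)
qed

text \<open>
  Bound variables are treated in the manner of de Bruijn: position 0 holds the bound variable.
\<close>

lemma D_all:
  assumes "D (\<lambda>v. P (v 0) (\<lambda>n. v (Suc n)))"
  shows "D (\<lambda>v. \<forall>x\<in>M. P x v)"
proof -
  from assms obtain p w where w: "range w \<subseteq> M" and
    p: "\<And>v. range v \<subseteq> M \<Longrightarrow> P (v 0) (\<lambda>n. v (Suc n)) = sat M E (env v w) p"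
    unfolding D_def by blast
  define N where "N = bound p"
  \<comment> \<open>Position 0 goes to the fresh position \<open>N\<close> and every other position
    of \<open>p\<close> moves down by one; the values beyond \<open>N\<close> lie outside
    \<open>p\<close> and only make \<open>a\<close> injective.\<close>
  define a where "a k = (case k of 0 \<Rightarrow> N | Suc m \<Rightarrow> if m < N then m else Suc m)" for k
  define f where "f = par a id"
  have "inj a" by (auto simp: a_def inj_def split: nat.splits if_splits)
  then have f: "inj f" unfolding f_def by (rule inj_par) simp
  have "sat M E ((env v w)(f 0 := x)) (ren f p) = P x v" if v: "range v \<subseteq> M" and x: "x \<in> M" for v x
  proof -
    have r: "range (case_nat x v) \<subseteq> M" using v x by (fastforce simp: image_subset_iff split: nat.splits)
    have "((env v w)(f 0 := x)) (f n) = env (case_nat x v) w n" if "n < N" for n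
    proof (cases "n = 0 \<or> odd n")
      case True
      then show ?thesis by (auto simp: f_def env_def par_def)
    next
      case False
      then have "n = 2 * Suc (n div 2 - 1)" by presburger
      then obtain m where "n = 2 * Suc m" by blast
      then show ?thesis using that by (auto simp: f_def env_def par_def a_def)
    qed
    then have "sat M E ((env v w)(f 0 := x)) (ren f p) = sat M E (env (case_nat x v) w) p"
      unfolding sat_ren[OF f] N_def by (rule sat_cong)
    also have "\<dots> = P x v" using p[OF r] by simp
    finally show ?thesis .
  qed
  then show ?thesis unfolding D_def using w
    by (intro exI[of _ "All (f 0) (ren f p)"] exI[of _ w]) simp
qed

lemma D_ren:
  assumes "D Q" "inj f"
  shows "D (\<lambda>v. Q (\<lambda>n. v (f n)))"
proof -
  from assms obtain p w where *: "range w \<subseteq> M" "\<And>v. range v \<subseteq> M \<Longrightarrow> Q v = sat M E (env v w) p"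
    unfolding D_def by blast
  define g where "g = par f id"
  have g: "inj g" unfolding g_def by (rule inj_par[OF \<open>inj f\<close>]) simp
  have a: "(\<lambda>n. env v w (g n)) = env (\<lambda>n. v (f n)) w" for v
    by (simp add: g_def env_par)
  show ?thesis unfolding D_def
  proof (intro exI conjI allI impI)
    show "range w \<subseteq> M" by fact
    fix v :: "nat \<Rightarrow> 'a" assume "range v \<subseteq> M"
    then have "range (\<lambda>n. v (f n)) \<subseteq> M" by auto
    from *(2)[OF this] show "Q (\<lambda>n. v (f n)) = sat M E (env v w) (ren g p)"
      by (simp add: sat_ren[OF g] a)
  qed
qed

lemma D_disj: "D P \<Longrightarrow> D Q \<Longrightarrow> D (\<lambda>v. P v \<or> Q v)"
  by (rule D_cong[OF D_neg[OF D_conj[OF D_neg D_neg, of P Q]]]) auto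
lemma D_imp: "D P \<Longrightarrow> D Q \<Longrightarrow> D (\<lambda>v. P v \<longrightarrow> Q v)"
  by (rule D_cong[OF D_neg[OF D_conj[OF _ D_neg, of P Q]]]) auto
lemma D_iff: "D P \<Longrightarrow> D Q \<Longrightarrow> D (\<lambda>v. P v \<longleftrightarrow> Q v)"
  by (rule D_cong[OF D_conj[OF D_imp[of P Q] D_imp[of Q P]]]) auto
lemma D_ex:
  assumes "D (\<lambda>v. P (v 0) (\<lambda>n. v (Suc n)))"
  shows "D (\<lambda>v. \<exists>x\<in>M. P x v)"
  by (rule D_cong[OF D_neg[OF D_all[where P = "\<lambda>x v. \<not> P x v"]]]) (auto intro: D_neg assms)

lemma D_bool: "M \<noteq> {} \<Longrightarrow> D (\<lambda>v. b)"
proof -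
  assume "M \<noteq> {}"
  then obtain c where c: "c \<in> M" by auto
  show ?thesis unfolding D_def
    by (rule exI[of _ "if b then Equal 0 0 else Neg (Equal 0 0)"], rule exI[of _ "\<lambda>_. c"]) (use c in auto)
qed

lemma D_mem0: "c \<in> M \<Longrightarrow> D (\<lambda>v. E (v i) (v j))"
  unfolding D_def
  by (rule exI[of _ "Mem (2 * i) (2 * j)"], rule exI[of _ "\<lambda>_. c"]) auto
lemma D_eq0: "c \<in> M \<Longrightarrow> D (\<lambda>v. v i = v j)"
  unfolding D_def
  by (rule exI[of _ "Equal (2 * i) (2 * j)"], rule exI[of _ "\<lambda>_. c"]) auto
lemma Dt_const: "c \<in> M \<Longrightarrow> Dt (\<lambda>v. c)"
  unfolding Dt_def D_def
  by (intro conjI, simp, rule exI[of _ "Equal 0 1"], rule exI[of _ "\<lambda>_. c"])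
    (auto simp: env_def)
lemma Dt_var: assumes c: "c \<in> M" shows "Dt (\<lambda>v. v i)"
proof -
  have "v i \<in> M" if "range v \<subseteq> M" for v :: "nat \<Rightarrow> 'a" using that by auto
  then show ?thesis unfolding Dt_def using D_eq0[OF c] by blast
qed

lemma Dt_in: "Dt t \<Longrightarrow> range v \<subseteq> M \<Longrightarrow> t v \<in> M"
  unfolding Dt_def by blast

lemma Dt_ren: "Dt t \<Longrightarrow> inj f \<Longrightarrow> Dt (\<lambda>v. t (\<lambda>n. v (f n)))"
  unfolding Dt_def
proof (intro conjI allI impI; (elim conjE)?)
  assume t: "\<forall>v. range v \<subseteq> M \<longrightarrow> t v \<in> M"
  fix v :: "nat \<Rightarrow> 'a"
  assume "range v \<subseteq> M"
  then have "range (\<lambda>n. v (f n)) \<subseteq> M" by auto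
  from t[rule_format, OF this] show "t (\<lambda>n. v (f n)) \<in> M" .
next
  assume f: "inj f" and "D (\<lambda>v. v 0 = t (\<lambda>n. v (Suc n)))"
  define g where "g n = (case n of 0 \<Rightarrow> 0 | Suc m \<Rightarrow> Suc (f m))" for n
  have g: "g 0 = 0" "\<And>n. g (Suc n) = Suc (f n)" by (simp_all add: g_def)
  have "inj g"
  proof (rule injI)
    fix m n assume "g m = g n"
    then show "m = n" using f by (cases m; cases n) (simp_all add: g inj_eq)
  qed
  from D_ren[OF \<open>D _\<close> this] show "D (\<lambda>v. v 0 = t (\<lambda>n. v (Suc (f n))))" unfolding g .
qed

lemma Dt_shift: "Dt t \<Longrightarrow> Dt (\<lambda>v. t (\<lambda>n. v (Suc n)))"
  by (rule Dt_ren) simp_all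

text \<open>A definable term is substituted by quantifying over its value,
  \<open>\<exists>x. x = t v \<and> Q x v\<close>.\<close>

lemma D_comp:
  assumes "D (\<lambda>v. Q (v 0) (\<lambda>n. v (Suc n)))" "Dt t"
  shows "D (\<lambda>v. Q (t v) v)"
  by (rule D_cong[OF D_ex[where P = "\<lambda>x v. x = t v \<and> Q x v"]])
    (use assms in \<open>auto intro!: D_conj simp: Dt_def\<close>)

end

text \<open>
  Higher-order introduction rules that decide definability by recursion on the syntax of the
  predicate.  They have to be applied with \<open>intro\<close>; the classical reasoner loops on them.
\<close>

named_theorems dfn

section \<open>Transitive models of ZFC\<close>

text \<open>Transitivity lets a quantifier bounded by a set range over the whole type. Formulas with
  only such quantifiers then read the same in the ground model and in the larger one.\<close>

locale zf = model M E for M :: "'a set" and E (infix "\<epsilon>" 50) +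
  assumes trans: "x \<in> M \<Longrightarrow> y \<epsilon> x \<Longrightarrow> y \<in> M"
    and zfc: ZFC
begin

lemma zfc_axioms: extensionality foundation pairing union powerset infinity separation replacement choice
  using zfc unfolding ZFC_def by blast+

lemma ex_empty: "\<exists>z\<in>M. is_empty z"
  using zfc_axioms(6) unfolding infinity_def by blast

lemma set_ext: "x \<in> M \<Longrightarrow> y \<in> M \<Longrightarrow> (\<And>z. z \<epsilon> x \<longleftrightarrow> z \<epsilon> y) \<Longrightarrow> x = y"
  using zfc_axioms(1) unfolding extensionality_def by blast

definition zer :: 'a where "zer = (THE z. z \<in> M \<and> is_empty z)"

lemma zer: "zer \<in> M" "\<not> z \<epsilon> zer"
proof -
  obtain c where c: "c \<in> M" "is_empty c" using ex_empty by blast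
  then have "zer = c" unfolding zer_def
    by (intro the_equality) (auto intro!: set_ext simp: is_empty_def dest: trans)
  with c show "zer \<in> M" "\<not> z \<epsilon> zer" by (auto simp: is_empty_def dest: trans)
qed
declare zer [simp]

lemma Dt_var' [dfn]: "Dt (\<lambda>v. v i)" by (rule Dt_var[OF zer(1)])
lemma Dt_const' [dfn]: "c \<in> M \<Longrightarrow> Dt (\<lambda>v. c)" by (rule Dt_const)
lemmas [dfn] = D_neg D_conj D_disj D_imp D_iff D_all D_ex
lemma D_bool' [dfn]: "D (\<lambda>v. b)" by (rule D_bool) (use zer(1) in blast)

lemma D_comp2:
  assumes "D (\<lambda>v. R (v 0) (v (Suc 0)))" "Dt s" "Dt t"
  shows "D (\<lambda>v. R (s v) (t v))"
proof (rule D_comp[where t = t and Q = "\<lambda>x v. R (s v) x"])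
  show "D (\<lambda>v. R (s (\<lambda>n. v (Suc n))) (v 0))"
    by (rule D_comp[where t = "\<lambda>v. s (\<lambda>n. v (Suc n))" and Q = "\<lambda>x v. R x (v 0)"])
      (use assms Dt_shift in auto)
qed fact

lemma D_comp3:
  assumes "D (\<lambda>v. R (v 0) (v (Suc 0)) (v (Suc (Suc 0))))" "Dt s" "Dt t" "Dt u"
  shows "D (\<lambda>v. R (s v) (t v) (u v))"
proof (rule D_comp[where t = u and Q = "\<lambda>x v. R (s v) (t v) x"])
  show "D (\<lambda>v. R (s (\<lambda>n. v (Suc n))) (t (\<lambda>n. v (Suc n))) (v 0))"
  proof (rule D_comp[where t = "\<lambda>v. t (\<lambda>n. v (Suc n))" and Q = "\<lambda>x v. R (s (\<lambda>n. v (Suc n))) x (v 0)"])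
    show "D (\<lambda>v. R (s (\<lambda>n. v (Suc (Suc n)))) (v 0) (v (Suc 0)))"
      by (rule D_comp[where t = "\<lambda>v. s (\<lambda>n. v (Suc (Suc n)))" and Q = "\<lambda>x v. R x (v 0) (v (Suc 0))"])
       (use assms Dt_shift[OF Dt_shift[of s]] in auto)
  qed (use assms Dt_shift in auto)
qed fact

lemma Dt_comp1:
  assumes "Dt (\<lambda>v. F (v 0))" "Dt t" shows "Dt (\<lambda>v. F (t v))"
  unfolding Dt_def
proof (intro conjI allI impI)
  fix v :: "nat \<Rightarrow> 'a" assume "range v \<subseteq> M"
  then have "t v \<in> M" using assms(2) Dt_in by blast
  then show "F (t v) \<in> M" using Dt_in[OF assms(1), of "\<lambda>_. t v"] by auto
next
  have "D (\<lambda>v. v 0 = F (v (Suc 0)))" using assms(1) unfolding Dt_def by simp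
  from D_comp2[where R = "\<lambda>y x. y = F x", OF this Dt_var' Dt_shift[OF assms(2)]]
  show "D (\<lambda>v. v 0 = F (t (\<lambda>n. v (Suc n))))" .
qed

lemma Dt_comp2:
  assumes "Dt (\<lambda>v. F (v 0) (v (Suc 0)))" "Dt s" "Dt t" shows "Dt (\<lambda>v. F (s v) (t v))"
  unfolding Dt_def
proof (intro conjI allI impI)
  fix v :: "nat \<Rightarrow> 'a" assume "range v \<subseteq> M"
  then have "s v \<in> M" "t v \<in> M" using assms(2,3) Dt_in by blast+
  then show "F (s v) (t v) \<in> M" using Dt_in[OF assms(1), of "\<lambda>n. if n = 0 then s v else t v"] by auto
next
  have "D (\<lambda>v. v 0 = F (v (Suc 0)) (v (Suc (Suc 0))))" using assms(1) unfolding Dt_def by simp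
  from D_comp3[where R = "\<lambda>y x z. y = F x z", OF this Dt_var' Dt_shift[OF assms(2)] Dt_shift[OF assms(3)]]
  show "D (\<lambda>v. v 0 = F (s (\<lambda>n. v (Suc n))) (t (\<lambda>n. v (Suc n))))" .
qed

lemma D_mem [dfn]: "Dt s \<Longrightarrow> Dt t \<Longrightarrow> D (\<lambda>v. s v \<epsilon> t v)"
  by (rule D_comp2[where R = E, OF D_mem0[OF zer(1)]])
lemma D_eq [dfn]: "Dt s \<Longrightarrow> Dt t \<Longrightarrow> D (\<lambda>v. s v = t v)"
  by (rule D_comp2[where R = "(=)", OF D_eq0[OF zer(1)]])

lemma D_ball [dfn]:
  assumes "Dt t" "D (\<lambda>v. P (v 0) (\<lambda>n. v (Suc n)))"
  shows "D (\<lambda>v. \<forall>x. x \<epsilon> t v \<longrightarrow> P x v)"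
proof (rule D_cong)
  show "D (\<lambda>v. \<forall>x\<in>M. x \<epsilon> t v \<longrightarrow> P x v)" by (intro dfn assms Dt_shift)
  fix v :: "nat \<Rightarrow> 'a" assume "range v \<subseteq> M"
  with assms(1) have "t v \<in> M" by (rule Dt_in)
  then show "(\<forall>x\<in>M. x \<epsilon> t v \<longrightarrow> P x v) \<longleftrightarrow> (\<forall>x. x \<epsilon> t v \<longrightarrow> P x v)" using trans by blast
qed
lemma D_bex [dfn]:
  assumes "Dt t" "D (\<lambda>v. P (v 0) (\<lambda>n. v (Suc n)))"
  shows "D (\<lambda>v. \<exists>x. x \<epsilon> t v \<and> P x v)"
proof (rule D_cong)
  show "D (\<lambda>v. \<exists>x\<in>M. x \<epsilon> t v \<and> P x v)" by (intro dfn assms Dt_shift)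
  fix v :: "nat \<Rightarrow> 'a" assume "range v \<subseteq> M"
  with assms(1) have "t v \<in> M" by (rule Dt_in)
  then show "(\<exists>x\<in>M. x \<epsilon> t v \<and> P x v) \<longleftrightarrow> (\<exists>x. x \<epsilon> t v \<and> P x v)" using trans by blast
qed
lemma D_ex1 [dfn]:
  assumes "D (\<lambda>v. P (v 0) (\<lambda>n. v (Suc n)))"
  shows "D (\<lambda>v. \<exists>!x. x \<in> M \<and> P x v)"
proof (rule D_cong)
  \<comment> \<open>Position 1 is left free for the second bound variable.\<close>
  define f where "f n = (case n of 0 \<Rightarrow> 0 | Suc m \<Rightarrow> Suc (Suc m))" for n :: nat
  have "inj f" by (auto simp: f_def inj_def split: nat.splits)
  from D_ren[OF assms this] have "D (\<lambda>v. P (v 0) (\<lambda>n. v (Suc (Suc n))))" by (simp add: f_def)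
  then show "D (\<lambda>v. \<exists>x\<in>M. P x v \<and> (\<forall>y\<in>M. P y v \<longrightarrow> y = x))"
    by (intro dfn assms)
qed blast

lemma Dt_if [dfn]:
  assumes "D P" "Dt s" "Dt t" shows "Dt (\<lambda>v. if P v then s v else t v)"
  unfolding Dt_def
proof (intro conjI allI impI)
  have "D (\<lambda>v. P (\<lambda>n. v (Suc n)))" using D_ren[OF assms(1), of Suc] by simp
  then show "D (\<lambda>v. v 0 = (if P (\<lambda>n. v (Suc n)) then s (\<lambda>n. v (Suc n)) else t (\<lambda>n. v (Suc n))))"
    unfolding if_distrib[where f = "(=) _"] if_bool_eq_conj
    by (intro dfn assms(2,3)[THEN Dt_shift])
next
  fix v :: "nat \<Rightarrow> 'a" assume "range v \<subseteq> M"
  then show "(if P v then s v else t v) \<in> M" using Dt_in[OF assms(2)] Dt_in[OF assms(3)] by simp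
qed

text \<open>
  Definite description, with the empty set as junk value; so every term built from it lies in \<open>M\<close>.
\<close>

definition tht :: "('a \<Rightarrow> bool) \<Rightarrow> 'a" where
  "tht P = (if \<exists>!x. x \<in> M \<and> P x then THE x. x \<in> M \<and> P x else zer)"

lemma tht_in [simp]: "tht P \<in> M"
proof (cases "\<exists>!x. x \<in> M \<and> P x")
  case True
  from theI'[OF this] True show ?thesis unfolding tht_def by simp
qed (simp add: tht_def)

lemma tht_eq: "x \<in> M \<Longrightarrow> P x \<Longrightarrow> (\<And>y. y \<in> M \<Longrightarrow> P y \<Longrightarrow> y = x) \<Longrightarrow> tht P = x"
proof -
  assume *: "x \<in> M" "P x" "\<And>y. y \<in> M \<Longrightarrow> P y \<Longrightarrow> y = x"
  then have "\<exists>!x. x \<in> M \<and> P x" by blast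
  moreover have "(THE x. x \<in> M \<and> P x) = x" using * by (intro the_equality) blast+
  ultimately show ?thesis unfolding tht_def by simp
qed

lemma Dt_tht [dfn]:
  assumes "D (\<lambda>v. P (v 0) (\<lambda>n. v (Suc n)))" shows "Dt (\<lambda>v. tht (\<lambda>x. P x v))"
  unfolding Dt_def
proof (intro conjI allI impI)
  define f where "f n = (case n of 0 \<Rightarrow> 0 | Suc m \<Rightarrow> Suc (Suc m))" for n :: nat
  have "inj f" by (auto simp: f_def inj_def split: nat.splits)
  from D_ren[OF assms this] have 2: "D (\<lambda>v. P (v 0) (\<lambda>n. v (Suc (Suc n))))" by (simp add: f_def)
  show "D (\<lambda>v. v 0 = tht (\<lambda>x. P x (\<lambda>n. v (Suc n))))"
  proof (rule D_cong)
    show "D (\<lambda>v. ((\<exists>!x. x \<in> M \<and> P x (\<lambda>n. v (Suc n))) \<and> P (v 0) (\<lambda>n. v (Suc n))) \<or>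
      (\<not> (\<exists>!x. x \<in> M \<and> P x (\<lambda>n. v (Suc n))) \<and> v 0 = zer))"
      by (intro dfn assms 2) simp
  next
    fix v :: "nat \<Rightarrow> 'a" assume "range v \<subseteq> M"
    then have v: "v 0 \<in> M" by auto
    let ?P = "\<lambda>x. x \<in> M \<and> P x (\<lambda>n. v (Suc n))"
    show "(Ex1 ?P \<and> P (v 0) (\<lambda>n. v (Suc n)) \<or> \<not> Ex1 ?P \<and> v 0 = zer) \<longleftrightarrow> (v 0 = tht (\<lambda>x. P x (\<lambda>n. v (Suc n))))"
    proof (cases "Ex1 ?P")
      case True
      then have "?P (The ?P)" by (rule theI')
      with True v show ?thesis unfolding tht_def by auto
    next
      case False
      then show ?thesis unfolding tht_def by auto
    qed
  qed
qed simp

section \<open>Set-building operations from the axioms of ZFC\<close>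

definition collect :: "'a \<Rightarrow> ('a \<Rightarrow> bool) \<Rightarrow> 'a" where
  "collect A P = tht (\<lambda>B. \<forall>x\<in>M. x \<epsilon> B \<longleftrightarrow> x \<epsilon> A \<and> P x)"
definition repl :: "'a \<Rightarrow> ('a \<Rightarrow> 'a) \<Rightarrow> 'a" where
  "repl A F = tht (\<lambda>B. \<forall>y\<in>M. y \<epsilon> B \<longleftrightarrow> (\<exists>x. x \<epsilon> A \<and> y = F x))"
definition upair :: "'a \<Rightarrow> 'a \<Rightarrow> 'a" where "upair x y = tht (\<lambda>p. is_upair p x y)"
definition pow :: "'a \<Rightarrow> 'a" where "pow x = tht (\<lambda>p. \<forall>z\<in>M. z \<epsilon> p \<longleftrightarrow> sub z x)"
definition Uni :: "'a \<Rightarrow> 'a" where "Uni x = tht (\<lambda>u. \<forall>z\<in>M. z \<epsilon> u \<longleftrightarrow> (\<exists>y. y \<epsilon> x \<and> z \<epsilon> y))"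
definition suc :: "'a \<Rightarrow> 'a" where "suc x = tht (\<lambda>s. is_succ s x)"
definition opair :: "'a \<Rightarrow> 'a \<Rightarrow> 'a" where "opair x y = upair (upair x x) (upair x y)"
definition ap :: "'a \<Rightarrow> 'a \<Rightarrow> 'a" where "ap f x = tht (\<lambda>y. app f x y)"
definition lam :: "'a \<Rightarrow> ('a \<Rightarrow> 'a) \<Rightarrow> 'a" where "lam A F = repl A (\<lambda>x. opair x (F x))"

lemma in_M [simp]: "collect A P \<in> M" "repl A F \<in> M" "upair x y \<in> M" "pow x \<in> M" "Uni x \<in> M"
  "suc x \<in> M" "opair x y \<in> M" "ap f x \<in> M" "lam A F \<in> M"
  by (simp_all add: collect_def repl_def upair_def pow_def Uni_def suc_def opair_def ap_def lam_def)

lemma mem_tht: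
  assumes "x \<in> M" "\<And>z. z \<in> M \<Longrightarrow> z \<epsilon> x \<longleftrightarrow> P z"
  shows "tht (\<lambda>B. \<forall>z\<in>M. z \<epsilon> B \<longleftrightarrow> P z) = x"
  by (rule tht_eq) (use assms in \<open>auto intro!: set_ext dest: trans\<close>)

lemma mem_collect:
  assumes P: "D (\<lambda>v. P (v 0))" and A: "A \<in> M"
  shows "x \<epsilon> collect A P \<longleftrightarrow> x \<epsilon> A \<and> P x"
proof -
  from P obtain p w where w: "range w \<subseteq> M" and
    p: "\<And>v. range v \<subseteq> M \<Longrightarrow> P (v 0) = sat M E (env v w) p" unfolding D_def by blast
  have "range (env (\<lambda>_. zer) w) \<subseteq> M" using w by (auto simp: env_def)
  then obtain B where B: "B \<in> M" "\<forall>x\<in>M. x \<epsilon> B \<longleftrightarrow> x \<epsilon> A \<and> sat M E ((env (\<lambda>_. zer) w)(0 := x)) p"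
    using zfc_axioms(7) A unfolding separation_def by blast
  have "sat M E ((env (\<lambda>_. zer) w)(0 := x)) p = P x" if "x \<in> M" for x
  proof -
    have "(env (\<lambda>_. zer) w)(0 := x) = env ((\<lambda>_. zer)(0 := x)) w" by (auto simp: env_def fun_eq_iff)
    moreover have "range ((\<lambda>_. zer)(0 := x)) \<subseteq> M" using that by auto
    from p[OF this] have "P x = sat M E (env ((\<lambda>_. zer)(0 := x)) w) p" by simp
    ultimately show ?thesis by simp
  qed
  then have "collect A P = B" unfolding collect_def using B by (intro mem_tht) auto
  then show ?thesis using B A trans \<open>\<And>x. x \<in> M \<Longrightarrow> sat M E ((env (\<lambda>_. zer) w)(0 := x)) p = P x\<close> by blast
qed

lemma mem_repl:
  assumes F: "Dt (\<lambda>v. F (v 0))" and A: "A \<in> M"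
  shows "y \<epsilon> repl A F \<longleftrightarrow> (\<exists>x. x \<epsilon> A \<and> y = F x)"
proof -
  have FM: "F x \<in> M" if "x \<in> M" for x using Dt_in[OF F, of "\<lambda>_. x"] that by auto
  have "D (\<lambda>v. v 0 = F (v 1))" using F unfolding Dt_def by simp
  then obtain p w where w: "range w \<subseteq> M" and
    p: "\<And>v. range v \<subseteq> M \<Longrightarrow> v 0 = F (v 1) \<longleftrightarrow> sat M E (env v w) p" unfolding D_def by blast
  \<comment> \<open>The axiom puts the argument at index 0 and the value at 1; \<open>p\<close> has
    the value at 0, the argument at 2 and the parameter \<open>w 0\<close> at 1. The permutation
    \<open>f\<close> matches the two layouts, and \<open>u\<close> keeps that parameter at
    2.\<close>
  define f :: "nat \<Rightarrow> nat" where "f = id(0 := 1, 2 := 0, 1 := 2)"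
  have f: "inj f" by (auto simp: f_def inj_def)
  define u where "u = (env (\<lambda>_. zer) w)(2 := w 0)"
  have u: "range u \<subseteq> M" using w by (auto simp: u_def env_def)
  have *: "sat M E (u(0 := x, 1 := y)) (ren f p) \<longleftrightarrow> y = F x" if "x \<in> M" "y \<in> M" for x y
  proof -
    have "(u(0 := x, 1 := y)) (f n) = env ((\<lambda>_. zer)(0 := y, 1 := x)) w n" for n
      by (auto simp: env_def u_def f_def elim!: oddE)
    then have "(\<lambda>n. (u(0 := x, 1 := y)) (f n)) = env ((\<lambda>_. zer)(0 := y, 1 := x)) w" by blast
    moreover have "range ((\<lambda>_. zer)(0 := y, 1 := x)) \<subseteq> M" using that by auto
    from p[OF this] have "y = F x \<longleftrightarrow> sat M E (env ((\<lambda>_. zer)(0 := y, 1 := x)) w) p" by simp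
    ultimately show ?thesis by (simp add: sat_ren[OF f])
  qed
  have "\<exists>B\<in>M. \<forall>y\<in>M. y \<epsilon> B \<longleftrightarrow> (\<exists>x\<in>M. x \<epsilon> A \<and> sat M E (u(0 := x, 1 := y)) (ren f p))"
    by (rule zfc_axioms(8)[unfolded replacement_def, rule_format, OF u A]) (metis *)
  then obtain B where B: "B \<in> M" "\<forall>y\<in>M. y \<epsilon> B \<longleftrightarrow> (\<exists>x\<in>M. x \<epsilon> A \<and> y = F x)"
    using * by (metis (no_types, lifting))
  then have B': "y \<epsilon> B \<longleftrightarrow> (\<exists>x. x \<epsilon> A \<and> y = F x)" for y using A trans FM by metis
  then have "repl A F = B" unfolding repl_def using B(1) by (intro mem_tht) auto
  then show ?thesis using B' by simp
qed

lemma sub_iff: "x \<in> M \<Longrightarrow> sub x y \<longleftrightarrow> (\<forall>z. z \<epsilon> x \<longrightarrow> z \<epsilon> y)"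
  unfolding sub_def using trans by blast

lemma mem_upair [simp]: "x \<in> M \<Longrightarrow> y \<in> M \<Longrightarrow> z \<epsilon> upair x y \<longleftrightarrow> z = x \<or> z = y"
proof -
  assume a: "x \<in> M" "y \<in> M"
  then obtain p where p: "p \<in> M" "\<forall>z\<in>M. z \<epsilon> p \<longleftrightarrow> z = x \<or> z = y"
    using zfc_axioms(3) unfolding pairing_def is_upair_def by blast
  then have "upair x y = p" unfolding upair_def is_upair_def by (intro mem_tht) auto
  then show ?thesis using p a trans by blast
qed

lemma mem_pow: "x \<in> M \<Longrightarrow> z \<epsilon> pow x \<longleftrightarrow> z \<in> M \<and> (\<forall>y. y \<epsilon> z \<longrightarrow> y \<epsilon> x)"
proof -
  assume a: "x \<in> M"
  then obtain p where p: "p \<in> M" "\<forall>z\<in>M. z \<epsilon> p \<longleftrightarrow> sub z x"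
    using zfc_axioms(5) unfolding powerset_def by blast
  then have "pow x = p" unfolding pow_def by (intro mem_tht) auto
  then show ?thesis using p a trans sub_iff by blast
qed

lemma mem_Uni: "x \<in> M \<Longrightarrow> z \<epsilon> Uni x \<longleftrightarrow> (\<exists>y. y \<epsilon> x \<and> z \<epsilon> y)"
proof -
  assume a: "x \<in> M"
  then obtain p where p: "p \<in> M" "\<forall>z\<in>M. z \<epsilon> p \<longleftrightarrow> (\<exists>y. y \<epsilon> x \<and> z \<epsilon> y)"
  proof -
    obtain u where "u \<in> M" "\<forall>z\<in>M. z \<epsilon> u \<longleftrightarrow> (\<exists>y\<in>M. y \<epsilon> x \<and> z \<epsilon> y)"
      using zfc_axioms(4) a unfolding union_def by blast
    then show ?thesis using that trans[OF a] by blast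
  qed
  then have "Uni x = p" unfolding Uni_def by (intro mem_tht) auto
  then show ?thesis using p a trans by blast
qed

lemma is_upair_iff: "p \<in> M \<Longrightarrow> x \<in> M \<Longrightarrow> y \<in> M \<Longrightarrow> is_upair p x y \<longleftrightarrow> p = upair x y"
  unfolding is_upair_def by (auto intro!: set_ext dest: trans)

lemma is_opair_iff: "p \<in> M \<Longrightarrow> x \<in> M \<Longrightarrow> y \<in> M \<Longrightarrow> is_opair p x y \<longleftrightarrow> p = opair x y"
  unfolding is_opair_def opair_def by (auto simp: is_upair_iff)

lemma mem_suc [simp]: "x \<in> M \<Longrightarrow> z \<epsilon> suc x \<longleftrightarrow> z \<epsilon> x \<or> z = x"
proof -
  assume a: "x \<in> M"
  have "suc x = Uni (upair x (upair x x))" unfolding suc_def is_succ_def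
    by (rule mem_tht) (use a in \<open>auto simp: mem_Uni\<close>)
  then show ?thesis using a by (auto simp: mem_Uni)
qed

lemma is_succ_iff: "s \<in> M \<Longrightarrow> x \<in> M \<Longrightarrow> is_succ s x \<longleftrightarrow> s = suc x"
proof -
  assume *: "s \<in> M" "x \<in> M"
  have "is_succ s x \<longleftrightarrow> (\<forall>z. z \<epsilon> s \<longleftrightarrow> z \<epsilon> suc x)"
    unfolding is_succ_def mem_suc[OF *(2)] using * trans by blast
  also have "\<dots> \<longleftrightarrow> s = suc x" using set_ext[OF *(1) in_M(6)] by blast
  finally show ?thesis .
qed

lemma upair_inj: "x \<in> M \<Longrightarrow> y \<in> M \<Longrightarrow> x' \<in> M \<Longrightarrow> y' \<in> M \<Longrightarrow> upair x y = upair x' y' \<Longrightarrow>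
  (x = x' \<and> y = y') \<or> (x = y' \<and> y = x')"
proof -
  assume a: "x \<in> M" "y \<in> M" "x' \<in> M" "y' \<in> M" "upair x y = upair x' y'"
  then have "z = x \<or> z = y \<longleftrightarrow> z = x' \<or> z = y'" for z using mem_upair[of x y z] mem_upair[of x' y' z] by simp
  from this[of x] this[of y] this[of x'] this[of y'] show ?thesis by auto
qed

lemma opair_inj [simp]: "x \<in> M \<Longrightarrow> y \<in> M \<Longrightarrow> x' \<in> M \<Longrightarrow> y' \<in> M \<Longrightarrow> opair x y = opair x' y' \<longleftrightarrow> x = x' \<and> y = y'"
proof -
  assume a: "x \<in> M" "y \<in> M" "x' \<in> M" "y' \<in> M"
  have "x = x' \<and> y = y'" if "opair x y = opair x' y'"
  proof -
    from upair_inj[OF _ _ _ _ that[unfolded opair_def]]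
    have "upair x x = upair x' x' \<and> upair x y = upair x' y' \<or> upair x x = upair x' y' \<and> upair x y = upair x' x'"
      by simp
    then show ?thesis
    proof
      assume "upair x x = upair x' x' \<and> upair x y = upair x' y'"
      with upair_inj[of x x x' x'] upair_inj[of x y x' y'] a show ?thesis by auto
    next
      assume "upair x x = upair x' y' \<and> upair x y = upair x' x'"
      with upair_inj[of x x x' y'] upair_inj[of x y x' x'] a show ?thesis by auto
    qed
  qed
  then show ?thesis by auto
qed

abbreviation dfun :: "('a \<Rightarrow> 'a) \<Rightarrow> bool" where "dfun F \<equiv> Dt (\<lambda>v. F (v 0))"
abbreviation dfun2 :: "('a \<Rightarrow> 'a \<Rightarrow> 'a) \<Rightarrow> bool" where "dfun2 F \<equiv> Dt (\<lambda>v. F (v 0) (v (Suc 0)))"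
abbreviation dpred :: "('a \<Rightarrow> bool) \<Rightarrow> bool" where "dpred P \<equiv> D (\<lambda>v. P (v 0))"
abbreviation dpred2 :: "('a \<Rightarrow> 'a \<Rightarrow> bool) \<Rightarrow> bool" where "dpred2 P \<equiv> D (\<lambda>v. P (v 0) (v (Suc 0)))"

lemma D_comp1: "dpred P \<Longrightarrow> Dt t \<Longrightarrow> D (\<lambda>v. P (t v))"
  by (rule D_comp[where Q = "\<lambda>x v. P x"])

lemma dfun_in: "dfun F \<Longrightarrow> x \<in> M \<Longrightarrow> F x \<in> M"
  using Dt_in[of "\<lambda>v. F (v 0)" "\<lambda>_. x"] by auto

lemma inj_insert_vars: "inj (\<lambda>n. case n of 0 \<Rightarrow> 0 | Suc m \<Rightarrow> Suc (k + m))"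
proof (rule injI)
  fix m n assume "(case m of 0 \<Rightarrow> 0 | Suc m \<Rightarrow> Suc (k + m)) = (case n of 0 \<Rightarrow> 0 | Suc m \<Rightarrow> Suc (k + m))"
  then show "m = n" by (cases m; cases n) auto
qed

lemma D_lift: "D (\<lambda>v. P (v 0) (\<lambda>n. v (Suc n))) \<Longrightarrow> D (\<lambda>v. P (v 0) (\<lambda>n. v (Suc (Suc n))))"
  by (drule D_ren[OF _ inj_insert_vars[of 1]]) simp

lemma Dt_lift: "Dt (\<lambda>v. F (v 0) (\<lambda>n. v (Suc n))) \<Longrightarrow> Dt (\<lambda>v. F (v 0) (\<lambda>n. v (Suc (Suc (Suc n)))))"
  by (drule Dt_ren[OF _ inj_insert_vars[of 2]]) simp

lemma Dt_collect [dfn]: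
  assumes "Dt A" "D (\<lambda>v. P (v 0) (\<lambda>n. v (Suc n)))"
  shows "Dt (\<lambda>v. collect (A v) (\<lambda>x. P x v))"
  unfolding collect_def by (intro dfn Dt_shift assms(1) D_lift[OF assms(2)])

lemma Dt_repl [dfn]:
  assumes "Dt A" "Dt (\<lambda>v. F (v 0) (\<lambda>n. v (Suc n)))"
  shows "Dt (\<lambda>v. repl (A v) (\<lambda>x. F x v))"
  unfolding repl_def by (intro dfn Dt_shift assms(1) Dt_lift[OF assms(2)])

lemma D_sub [dfn]: "Dt s \<Longrightarrow> Dt t \<Longrightarrow> D (\<lambda>v. sub (s v) (t v))"
  by (rule D_comp2) (unfold sub_def, intro dfn)

lemma D_is_upair [dfn]: "Dt s \<Longrightarrow> Dt t \<Longrightarrow> Dt u \<Longrightarrow> D (\<lambda>v. is_upair (s v) (t v) (u v))"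
  by (rule D_comp3) (unfold is_upair_def, intro dfn)
lemma D_is_opair [dfn]: "Dt s \<Longrightarrow> Dt t \<Longrightarrow> Dt u \<Longrightarrow> D (\<lambda>v. is_opair (s v) (t v) (u v))"
  by (rule D_comp3) (unfold is_opair_def, intro dfn)
lemma D_is_succ [dfn]: "Dt s \<Longrightarrow> Dt t \<Longrightarrow> D (\<lambda>v. is_succ (s v) (t v))"
  by (rule D_comp2) (unfold is_succ_def, intro dfn)
lemma D_app [dfn]: "Dt s \<Longrightarrow> Dt t \<Longrightarrow> Dt u \<Longrightarrow> D (\<lambda>v. app (s v) (t v) (u v))"
  by (rule D_comp3) (unfold app_def, intro dfn)
lemma D_is_fun [dfn]: "Dt s \<Longrightarrow> Dt t \<Longrightarrow> Dt u \<Longrightarrow> D (\<lambda>v. is_fun (s v) (t v) (u v))"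
  by (rule D_comp3) (unfold is_fun_def, intro dfn)
lemma D_is_bij [dfn]: "Dt s \<Longrightarrow> Dt t \<Longrightarrow> Dt u \<Longrightarrow> D (\<lambda>v. is_bij (s v) (t v) (u v))"
  by (rule D_comp3) (unfold is_bij_def, intro dfn)
lemma D_equipotent [dfn]: "Dt s \<Longrightarrow> Dt t \<Longrightarrow> D (\<lambda>v. equipotent (s v) (t v))"
  by (rule D_comp2) (unfold equipotent_def, intro dfn)
lemma D_trans_set [dfn]: "Dt s \<Longrightarrow> D (\<lambda>v. trans_set (s v))"
  by (rule D_comp1) (unfold trans_set_def, intro dfn)
lemma D_is_ord [dfn]: "Dt s \<Longrightarrow> D (\<lambda>v. is_ord (s v))"
  by (rule D_comp1) (unfold is_ord_def, intro dfn)

lemma Dt_upair [dfn]: "Dt s \<Longrightarrow> Dt t \<Longrightarrow> Dt (\<lambda>v. upair (s v) (t v))"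
  by (rule Dt_comp2) (unfold upair_def, intro dfn)

lemma Dt_suc [dfn]: "Dt s \<Longrightarrow> Dt (\<lambda>v. suc (s v))"
  by (rule Dt_comp1) (unfold suc_def, intro dfn)
lemma Dt_opair [dfn]: "Dt s \<Longrightarrow> Dt t \<Longrightarrow> Dt (\<lambda>v. opair (s v) (t v))"
  unfolding opair_def by (intro dfn)
lemma Dt_ap [dfn]: "Dt s \<Longrightarrow> Dt t \<Longrightarrow> Dt (\<lambda>v. ap (s v) (t v))"
  by (rule Dt_comp2) (unfold ap_def, intro dfn)
lemma Dt_lam [dfn]:
  assumes "Dt A" "Dt (\<lambda>v. F (v 0) (\<lambda>n. v (Suc n)))"
  shows "Dt (\<lambda>v. lam (A v) (\<lambda>x. F x v))"
  unfolding lam_def by (intro dfn assms)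

section \<open>Functions\<close>

text \<open>The extension of a set of the model as a set of the logic, so that
  \<open>bij_betw\<close>, \<open>inj_on\<close> and images from the library apply.\<close>

definition el :: "'a \<Rightarrow> 'a set" where "el A = {x. x \<epsilon> A}"

lemma mem_el [simp]: "x \<in> el A \<longleftrightarrow> x \<epsilon> A" by (simp add: el_def)

lemma app_iff: "f \<in> M \<Longrightarrow> x \<in> M \<Longrightarrow> y \<in> M \<Longrightarrow> app f x y \<longleftrightarrow> opair x y \<epsilon> f"
  unfolding app_def by (auto simp: is_opair_iff)

lemma ap_eq:
  assumes "y \<in> M" "app f x y" "\<And>z. z \<in> M \<Longrightarrow> app f x z \<Longrightarrow> z = y"
  shows "ap f x = y"
  unfolding ap_def by (rule tht_eq) (fact assms)+

lemma app_lam: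
  assumes "dfun F" "A \<in> M" "x \<in> M" "y \<in> M"
  shows "app (lam A F) x y \<longleftrightarrow> x \<epsilon> A \<and> y = F x"
proof -
  have "dfun (\<lambda>x. opair x (F x))" by (intro dfn assms)
  from mem_repl[OF this assms(2)] have "opair x y \<epsilon> lam A F \<longleftrightarrow> (\<exists>z. z \<epsilon> A \<and> opair x y = opair z (F z))"
    by (simp add: lam_def)
  also have "\<dots> \<longleftrightarrow> (\<exists>z. z \<epsilon> A \<and> x = z \<and> y = F z)"
    using opair_inj[OF assms(3,4) _ dfun_in[OF assms(1)]] trans[OF assms(2)] by auto
  finally show ?thesis using app_iff[OF in_M(9) assms(3,4)] by auto
qed

lemma ap_lam [simp]: "dfun F \<Longrightarrow> A \<in> M \<Longrightarrow> x \<epsilon> A \<Longrightarrow> ap (lam A F) x = F x"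
proof -
  assume *: "dfun F" "A \<in> M" "x \<epsilon> A"
  then have "x \<in> M" "F x \<in> M" using trans dfun_in[OF *(1)] by blast+
  then show ?thesis using app_lam[OF *(1,2)] *(3) by (intro ap_eq) simp_all
qed

lemma is_fun_app:
  assumes "is_fun f A B" "f \<in> M" "A \<in> M" "x \<epsilon> A"
  shows "app f x (ap f x)" "\<And>y. y \<in> M \<Longrightarrow> app f x y \<longleftrightarrow> y = ap f x"
proof -
  have x: "x \<in> M" using trans assms by blast
  then obtain y where y: "y \<in> M" "app f x y" "\<And>z. z \<in> M \<Longrightarrow> app f x z \<Longrightarrow> z = y"
    using assms unfolding is_fun_def by blast
  then have "ap f x = y" by (rule ap_eq)
  then show "app f x (ap f x)" using y(2) by simp
  fix z assume "z \<in> M"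
  then show "app f x z \<longleftrightarrow> z = ap f x" using y \<open>ap f x = y\<close> by blast
qed

lemma is_fun_dom:
  assumes "is_fun f A B" "f \<in> M" "x \<in> M" "y \<in> M" "app f x y" "A \<in> M" "B \<in> M"
  shows "x \<epsilon> A" "y \<epsilon> B"
proof -
  have "opair x y \<epsilon> f" using app_iff assms by blast
  then obtain x' y' where "x' \<in> M" "y' \<in> M" "x' \<epsilon> A" "y' \<epsilon> B" "is_opair (opair x y) x' y'"
    using assms(1) unfolding is_fun_def by (meson in_M(7))
  then show "x \<epsilon> A" "y \<epsilon> B" using is_opair_iff assms by auto
qed

lemma is_fun_ap: "is_fun f A B \<Longrightarrow> f \<in> M \<Longrightarrow> A \<in> M \<Longrightarrow> B \<in> M \<Longrightarrow> x \<epsilon> A \<Longrightarrow> ap f x \<epsilon> B"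
  using is_fun_dom(2)[OF _ _ _ in_M(8) is_fun_app(1)] trans by blast

lemma is_fun_lam:
  assumes "dfun F" "A \<in> M" "B \<in> M" "\<And>x. x \<epsilon> A \<Longrightarrow> F x \<epsilon> B"
  shows "is_fun (lam A F) A B"
  unfolding is_fun_def
proof (intro conjI ballI impI)
  fix p assume "p \<in> M" "p \<epsilon> lam A F"
  have d: "dfun (\<lambda>x. opair x (F x))" by (intro dfn assms)
  from \<open>p \<epsilon> lam A F\<close> obtain x where "x \<epsilon> A" "p = opair x (F x)"
    unfolding lam_def mem_repl[OF d assms(2)] by blast
  moreover from this(1) have "x \<in> M" by (rule trans[OF assms(2)])
  moreover from this have "F x \<in> M" by (rule dfun_in[OF assms(1)])
  ultimately show "\<exists>x\<in>M. \<exists>y\<in>M. x \<epsilon> A \<and> y \<epsilon> B \<and> is_opair p x y"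
    using assms(4)[of x] is_opair_iff[of p x "F x"] \<open>p \<in> M\<close> by auto
next
  fix x assume "x \<in> M" "x \<epsilon> A"
  then show "\<exists>!y. y \<in> M \<and> app (lam A F) x y"
    using app_lam[OF assms(1,2) \<open>x \<in> M\<close>] dfun_in[OF assms(1) \<open>x \<in> M\<close>] by auto
qed

text \<open>A normal form for functions that are sets: two of them with the same domain are equal
  once their values agree.\<close>

lemma is_fun_eq_lam:
  assumes "is_fun f A B" "f \<in> M" "A \<in> M" "B \<in> M"
  shows "f = lam A (ap f)"
proof (rule set_ext)
  have d: "dfun (ap f)" "dfun (\<lambda>x. opair x (ap f x))" by (intro dfn assms)+
  fix p
  show "p \<epsilon> f \<longleftrightarrow> p \<epsilon> lam A (ap f)"
  proof
    assume p: "p \<epsilon> f"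
    then have pM: "p \<in> M" by (rule trans[OF assms(2)])
    obtain x y where xy: "x \<in> M" "y \<in> M" "x \<epsilon> A" "y \<epsilon> B" "is_opair p x y"
      using assms(1) p pM unfolding is_fun_def by blast
    then have pe: "p = opair x y" using is_opair_iff[OF pM] by blast
    then have "app f x y" using p app_iff[OF assms(2) xy(1,2)] by simp
    then have "y = ap f x" using is_fun_app(2)[OF assms(1-3) xy(3,2)] by simp
    then show "p \<epsilon> lam A (ap f)" unfolding lam_def mem_repl[OF d(2) assms(3)] using xy(3) pe by auto
  next
    assume "p \<epsilon> lam A (ap f)"
    then obtain x where x: "x \<epsilon> A" "p = opair x (ap f x)"
      unfolding lam_def mem_repl[OF d(2) assms(3)] by blast
    then show "p \<epsilon> f"
      using is_fun_app(1)[OF assms(1-3) x(1)] app_iff[OF assms(2) trans[OF assms(3) x(1)] in_M(8)] by simp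
  qed
qed (use assms in auto)

lemma lam_cong:
  assumes "dfun F" "dfun G" "A \<in> M" "\<And>x. x \<epsilon> A \<Longrightarrow> F x = G x"
  shows "lam A F = lam A G"
proof (rule set_ext)
  have d: "dfun (\<lambda>x. opair x (F x))" "dfun (\<lambda>x. opair x (G x))" by (intro dfn assms)+
  fix p show "p \<epsilon> lam A F \<longleftrightarrow> p \<epsilon> lam A G"
    unfolding lam_def mem_repl[OF d(1) assms(3)] mem_repl[OF d(2) assms(3)] using assms(4) by auto
qed auto

lemma is_bij_iff:
  assumes "f \<in> M" "A \<in> M" "B \<in> M"
  shows "is_bij f A B \<longleftrightarrow> is_fun f A B \<and> bij_betw (ap f) (el A) (el B)"
proof (cases "is_fun f A B")
  case True
  have a: "app f x y \<longleftrightarrow> x \<epsilon> A \<and> y = ap f x" if "x \<in> M" "y \<in> M" for x y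
    using is_fun_app(2)[OF True assms(1,2)] is_fun_dom(1)[OF True assms(1)] assms that by blast
  have b: "x \<in> M \<and> app f x y \<longleftrightarrow> x \<epsilon> A \<and> y = ap f x" if "y \<in> M" for x y
    using a[OF _ that] trans[OF assms(2)] by blast
  have "(\<forall>y\<in>M. y \<epsilon> B \<longrightarrow> (\<exists>!x. x \<in> M \<and> app f x y)) \<longleftrightarrow> (\<forall>y\<in>M. y \<epsilon> B \<longrightarrow> (\<exists>!x. x \<epsilon> A \<and> y = ap f x))"
    by (rule ball_cong[OF refl]) (simp only: b)
  also have "\<dots> \<longleftrightarrow> (\<forall>y. y \<epsilon> B \<longrightarrow> (\<exists>!x. x \<epsilon> A \<and> y = ap f x))"
    using trans[OF assms(3)] by blast
  also have "\<dots> \<longleftrightarrow> bij_betw (ap f) (el A) (el B)"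
  proof
    assume R: "\<forall>y. y \<epsilon> B \<longrightarrow> (\<exists>!x. x \<epsilon> A \<and> y = ap f x)"
    have "inj_on (ap f) (el A)"
    proof (rule inj_onI)
      fix x x' assume x: "x \<in> el A" "x' \<in> el A" "ap f x = ap f x'"
      then have "ap f x \<epsilon> B" using is_fun_ap[OF True assms] by simp
      with R have "\<exists>!z. z \<epsilon> A \<and> ap f x = ap f z" by blast
      then show "x = x'" using x unfolding mem_el by metis
    qed
    moreover have "ap f ` el A = el B"
    proof (intro equalityI subsetI)
      fix y assume "y \<in> ap f ` el A"
      then show "y \<in> el B" using is_fun_ap[OF True assms] by auto
    next
      fix y assume "y \<in> el B"
      then obtain x where "x \<epsilon> A" "y = ap f x" using R unfolding mem_el by blast
      then show "y \<in> ap f ` el A" by auto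
    qed
    ultimately show "bij_betw (ap f) (el A) (el B)" unfolding bij_betw_def by blast
  next
    assume R: "bij_betw (ap f) (el A) (el B)"
    show "\<forall>y. y \<epsilon> B \<longrightarrow> (\<exists>!x. x \<epsilon> A \<and> y = ap f x)"
    proof (intro allI impI)
      fix y assume "y \<epsilon> B"
      then have "y \<in> ap f ` el A" using R by (simp add: bij_betw_def)
      then obtain x where "x \<epsilon> A" "y = ap f x" by auto
      moreover have "x' = x" if "x' \<epsilon> A" "y = ap f x'" for x'
        using inj_onD[OF bij_betw_imp_inj_on[OF R], of x' x] that calculation by simp
      ultimately show "\<exists>!x. x \<epsilon> A \<and> y = ap f x" by blast
    qed
  qed
  finally show ?thesis using True unfolding is_bij_def by blast
qed (simp add: is_bij_def)

text \<open>Replacement turns a definable bijection between two sets into a set.\<close>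

lemma equipotentI:
  assumes "dfun F" "A \<in> M" "B \<in> M" "bij_betw F (el A) (el B)"
  shows "equipotent A B"
proof -
  have "bij_betw (ap (lam A F)) (el A) (el B)"
    using assms(4) bij_betw_cong[of "el A" F "ap (lam A F)"] ap_lam[OF assms(1,2)] by simp
  moreover have "is_fun (lam A F) A B"
    using bij_betwE[OF assms(4)] by (intro is_fun_lam assms(1-3)) simp
  ultimately show ?thesis unfolding equipotent_def using is_bij_iff[OF in_M(9) assms(2,3)] in_M(9) by blast
qed

lemma equipotentE:
  assumes "equipotent A B" "A \<in> M" "B \<in> M"
  obtains f where "f \<in> M" "is_fun f A B" "bij_betw (ap f) (el A) (el B)"
proof -
  from assms(1) obtain f where "f \<in> M" "is_bij f A B" unfolding equipotent_def by blast
  then show ?thesis using that is_bij_iff[of f A B] assms(2,3) by simp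
qed

definition finv :: "'a \<Rightarrow> ('a \<Rightarrow> 'a) \<Rightarrow> 'a \<Rightarrow> 'a" where
  "finv A F y = tht (\<lambda>x. x \<epsilon> A \<and> F x = y)"

lemma finv_eq: "A \<in> M \<Longrightarrow> inj_on F (el A) \<Longrightarrow> x \<epsilon> A \<Longrightarrow> finv A F (F x) = x"
  unfolding finv_def by (rule tht_eq) (auto dest: inj_onD intro: trans)

lemma dfun_finv:
  assumes "dfun F" "A \<in> M" "Dt t" shows "Dt (\<lambda>v. finv A F (t v))"
  by (rule Dt_comp1[OF _ assms(3)], unfold finv_def, intro dfn Dt_comp1[OF assms(1)] assms(2))

lemma equipotent_sym:
  assumes "equipotent A B" "A \<in> M" "B \<in> M" shows "equipotent B A"
proof -
  obtain f where f: "f \<in> M" "bij_betw (ap f) (el A) (el B)" using equipotentE[OF assms] by blast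
  show ?thesis
  proof (rule equipotentI)
    show "dfun (finv A (ap f))" by (intro dfn dfun_finv f assms)
    have e: "\<forall>x\<in>el A. finv A (ap f) (ap f x) = x"
      using finv_eq[OF assms(2) bij_betw_imp_inj_on[OF f(2)]] by simp
    have "ap f ` el A = el B" using f(2) by (rule bij_betw_imp_surj_on)
    then show "bij_betw (finv A (ap f)) (el B) (el A)"
      by (intro bij_betw_byWitness[where f' = "ap f"]) (use e in force)+
  qed (use assms in auto)
qed

lemma equipotent_trans:
  assumes "equipotent A B" "equipotent B C" "A \<in> M" "B \<in> M" "C \<in> M" shows "equipotent A C"
proof -
  obtain f where f: "f \<in> M" "bij_betw (ap f) (el A) (el B)" using equipotentE[OF assms(1,3,4)] by blast
  obtain g where g: "g \<in> M" "bij_betw (ap g) (el B) (el C)" using equipotentE[OF assms(2,4,5)] by blast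
  show ?thesis
  proof (rule equipotentI)
    show "dfun (\<lambda>x. ap g (ap f x))" by (intro dfn f g)
    show "bij_betw (\<lambda>x. ap g (ap f x)) (el A) (el C)"
      using bij_betw_trans[OF f(2) g(2)] by (simp add: comp_def)
  qed (use assms in auto)
qed

lemma D_is_card [dfn]: "Dt s \<Longrightarrow> D (\<lambda>v. is_card (s v))"
  by (rule D_comp1) (unfold is_card_def, intro dfn)
lemma D_has_card [dfn]: "Dt s \<Longrightarrow> Dt t \<Longrightarrow> D (\<lambda>v. has_card (s v) (t v))"
  unfolding has_card_def by (intro dfn)
lemma D_size_less [dfn]: "Dt s \<Longrightarrow> Dt t \<Longrightarrow> D (\<lambda>v. size_less (s v) (t v))"
  by (rule D_comp2) (unfold size_less_def, intro dfn)

section \<open>Ordinals\<close>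

lemma wf_set: "X \<in> M \<Longrightarrow> z \<epsilon> X \<Longrightarrow> \<exists>m. m \<epsilon> X \<and> (\<forall>y. y \<epsilon> X \<longrightarrow> \<not> y \<epsilon> m)"
proof -
  assume *: "X \<in> M" "z \<epsilon> X"
  then have "\<not> is_empty X" using trans[OF *] unfolding is_empty_def by blast
  then obtain m where m: "m \<in> M" "m \<epsilon> X" "\<not> (\<exists>z\<in>M. z \<epsilon> X \<and> z \<epsilon> m)"
    using zfc_axioms(2) *(1) unfolding foundation_def by blast
  then show ?thesis using trans[OF *(1)] by blast
qed

lemma mem_irrefl: "x \<in> M \<Longrightarrow> \<not> x \<epsilon> x"
  using wf_set[of "upair x x" x] by auto

definition Ord :: "'a \<Rightarrow> bool" where "Ord x \<longleftrightarrow> x \<in> M \<and> is_ord x"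

lemma Ord_in [simp]: "Ord x \<Longrightarrow> x \<in> M" by (simp add: Ord_def)

lemma D_Ord [dfn]: "Dt t \<Longrightarrow> D (\<lambda>v. Ord (t v))"
  by (rule D_cong[of "\<lambda>v. is_ord (t v)"]) (intro dfn, assumption, auto simp: Ord_def Dt_in)

text \<open>Apart from \<open>x \<in> M\<close> all quantifiers are bounded by \<open>x\<close> and
  its members, which makes the right-hand side absolute between transitive classes.\<close>

lemma Ord_iff: "Ord x \<longleftrightarrow> x \<in> M \<and> (\<forall>y z. y \<epsilon> x \<longrightarrow> z \<epsilon> y \<longrightarrow> z \<epsilon> x) \<and>
    (\<forall>y z w. y \<epsilon> x \<longrightarrow> z \<epsilon> y \<longrightarrow> w \<epsilon> z \<longrightarrow> w \<epsilon> y)"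
proof (cases "x \<in> M")
  case True
  have t: "trans_set y \<longleftrightarrow> (\<forall>z w. z \<epsilon> y \<longrightarrow> w \<epsilon> z \<longrightarrow> w \<epsilon> y)" if "y \<in> M" for y
    unfolding trans_set_def sub_def using trans[OF that] trans[OF trans[OF that]] by blast
  have "is_ord x \<longleftrightarrow> trans_set x \<and> (\<forall>y. y \<epsilon> x \<longrightarrow> trans_set y)"
    unfolding is_ord_def using trans[OF True] by blast
  then show ?thesis unfolding Ord_def using True t[OF True] t[OF trans[OF True]] by auto
qed (simp add: Ord_def)

lemma Ord_trans: "Ord x \<Longrightarrow> y \<epsilon> x \<Longrightarrow> z \<epsilon> y \<Longrightarrow> z \<epsilon> x"
  unfolding Ord_iff by blast

lemma Ord_elem: "Ord x \<Longrightarrow> y \<epsilon> x \<Longrightarrow> Ord y"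
proof -
  assume *: "Ord x" "y \<epsilon> x"
  then have "y \<in> M" using trans unfolding Ord_iff[of x] by blast
  with * show ?thesis unfolding Ord_iff by blast
qed

lemma Ord_min:
  assumes "dpred P" "Ord a" "P a"
  shows "\<exists>b. Ord b \<and> P b \<and> (\<forall>c. c \<epsilon> b \<longrightarrow> \<not> P c) \<and> (b = a \<or> b \<epsilon> a)"
proof (cases "\<exists>b. b \<epsilon> a \<and> P b")
  case True
  let ?X = "collect a P"
  have X: "x \<epsilon> ?X \<longleftrightarrow> x \<epsilon> a \<and> P x" for x by (rule mem_collect) (use assms in auto)
  from True obtain z where "z \<epsilon> ?X" unfolding X by blast
  from wf_set[OF in_M(1) this] obtain m where "m \<epsilon> ?X" "\<forall>y. y \<epsilon> ?X \<longrightarrow> \<not> y \<epsilon> m" by blast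
  then have "Ord m" "P m" "m \<epsilon> a" "\<forall>c. c \<epsilon> m \<longrightarrow> \<not> P c"
    using X Ord_elem[OF assms(2)] Ord_trans[OF assms(2)] by blast+
  then show ?thesis by blast
next
  case False
  then show ?thesis using assms by blast
qed

lemma Ord_induct:
  assumes "dpred P" "\<And>a. Ord a \<Longrightarrow> (\<And>b. b \<epsilon> a \<Longrightarrow> P b) \<Longrightarrow> P a" "Ord a"
  shows "P a"
proof (rule ccontr)
  assume "\<not> P a"
  moreover have "dpred (\<lambda>x. \<not> P x)" by (intro dfn assms)
  ultimately obtain b where "Ord b" "\<not> P b" "\<forall>c. c \<epsilon> b \<longrightarrow> \<not> \<not> P c"
    using Ord_min[of "\<lambda>x. \<not> P x" a] assms by blast
  then show False using assms(2) by blast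
qed

text \<open>Induction on \<open>a\<close> and, inside it, on \<open>b\<close>: if neither is a
  member of the other, the two induction hypotheses give them the same elements.\<close>

lemma Ord_linear:
  assumes "Ord a" "Ord b" shows "a \<epsilon> b \<or> a = b \<or> b \<epsilon> a"
proof -
  have "\<forall>b\<in>M. Ord b \<longrightarrow> a \<epsilon> b \<or> a = b \<or> b \<epsilon> a"
  proof (rule Ord_induct[OF _ _ assms(1)])
    show "dpred (\<lambda>a. \<forall>b\<in>M. Ord b \<longrightarrow> a \<epsilon> b \<or> a = b \<or> b \<epsilon> a)" by (intro dfn)
    fix a assume a: "Ord a" "\<And>x. x \<epsilon> a \<Longrightarrow> \<forall>b\<in>M. Ord b \<longrightarrow> x \<epsilon> b \<or> x = b \<or> b \<epsilon> x"
    have "a \<epsilon> b \<or> a = b \<or> b \<epsilon> a" if "Ord b" for b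
    proof (rule Ord_induct[OF _ _ that])
      show "dpred (\<lambda>b. a \<epsilon> b \<or> a = b \<or> b \<epsilon> a)" by (intro dfn Ord_in a)
      fix b assume b: "Ord b" "\<And>y. y \<epsilon> b \<Longrightarrow> a \<epsilon> y \<or> a = y \<or> y \<epsilon> a"
      show "a \<epsilon> b \<or> a = b \<or> b \<epsilon> a"
      proof (rule ccontr)
        assume n: "\<not> (a \<epsilon> b \<or> a = b \<or> b \<epsilon> a)"
        have "x \<epsilon> b" if "x \<epsilon> a" for x using a(2)[OF that] b(1) n that Ord_trans[OF a(1) that] by auto
        moreover have "y \<epsilon> a" if "y \<epsilon> b" for y using b(2)[OF that] n that Ord_trans[OF b(1) that] by auto
        ultimately have "a = b" by (intro set_ext) (use a b in auto)
        with n show False by blast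
      qed
    qed
    then show "\<forall>b\<in>M. Ord b \<longrightarrow> a \<epsilon> b \<or> a = b \<or> b \<epsilon> a" by blast
  qed
  then show ?thesis using assms by simp
qed

lemma Ord_asym: "Ord a \<Longrightarrow> b \<epsilon> a \<Longrightarrow> \<not> a \<epsilon> b"
  using Ord_trans[of a b a] mem_irrefl[of a] Ord_in[of a] by blast

lemma Ord_subset:
  assumes "Ord a" "Ord b" "\<And>x. x \<epsilon> a \<Longrightarrow> x \<epsilon> b" shows "a \<epsilon> b \<or> a = b"
  using Ord_linear[OF assms(1,2)] assms(3)[of b] mem_irrefl[of b] Ord_in[OF assms(2)] by blast

lemma Ord_zer [simp]: "Ord zer" by (simp add: Ord_iff)

lemma Ord_suc [simp]: "Ord x \<Longrightarrow> Ord (suc x)"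
proof -
  assume x: "Ord x"
  have t: "z \<epsilon> x" if "y \<epsilon> x" "z \<epsilon> y" for y z using Ord_trans[OF x that] .
  have t2: "w \<epsilon> y" if "y \<epsilon> x" "z \<epsilon> y" "w \<epsilon> z" for y z w using Ord_trans[OF Ord_elem[OF x that(1)] that(2,3)] .
  show ?thesis unfolding Ord_iff[of "suc x"] mem_suc[OF Ord_in[OF x]] using t t2 by (intro conjI) (simp, blast+)
qed

lemma suc_inj: "Ord a \<Longrightarrow> Ord b \<Longrightarrow> suc a = suc b \<Longrightarrow> a = b"
proof -
  assume *: "Ord a" "Ord b" "suc a = suc b"
  have "z \<epsilon> suc a \<longleftrightarrow> z \<epsilon> suc b" for z using *(3) by simp
  from this[of a] this[of b] show ?thesis using *(1,2) Ord_asym[of a b] by auto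
qed

lemma Ord_set:
  assumes "X \<in> M" "\<And>x. x \<epsilon> X \<Longrightarrow> Ord x" "\<And>x y. x \<epsilon> X \<Longrightarrow> y \<epsilon> x \<Longrightarrow> y \<epsilon> X"
  shows "Ord X"
  unfolding Ord_iff[of X] using assms(1,3) Ord_trans[OF assms(2)] by blast

section \<open>Recursion\<close>

text \<open>Minimal elements are available for sets of the model only, so the counterexamples to
  \<open>P\<close> are collected into one; this is where definability of \<open>P\<close>
  enters.\<close>

lemma wf_rel_induct:
  assumes A: "A \<in> M"
    and wf: "\<And>X z. X \<in> M \<Longrightarrow> z \<epsilon> X \<Longrightarrow> (\<And>x. x \<epsilon> X \<Longrightarrow> x \<epsilon> A) \<Longrightarrow> \<exists>m. m \<epsilon> X \<and> (\<forall>y. y \<epsilon> X \<longrightarrow> \<not> R y m)"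
    and P: "dpred P"
    and step: "\<And>x. x \<epsilon> A \<Longrightarrow> (\<And>y. y \<epsilon> A \<Longrightarrow> R y x \<Longrightarrow> P y) \<Longrightarrow> P x"
    and x: "x \<epsilon> A"
  shows "P x"
proof (rule ccontr)
  assume n: "\<not> P x"
  have "dpred (\<lambda>x. \<not> P x)" by (intro dfn P)
  note X = mem_collect[OF this A]
  have "x \<epsilon> collect A (\<lambda>x. \<not> P x)" unfolding X using x n by blast
  from wf[OF in_M(1) this] obtain m where "m \<epsilon> A" "\<not> P m" "\<forall>y. y \<epsilon> A \<and> \<not> P y \<longrightarrow> \<not> R y m"
    unfolding X by blast
  then show False using step[of m] by blast
qed

text \<open>The restriction of the solution to an initial segment is the only function satisfying
  \<open>app'\<close>, so definite description yields it and keeps \<open>F\<close> definable.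
  Transitivity of \<open>R\<close> allows an approximation to be compared with those on smaller
  segments.\<close>

lemma wf_recursion:
  assumes A: "A \<in> M" and R: "dpred2 R"
    and wf: "\<And>X z. X \<in> M \<Longrightarrow> z \<epsilon> X \<Longrightarrow> (\<And>x. x \<epsilon> X \<Longrightarrow> x \<epsilon> A) \<Longrightarrow> \<exists>m. m \<epsilon> X \<and> (\<forall>y. y \<epsilon> X \<longrightarrow> \<not> R y m)"
    and tr: "\<And>x y z. x \<epsilon> A \<Longrightarrow> y \<epsilon> A \<Longrightarrow> z \<epsilon> A \<Longrightarrow> R x y \<Longrightarrow> R y z \<Longrightarrow> R x z"
    and G: "dfun2 G"
  obtains F where "dfun F" "\<And>x. x \<epsilon> A \<Longrightarrow> F x = G x (lam (collect A (\<lambda>y. R y x)) F)"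
proof -
  define seg where "seg x = collect A (\<lambda>y. R y x)" for x
  have dseg: "dfun seg" unfolding seg_def by (intro dfn A D_comp2[OF R])
  note dseg' = Dt_comp1[OF dseg]
  have segM [simp]: "seg x \<in> M" for x by (simp add: seg_def)
  have seg: "y \<epsilon> seg x \<longleftrightarrow> y \<epsilon> A \<and> R y x" if "x \<epsilon> A" for x y
  proof -
    have "x \<in> M" using that by (rule trans[OF A])
    then have "dpred (\<lambda>y. R y x)" by (intro D_comp2[OF R] dfn)
    then show ?thesis unfolding seg_def by (rule mem_collect) (rule A)
  qed
  have seg_tr: "z \<epsilon> seg x" if "x \<epsilon> A" "y \<epsilon> seg x" "z \<epsilon> seg y" for x y z
    using that seg[OF that(1)] seg[of y] tr[of z y x] by blast
  define app' where "app' f x \<longleftrightarrow> f = lam (seg x) (ap f) \<and>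
      (\<forall>y. y \<epsilon> seg x \<longrightarrow> ap f y = G y (lam (seg y) (ap f)))" for f x
  have dapp': "dpred2 app'" unfolding app'_def by (intro dfn dseg' Dt_comp2[OF G])
  have dap: "dfun (ap f)" if "f \<in> M" for f by (intro dfn that)
  have uniq: "ap f y = ap g y"
    if f: "app' f x" "f \<in> M" "x \<epsilon> A" and g: "app' g x'" "g \<in> M" "x' \<epsilon> A" and y: "y \<epsilon> seg x" "y \<epsilon> seg x'" for f g x x' y
  proof -
    have M: "x \<in> M" "x' \<in> M" using f g trans[OF A] by blast+
    have "y \<epsilon> seg x \<longrightarrow> y \<epsilon> seg x' \<longrightarrow> ap f y = ap g y"
    proof (rule wf_rel_induct[OF A wf, where P = "\<lambda>y. y \<epsilon> seg x \<longrightarrow> y \<epsilon> seg x' \<longrightarrow> ap f y = ap g y"])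
      show "dpred (\<lambda>y. y \<epsilon> seg x \<longrightarrow> y \<epsilon> seg x' \<longrightarrow> ap f y = ap g y)"
        by (intro dfn dseg' M f g)
      show "y \<epsilon> A" using y seg[OF f(3)] by blast
      fix y assume yA: "y \<epsilon> A" and IH: "\<And>z. z \<epsilon> A \<Longrightarrow> R z y \<Longrightarrow> z \<epsilon> seg x \<longrightarrow> z \<epsilon> seg x' \<longrightarrow> ap f z = ap g z"
      show "y \<epsilon> seg x \<longrightarrow> y \<epsilon> seg x' \<longrightarrow> ap f y = ap g y"
      proof (intro impI)
        assume y: "y \<epsilon> seg x" "y \<epsilon> seg x'"
        have "lam (seg y) (ap f) = lam (seg y) (ap g)"
        proof (rule lam_cong[OF dap[OF f(2)] dap[OF g(2)] segM])
          fix z assume z: "z \<epsilon> seg y"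
          then show "ap f z = ap g z"
            using IH[of z] seg[OF yA] seg_tr[OF f(3) y(1) z] seg_tr[OF g(3) y(2) z] by blast
        qed
        then show "ap f y = ap g y" using f(1) g(1) y unfolding app'_def by metis
      qed
    qed
    then show ?thesis using y by blast
  qed
  define h where "h x = tht (\<lambda>f. app' f x)" for x
  define F where "F x = G x (h x)" for x
  have dh: "dfun h" unfolding h_def by (intro dfn D_comp2[OF dapp'])
  have dF: "dfun F" unfolding F_def by (intro dfn Dt_comp2[OF G] dh)
  have hM [simp]: "h x \<in> M" for x by (simp add: h_def)
  have h1: "app' (h x) x" if ex: "f \<in> M" "app' f x" and x: "x \<epsilon> A" for f x
  proof -
    have "h x = f" unfolding h_def
    proof (rule tht_eq)
      fix g assume g: "g \<in> M" "app' g x"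
      have "g = lam (seg x) (ap g)" using g(2) unfolding app'_def by blast
      also have "\<dots> = lam (seg x) (ap f)"
        by (rule lam_cong[OF dap[OF g(1)] dap[OF ex(1)] segM]) (rule uniq[OF g(2,1) x ex(2,1) x])
      also have "\<dots> = f" using ex(2) unfolding app'_def by simp
      finally show "g = f" .
    qed (use ex in auto)
    with ex show ?thesis by simp
  qed
  have hF: "ap (h y) z = F z" if y: "y \<epsilon> A" "app' (h y) y" and z: "z \<epsilon> seg y" "app' (h z) z" for y z
  proof -
    have zA: "z \<epsilon> A" using z seg[OF y(1)] by blast
    have "ap (h y) z = G z (lam (seg z) (ap (h y)))" using y(2) z(1) unfolding app'_def by blast
    also have "lam (seg z) (ap (h y)) = lam (seg z) (ap (h z))"
    proof (rule lam_cong[OF dap[OF hM] dap[OF hM] segM])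
      fix w assume "w \<epsilon> seg z"
      then show "ap (h y) w = ap (h z) w"
        using uniq[OF y(2) hM y(1) z(2) hM zA] seg_tr[OF y(1) z(1)] by blast
    qed
    also have "\<dots> = h z" using z(2) unfolding app'_def by simp
    finally show ?thesis unfolding F_def .
  qed
  have "app' (h x) x" if "x \<epsilon> A" for x
  proof (rule wf_rel_induct[OF A wf, where P = "\<lambda>x. app' (h x) x"])
    show "dpred (\<lambda>x. app' (h x) x)" by (intro D_comp2[OF dapp'] dh dfn)
    show "x \<epsilon> A" by fact
    fix x assume x: "x \<epsilon> A" and IH: "\<And>y. y \<epsilon> A \<Longrightarrow> R y x \<Longrightarrow> app' (h y) y"
    \<comment> \<open>By induction \<open>F\<close> is already correct below \<open>x\<close>, so
      its restriction is the approximation whose existence is at stake.\<close>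
    let ?f = "lam (seg x) F"
    have a: "ap ?f y = F y" if "y \<epsilon> seg x" for y by (rule ap_lam[OF dF segM that])
    have "app' ?f x" unfolding app'_def
    proof (intro conjI allI impI)
      show "?f = lam (seg x) (ap ?f)"
        by (rule lam_cong[OF dF dap segM]) (simp_all add: a)
      fix y assume y: "y \<epsilon> seg x"
      then have yA: "y \<epsilon> A" "R y x" using seg[OF x] by blast+
      note hy = IH[OF yA]
      have "h y = lam (seg y) (ap (h y))" using hy unfolding app'_def by blast
      also have "\<dots> = lam (seg y) (ap ?f)"
      proof (rule lam_cong[OF dap[OF hM] dap segM])
        fix z assume z: "z \<epsilon> seg y"
        then have zx: "z \<epsilon> seg x" by (rule seg_tr[OF x y])
        then have "app' (h z) z" using IH seg[OF x] by blast
        from hF[OF yA(1) hy z this] show "ap (h y) z = ap ?f z" using a[OF zx] by simp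
      qed simp
      finally show "ap ?f y = G y (lam (seg y) (ap ?f))" unfolding a[OF y] F_def by simp
    qed
    from h1[OF in_M(9) this x] show "app' (h x) x" .
  qed
  note hx = this
  show thesis
  proof (rule that[OF dF])
    fix x assume x: "x \<epsilon> A"
    have "h x = lam (seg x) (ap (h x))" using hx[OF x] unfolding app'_def by blast
    also have "\<dots> = lam (seg x) F"
    proof (rule lam_cong[OF dap[OF hM] dF segM])
      fix z assume z: "z \<epsilon> seg x"
      then have "z \<epsilon> A" using seg[OF x] by blast
      from hF[OF x hx[OF x] z hx[OF this]] show "ap (h x) z = F z" .
    qed
    finally show "F x = G x (lam (collect A (\<lambda>y. R y x)) F)" unfolding F_def seg_def by simp
  qed
qed

text \<open>Transitivity of \<open>R\<close> makes the collapsed values transitive sets of ordinals,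
  hence ordinals. Injectivity is left to the applications, where the relation is linear.\<close>

lemma mostowski_collapse:
  assumes A: "A \<in> M" and R: "dpred2 R"
    and wf: "\<And>X z. X \<in> M \<Longrightarrow> z \<epsilon> X \<Longrightarrow> (\<And>x. x \<epsilon> X \<Longrightarrow> x \<epsilon> A) \<Longrightarrow> \<exists>m. m \<epsilon> X \<and> (\<forall>y. y \<epsilon> X \<longrightarrow> \<not> R y m)"
    and tr: "\<And>x y z. x \<epsilon> A \<Longrightarrow> y \<epsilon> A \<Longrightarrow> z \<epsilon> A \<Longrightarrow> R x y \<Longrightarrow> R y z \<Longrightarrow> R x z"
  obtains c where "dfun c" "\<And>x. x \<epsilon> A \<Longrightarrow> Ord (c x)"
    "\<And>x z. x \<epsilon> A \<Longrightarrow> z \<epsilon> c x \<longleftrightarrow> (\<exists>y. y \<epsilon> A \<and> R y x \<and> z = c y)"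
proof -
  have dG: "dfun2 (\<lambda>x f. repl (collect A (\<lambda>y. R y x)) (ap f))"
    by (intro dfn A D_comp2[OF R])
  obtain c where c: "dfun c"
    "\<And>x. x \<epsilon> A \<Longrightarrow> c x = repl (collect A (\<lambda>y. R y x)) (ap (lam (collect A (\<lambda>y. R y x)) c))"
    by (rule wf_recursion[OF A R wf tr dG], assumption+, rule that)
  have m: "z \<epsilon> c x \<longleftrightarrow> (\<exists>y. y \<epsilon> A \<and> R y x \<and> z = c y)" if x: "x \<epsilon> A" for x z
  proof -
    let ?s = "collect A (\<lambda>y. R y x)"
    have "x \<in> M" using x by (rule trans[OF A])
    then have "dpred (\<lambda>y. R y x)" by (intro D_comp2[OF R] dfn)
    note s = mem_collect[OF this A]
    have d: "dfun (ap (lam ?s c))" by (intro dfn in_M)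
    have "z \<epsilon> c x \<longleftrightarrow> (\<exists>y. y \<epsilon> ?s \<and> z = ap (lam ?s c) y)"
      unfolding c(2)[OF x] by (rule mem_repl[OF d in_M(1)])
    also have "\<dots> \<longleftrightarrow> (\<exists>y. y \<epsilon> ?s \<and> z = c y)" using ap_lam[OF c(1) in_M(1)] by auto
    finally show ?thesis unfolding s by blast
  qed
  have "Ord (c x)" if "x \<epsilon> A" for x
  proof (rule wf_rel_induct[OF A wf, where P = "\<lambda>x. Ord (c x)"])
    show "dpred (\<lambda>x. Ord (c x))" by (intro dfn c)
    show "x \<epsilon> A" by fact
    fix x assume x: "x \<epsilon> A" and IH: "\<And>y. y \<epsilon> A \<Longrightarrow> R y x \<Longrightarrow> Ord (c y)"
    show "Ord (c x)"
    proof (rule Ord_set)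
      show "c x \<in> M" using dfun_in[OF c(1)] trans[OF A x] by blast
      fix z assume "z \<epsilon> c x"
      then obtain y where y: "y \<epsilon> A" "R y x" "z = c y" using m[OF x] by blast
      then show "Ord z" using IH by blast
      fix w assume "w \<epsilon> z"
      then obtain u where "u \<epsilon> A" "R u y" "w = c u" using m[OF y(1)] y by blast
      then show "w \<epsilon> c x" using m[OF x] tr[of u y x] x y by blast
    qed
  qed
  with c(1) m that show thesis by blast
qed

section \<open>Cardinalities of sets of ordinals\<close>

lemma wf_epsilon: "X \<in> M \<Longrightarrow> z \<epsilon> X \<Longrightarrow> (\<And>x. x \<epsilon> X \<Longrightarrow> x \<epsilon> A) \<Longrightarrow> \<exists>m. m \<epsilon> X \<and> (\<forall>y. y \<epsilon> X \<longrightarrow> \<not> y \<epsilon> m)"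
  by (rule wf_set)

text \<open>The collapse \<open>c\<close> of \<open>A\<close> never moves an element up, so its
  range is an ordinal not above \<open>a\<close>.\<close>

lemma subset_Ord_equipotent:
  assumes a: "Ord a" and A: "A \<in> M" and sub: "\<And>x. x \<epsilon> A \<Longrightarrow> x \<epsilon> a"
  obtains b where "Ord b" "b \<epsilon> a \<or> b = a" "equipotent A b"
proof -
  have o: "Ord x" if "x \<epsilon> A" for x by (rule Ord_elem[OF a sub[OF that]])
  have d: "dpred2 (\<lambda>x y. x \<epsilon> y)" by (intro dfn)
  obtain c where c: "dfun c" "\<And>x. x \<epsilon> A \<Longrightarrow> Ord (c x)"
    "\<And>x z. x \<epsilon> A \<Longrightarrow> z \<epsilon> c x \<longleftrightarrow> (\<exists>y. y \<epsilon> A \<and> y \<epsilon> x \<and> z = c y)"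
  proof (rule mostowski_collapse[OF A d wf_epsilon])
    show "x \<epsilon> z" if "z \<epsilon> A" "x \<epsilon> y" "y \<epsilon> z" for x y z by (rule Ord_trans[OF o[OF that(1)] that(3,2)])
  qed (assumption+, rule that)
  have le: "c x \<epsilon> x \<or> c x = x" if "x \<epsilon> A" for x
  proof (rule wf_rel_induct[OF A wf_epsilon, where P = "\<lambda>x. c x \<epsilon> x \<or> c x = x"])
    show "dpred (\<lambda>x. c x \<epsilon> x \<or> c x = x)" by (intro dfn c)
    show "x \<epsilon> A" by fact
    fix x assume x: "x \<epsilon> A" and IH: "\<And>y. y \<epsilon> A \<Longrightarrow> y \<epsilon> x \<Longrightarrow> c y \<epsilon> y \<or> c y = y"
    show "c x \<epsilon> x \<or> c x = x"
    proof (rule Ord_subset[OF c(2)[OF x] o[OF x]])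
      fix z assume "z \<epsilon> c x"
      then obtain y where "y \<epsilon> A" "y \<epsilon> x" "z = c y" using c(3)[OF x] by blast
      then show "z \<epsilon> x" using IH[of y] Ord_trans[OF o[OF x], of y z] by auto
    qed
  qed
  let ?b = "repl A c"
  note mb = mem_repl[OF c(1) A]
  have b: "Ord ?b"
  proof (rule Ord_set)
    fix z assume "z \<epsilon> ?b"
    then obtain x where x: "x \<epsilon> A" "z = c x" unfolding mb by blast
    then show "Ord z" using c(2) by blast
    fix w assume "w \<epsilon> z"
    then show "w \<epsilon> ?b" unfolding mb using x c(3)[OF x(1)] by blast
  qed simp
  have "?b \<epsilon> a \<or> ?b = a"
  proof (rule Ord_subset[OF b a])
    fix z assume "z \<epsilon> ?b"
    then obtain x where x: "x \<epsilon> A" "z = c x" unfolding mb by blast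
    then show "z \<epsilon> a" using le[OF x(1)] sub[OF x(1)] Ord_trans[OF a, of x z] by auto
  qed
  moreover have "equipotent A ?b"
  proof (rule equipotentI[OF c(1) A in_M(2)])
    have "inj_on c (el A)"
    proof (rule inj_onI)
      fix x y assume "x \<in> el A" "y \<in> el A" and eq: "c x = c y"
      then have x: "x \<epsilon> A" and y: "y \<epsilon> A" by simp_all
      have "\<not> x \<epsilon> y" using c(3)[OF y, of "c x"] x mem_irrefl[OF Ord_in[OF c(2)[OF y]]] eq by auto
      moreover have "\<not> y \<epsilon> x" using c(3)[OF x, of "c y"] y mem_irrefl[OF Ord_in[OF c(2)[OF x]]] eq by auto
      ultimately show "x = y" using Ord_linear[OF o[OF x] o[OF y]] by blast
    qed
    moreover have "c ` el A = el ?b" using mb by (auto simp: el_def)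
    ultimately show "bij_betw c (el A) (el ?b)" unfolding bij_betw_def by blast
  qed
  ultimately show thesis using that b by blast
qed

lemma has_card_le:
  assumes A: "A \<in> M" and b: "Ord b" and e: "equipotent A b"
  obtains m where "has_card A m" "Ord m" "m \<epsilon> b \<or> m = b"
proof -
  have d: "dpred (\<lambda>m. equipotent A m)" by (intro dfn A)
  from Ord_min[of "\<lambda>m. equipotent A m", OF d b e] obtain m where m: "Ord m" "equipotent A m"
    "\<forall>c. c \<epsilon> m \<longrightarrow> \<not> equipotent A c" "m = b \<or> m \<epsilon> b" by blast
  have "is_card m" unfolding is_card_def
  proof (intro conjI ballI impI notI)
    show "is_ord m" using m(1) by (simp add: Ord_def)
    fix x assume "x \<in> M" "x \<epsilon> m" "equipotent x m"
    then have "equipotent A x"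
      using equipotent_trans[OF m(2) equipotent_sym] A Ord_in[OF m(1)] by blast
    with m(3) \<open>x \<epsilon> m\<close> show False by blast
  qed
  with m that show thesis unfolding has_card_def by blast
qed

lemma inj_equipotent:
  assumes A: "A \<in> M" and b: "Ord b" and F: "dfun F" "inj_on F (el A)" "\<And>x. x \<epsilon> A \<Longrightarrow> F x \<epsilon> b"
  obtains c where "Ord c" "c \<epsilon> b \<or> c = b" "equipotent A c"
proof -
  note mb = mem_repl[OF F(1) A]
  have "x \<epsilon> b" if "x \<epsilon> repl A F" for x using that F(3) unfolding mb by blast
  from subset_Ord_equipotent[OF b in_M(2) this] obtain c where
    c: "Ord c" "c \<epsilon> b \<or> c = b" "equipotent (repl A F) c" .
  have "equipotent A (repl A F)"
  proof (rule equipotentI[OF F(1) A in_M(2)])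
    have "F ` el A = el (repl A F)" using mb by (auto simp: el_def)
    then show "bij_betw F (el A) (el (repl A F))" using F(2) unfolding bij_betw_def by blast
  qed
  then have "equipotent A c" using equipotent_trans[OF _ c(3)] A Ord_in[OF c(1)] by simp
  with c that show thesis by blast
qed

lemma size_lessI:
  assumes "A \<in> M" "Ord d" "b \<epsilon> d" "dfun F" "inj_on F (el A)" "\<And>x. x \<epsilon> A \<Longrightarrow> F x \<epsilon> b"
  shows "size_less A d"
proof -
  have b: "Ord b" by (rule Ord_elem[OF assms(2,3)])
  obtain c where c: "Ord c" "c \<epsilon> b \<or> c = b" "equipotent A c" using inj_equipotent[OF assms(1) b assms(4-6)] .
  obtain m where m: "has_card A m" "Ord m" "m \<epsilon> c \<or> m = c" using has_card_le[OF assms(1) c(1,3)] .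
  have "m \<epsilon> b \<or> m = b" using m c Ord_trans[OF b, of c m] by auto
  then have "m \<epsilon> d" using Ord_trans[OF assms(2,3), of m] assms(3) by auto
  then show ?thesis unfolding size_less_def using m by auto
qed

text \<open>Collapsing the image turns the injection into a bijection with an ordinal at most
  \<open>b\<close>, against \<open>k\<close> being a cardinal. This is the form in which the
  pigeonhole principle is applied below.\<close>

lemma card_no_inj:
  assumes "k \<in> M" "is_card k" "b \<epsilon> k" "dfun F" "inj_on F (el k)" "\<And>x. x \<epsilon> k \<Longrightarrow> F x \<epsilon> b"
  shows False
proof -
  have k: "Ord k" using assms unfolding Ord_def is_card_def by blast
  obtain c where c: "Ord c" "c \<epsilon> b \<or> c = b" "equipotent k c"
    using inj_equipotent[OF assms(1) Ord_elem[OF k assms(3)] assms(4-6)] .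
  have "c \<epsilon> k" using c Ord_trans[OF k assms(3), of c] assms(3) by auto
  moreover have "equipotent c k" using equipotent_sym[OF c(3)] assms(1) Ord_in[OF c(1)] by blast
  ultimately show False using assms(2) Ord_in[OF c(1)] unfolding is_card_def by blast
qed

lemma size_lessE:
  assumes "size_less A d" "A \<in> M"
  obtains m f where "m \<in> M" "m \<epsilon> d" "is_card m" "f \<in> M" "is_fun f m A" "bij_betw (ap f) (el m) (el A)"
proof -
  from assms(1) obtain m where m: "m \<in> M" "is_card m" "equipotent A m" "m \<epsilon> d"
    unfolding size_less_def has_card_def by blast
  from equipotentE[OF equipotent_sym[OF m(3) assms(2) m(1)] m(1) assms(2)] that m show thesis by blast
qed

section \<open>Pairs, cartesian products and minimal values\<close>

definition pfst :: "'a \<Rightarrow> 'a" where "pfst p = tht (\<lambda>a. \<exists>b\<in>M. p = opair a b)"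
definition psnd :: "'a \<Rightarrow> 'a" where "psnd p = tht (\<lambda>b. \<exists>a\<in>M. p = opair a b)"

lemma pfst [simp]: "a \<in> M \<Longrightarrow> b \<in> M \<Longrightarrow> pfst (opair a b) = a"
  unfolding pfst_def by (rule tht_eq) auto
lemma psnd [simp]: "a \<in> M \<Longrightarrow> b \<in> M \<Longrightarrow> psnd (opair a b) = b"
  unfolding psnd_def by (rule tht_eq) auto
lemma Dt_pfst [dfn]: "Dt t \<Longrightarrow> Dt (\<lambda>v. pfst (t v))"
  by (rule Dt_comp1) (unfold pfst_def, intro dfn)
lemma Dt_psnd [dfn]: "Dt t \<Longrightarrow> Dt (\<lambda>v. psnd (t v))"
  by (rule Dt_comp1) (unfold psnd_def, intro dfn)

definition cprod :: "'a \<Rightarrow> 'a \<Rightarrow> 'a" where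
  "cprod A B = Uni (repl A (\<lambda>a. repl B (\<lambda>b. opair a b)))"

lemma cprod_in [simp]: "cprod A B \<in> M" by (simp add: cprod_def)

lemma mem_cprod:
  assumes A: "A \<in> M" and B: "B \<in> M"
  shows "z \<epsilon> cprod A B \<longleftrightarrow> (\<exists>a b. a \<epsilon> A \<and> b \<epsilon> B \<and> z = opair a b)"
proof -
  have d1: "dfun (\<lambda>a. repl B (\<lambda>b. opair a b))" by (intro dfn B)
  have d2: "dfun (\<lambda>b. opair a b)" if "a \<epsilon> A" for a by (intro dfn trans[OF A that])
  have "z \<epsilon> cprod A B \<longleftrightarrow> (\<exists>a. a \<epsilon> A \<and> z \<epsilon> repl B (\<lambda>b. opair a b))"
    unfolding cprod_def mem_Uni[OF in_M(2)] mem_repl[OF d1 A] by blast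
  then show ?thesis using mem_repl[OF d2 B] by blast
qed

definition mx :: "'a \<Rightarrow> 'a \<Rightarrow> 'a" where "mx a b = (if a \<epsilon> b then b else a)"

lemma Dt_mx [dfn]: "Dt s \<Longrightarrow> Dt t \<Longrightarrow> Dt (\<lambda>v. mx (s v) (t v))"
  unfolding mx_def by (intro dfn)

lemma min_on:
  assumes X: "X \<in> M" "z \<epsilon> X" and f: "dfun f" "\<And>x. x \<epsilon> X \<Longrightarrow> Ord (f x)"
  obtains m where "m \<epsilon> X" "\<And>y. y \<epsilon> X \<Longrightarrow> \<not> f y \<epsilon> f m"
proof -
  have d: "dpred (\<lambda>a. \<exists>x. x \<epsilon> X \<and> a = f x)" by (intro dfn X Dt_comp1[OF f(1)])
  from Ord_min[of "\<lambda>a. \<exists>x. x \<epsilon> X \<and> a = f x", OF d f(2)[OF X(2)]] X(2)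
  obtain b where "\<exists>x. x \<epsilon> X \<and> b = f x" "\<forall>c. c \<epsilon> b \<longrightarrow> \<not> (\<exists>x. x \<epsilon> X \<and> c = f x)" by blast
  then show thesis using that by blast
qed

end

section \<open>Regular cardinals\<close>

text \<open>A regular limit ordinal, with regularity stated for class functions that are definable
  with parameters. It is instantiated both for the larger model and for the ground model.\<close>

locale reg = zf +
  fixes k :: 'a
  assumes k: "Ord k" "zer \<epsilon> k" "\<And>x. x \<epsilon> k \<Longrightarrow> suc x \<epsilon> k"
    and bounded: "\<And>F b. dfun F \<Longrightarrow> b \<epsilon> k \<Longrightarrow> (\<And>x. x \<epsilon> b \<Longrightarrow> F x \<epsilon> k) \<Longrightarrow> \<exists>g. g \<epsilon> k \<and> (\<forall>x. x \<epsilon> b \<longrightarrow> F x \<epsilon> g)"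
begin

lemma kM [simp]: "k \<in> M" using k by simp
lemma k_in [simp]: "x \<epsilon> k \<Longrightarrow> x \<in> M" by (rule trans[OF kM])
lemma k_Ord [simp]: "x \<epsilon> k \<Longrightarrow> Ord x" by (rule Ord_elem[OF k(1)])
lemma k_down: "x \<epsilon> k \<Longrightarrow> y \<epsilon> x \<Longrightarrow> y \<epsilon> k" by (rule Ord_trans[OF k(1)])

text \<open>The least witnesses form a definable function on \<open>b\<close>, and by
  \<open>mono\<close> any bound for it is a common witness.\<close>

lemma reg_all:
  assumes Q: "dpred2 Q" and b: "b \<epsilon> k" and ex: "\<And>i. i \<epsilon> b \<Longrightarrow> \<exists>g. g \<epsilon> k \<and> Q i g"
    and mono: "\<And>i g h. i \<epsilon> b \<Longrightarrow> Q i g \<Longrightarrow> g \<epsilon> h \<Longrightarrow> h \<epsilon> k \<Longrightarrow> Q i h"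
  shows "\<exists>g. g \<epsilon> k \<and> (\<forall>i. i \<epsilon> b \<longrightarrow> Q i g)"
proof -
  define F where "F i = tht (\<lambda>g. g \<epsilon> k \<and> Q i g \<and> (\<forall>h. h \<epsilon> g \<longrightarrow> \<not> Q i h))" for i
  have dF: "dfun F" unfolding F_def by (intro dfn kM D_comp2[OF Q])
  have F: "F i \<epsilon> k \<and> Q i (F i)" if i: "i \<epsilon> b" for i
  proof -
    have "i \<in> M" using i b trans k_in by blast
    then have d: "dpred (\<lambda>g. g \<epsilon> k \<and> Q i g)" by (intro dfn kM D_comp2[OF Q])
    obtain g where g: "g \<epsilon> k" "Q i g" using ex[OF i] by blast
    from Ord_min[of "\<lambda>g. g \<epsilon> k \<and> Q i g", OF d k_Ord[OF g(1)]] g obtain m where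
      m: "m \<epsilon> k" "Q i m" "\<forall>c. c \<epsilon> m \<longrightarrow> \<not> (c \<epsilon> k \<and> Q i c)" by blast
    have m3: "\<not> Q i c" if "c \<epsilon> m" for c using m(3) k_down[OF m(1) that] that by blast
    have "F i = m" unfolding F_def
    proof (rule tht_eq)
      fix y assume "y \<epsilon> k \<and> Q i y \<and> (\<forall>h. h \<epsilon> y \<longrightarrow> \<not> Q i h)"
      then show "y = m" using Ord_linear[of y m] m m3 by auto
    qed (use m m3 in auto)
    with m show ?thesis by simp
  qed
  obtain g where g: "g \<epsilon> k" "\<forall>x. x \<epsilon> b \<longrightarrow> F x \<epsilon> g" using bounded[OF dF b] F by blast
  have "Q i g" if "i \<epsilon> b" for i using mono[OF that _ _ g(1), of "F i"] F[OF that] g(2) that by blast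
  with g(1) show ?thesis by blast
qed

text \<open>
  Goedel's well-ordering of \<open>k \<times> k\<close> collapses into \<open>k\<close>: otherwise \<open>k\<close> would inject into \<open>b \<times> b\<close> for some
  \<open>b < k\<close>, contradicting regularity.
\<close>

lemma pairing_injection:
  obtains p where "dfun2 p" "\<And>a b. a \<epsilon> k \<Longrightarrow> b \<epsilon> k \<Longrightarrow> p a b \<epsilon> k"
    "\<And>a b. a \<epsilon> k \<Longrightarrow> b \<epsilon> k \<Longrightarrow> b \<epsilon> p a b"
    "\<And>a b a' b'. a \<epsilon> k \<Longrightarrow> b \<epsilon> k \<Longrightarrow> a' \<epsilon> k \<Longrightarrow> b' \<epsilon> k \<Longrightarrow> p a b = p a' b' \<Longrightarrow> a = a' \<and> b = b'"
proof -
  define A where "A = cprod k k"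
  have A: "A \<in> M" by (simp add: A_def)
  note mA = mem_cprod[OF kM kM, folded A_def]
  define f1 where "f1 p = mx (pfst p) (psnd p)" for p
  have df1: "dfun f1" unfolding f1_def by (intro dfn)
  have df2: "dfun pfst" "dfun psnd" by (intro dfn)+
  \<comment> \<open>The maximum is compared first, then the first and then the second coordinate, so
    that everything below \<open>p\<close> has both coordinates in
    \<open>suc (f1 p)\<close>.\<close>
  define R where "R p q \<longleftrightarrow> f1 p \<epsilon> f1 q \<or> (f1 p = f1 q \<and>
    (pfst p \<epsilon> pfst q \<or> (pfst p = pfst q \<and> psnd p \<epsilon> psnd q)))" for p q
  have dR: "dpred2 R" unfolding R_def by (intro dfn Dt_comp1[OF df1])
  have inA: "pfst p \<epsilon> k \<and> psnd p \<epsilon> k \<and> p = opair (pfst p) (psnd p)" if "p \<epsilon> A" for p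
    using that unfolding mA by auto
  have f1A: "f1 p \<epsilon> k" if "p \<epsilon> A" for p using inA[OF that] by (simp add: f1_def mx_def)
  have o: "Ord (f1 p)" "Ord (pfst p)" "Ord (psnd p)" if "p \<epsilon> A" for p
    using inA[OF that] f1A[OF that] by auto
  have wf: "\<exists>m. m \<epsilon> X \<and> (\<forall>y. y \<epsilon> X \<longrightarrow> \<not> R y m)"
    if X: "X \<in> M" "z \<epsilon> X" "\<And>x. x \<epsilon> X \<Longrightarrow> x \<epsilon> A" for X z
  proof -
    \<comment> \<open>A minimal pair is found by minimizing the maximum, then the first and then the
      second coordinate, each on the set left by the step before.\<close>
    obtain m1 where m1: "m1 \<epsilon> X" "\<And>y. y \<epsilon> X \<Longrightarrow> \<not> f1 y \<epsilon> f1 m1"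
      using min_on[OF X(1,2) df1 o(1)[OF X(3)]] by blast
    have m1M: "m1 \<in> M" by (rule trans[OF X(1) m1(1)])
    define X1 where "X1 = collect X (\<lambda>x. f1 x = f1 m1)"
    have "dpred (\<lambda>x. f1 x = f1 m1)" by (intro dfn Dt_comp1[OF df1] m1M)
    note X1 = mem_collect[OF this X(1), folded X1_def]
    have X1M: "X1 \<in> M" by (simp add: X1_def)
    have "m1 \<epsilon> X1" unfolding X1 using m1 by blast
    from min_on[OF X1M this df2(1)] obtain m2 where m2: "m2 \<epsilon> X1" "\<And>y. y \<epsilon> X1 \<Longrightarrow> \<not> pfst y \<epsilon> pfst m2"
      using o(2) X(3) X1 by blast
    have m2M: "m2 \<in> M" by (rule trans[OF X1M m2(1)])
    define X2 where "X2 = collect X1 (\<lambda>x. pfst x = pfst m2)"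
    have "dpred (\<lambda>x. pfst x = pfst m2)" by (intro dfn m2M)
    note X2 = mem_collect[OF this X1M, folded X2_def]
    have X2M: "X2 \<in> M" by (simp add: X2_def)
    have "m2 \<epsilon> X2" unfolding X2 using m2 by blast
    from min_on[OF X2M this df2(2)] obtain m3 where m3: "m3 \<epsilon> X2" "\<And>y. y \<epsilon> X2 \<Longrightarrow> \<not> psnd y \<epsilon> psnd m3"
      using o(3) X(3) X1 X2 by blast
    have e: "m3 \<epsilon> X" "f1 m3 = f1 m1" "pfst m3 = pfst m2" using m3(1) unfolding X2 X1 by auto
    have "\<not> R y m3" if y: "y \<epsilon> X" for y
      unfolding R_def e(2,3) using m1(2)[OF y] m2(2)[of y] m3(2)[of y] y X1[of y] X2[of y] by auto
    with e(1) show ?thesis by blast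
  qed
  have tr: "R x z" if A: "x \<epsilon> A" "y \<epsilon> A" "z \<epsilon> A" and R: "R x y" "R y z" for x y z
    using R Ord_trans[OF o(1)[OF A(3)], of "f1 y" "f1 x"] Ord_trans[OF o(2)[OF A(3)], of "pfst y" "pfst x"]
      Ord_trans[OF o(3)[OF A(3)], of "psnd y" "psnd x"] unfolding R_def by auto
  have tot: "R x y \<or> x = y \<or> R y x" if A: "x \<epsilon> A" "y \<epsilon> A" for x y
  proof -
    have "x = y" if "pfst x = pfst y" "psnd x = psnd y" using inA[OF A(1)] inA[OF A(2)] that by metis
    then show ?thesis
      using Ord_linear[OF o(1)[OF A(1)] o(1)[OF A(2)]] Ord_linear[OF o(2)[OF A(1)] o(2)[OF A(2)]]
        Ord_linear[OF o(3)[OF A(1)] o(3)[OF A(2)]] unfolding R_def by auto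
  qed
  obtain c where c: "dfun c" "\<And>x. x \<epsilon> A \<Longrightarrow> Ord (c x)"
    "\<And>x z. x \<epsilon> A \<Longrightarrow> z \<epsilon> c x \<longleftrightarrow> (\<exists>y. y \<epsilon> A \<and> R y x \<and> z = c y)"
    by (rule mostowski_collapse[OF A dR wf tr], assumption+, rule that)
  have cm: "c y \<epsilon> c x" if "y \<epsilon> A" "x \<epsilon> A" "R y x" for x y using c(3)[OF that(2)] that by blast
  have cinj: "inj_on c (el A)"
  proof (rule inj_onI)
    fix x y assume x: "x \<in> el A" and y: "y \<in> el A" and e: "c x = c y"
    have "\<not> c x \<epsilon> c x" using x c(2) mem_irrefl Ord_in by auto
    then show "x = y" using tot[of x y] cm[of x y] cm[of y x] x y e by auto
  qed
  define G where "G z = finv A c z" for z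
  have dG: "dfun G" unfolding G_def by (intro dfun_finv c A dfn)
  have cG: "G (c q) = q" if "q \<epsilon> A" for q unfolding G_def by (rule finv_eq[OF A cinj that])
  have cb: "c p \<epsilon> k" if p: "p \<epsilon> A" for p
  proof (rule ccontr)
    assume n: "\<not> c p \<epsilon> k"
    define b where "b = suc (f1 p)"
    have b: "b \<epsilon> k" unfolding b_def using k(3) f1A[OF p] .
    have bM: "b \<in> M" using b by simp
    have Gz: "pfst (G z) \<epsilon> b \<and> psnd (G z) \<epsilon> b \<and> c (G z) = z \<and> G z \<epsilon> A" if z: "z \<epsilon> k" for z
    proof -
      have "z \<epsilon> c p" using n z Ord_linear[OF c(2)[OF p] k(1)] Ord_trans[OF c(2)[OF p], of k z] by auto
      then obtain q where q: "q \<epsilon> A" "R q p" "z = c q" using c(3)[OF p] by blast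
      have "f1 q \<epsilon> b" using q(2) f1A[OF p] unfolding R_def b_def by auto
      moreover have "pfst q = f1 q \<or> pfst q \<epsilon> f1 q" "psnd q = f1 q \<or> psnd q \<epsilon> f1 q"
        using Ord_linear[OF o(2,3)[OF q(1)]] unfolding f1_def mx_def by auto
      ultimately have "pfst q \<epsilon> b" "psnd q \<epsilon> b" using Ord_trans[OF k_Ord[OF b], of "f1 q"] by auto
      then show ?thesis using q cG by simp
    qed
    \<comment> \<open>All of \<open>k\<close> would be bounded in \<open>k\<close>: regularity over
      the second coordinates bounds the elements with first coordinate \<open>i\<close>, and
      regularity over \<open>i\<close> gives a common bound.\<close>
    define Q where "Q i g \<longleftrightarrow> (\<forall>z. z \<epsilon> k \<longrightarrow> pfst (G z) = i \<longrightarrow> z \<epsilon> g)" for i g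
    have dQ: "dpred2 Q" unfolding Q_def by (intro dfn kM Dt_comp1[OF dG])
    have "\<exists>g. g \<epsilon> k \<and> (\<forall>i. i \<epsilon> b \<longrightarrow> Q i g)"
    proof (rule reg_all[OF dQ b])
      fix i assume i: "i \<epsilon> b"
      then have iM: "i \<in> M" by (rule trans[OF bM])
      define H where "H j = tht (\<lambda>z. z \<epsilon> k \<and> pfst (G z) = i \<and> psnd (G z) = j)" for j
      have dH: "dfun H" unfolding H_def by (intro dfn kM iM Dt_comp1[OF dG])
      have Hz: "H j = z" if "z \<epsilon> k" "pfst (G z) = i" "psnd (G z) = j" for z j
        unfolding H_def
      proof (rule tht_eq)
        fix y assume y: "y \<epsilon> k \<and> pfst (G y) = i \<and> psnd (G y) = j"
        have "G y = opair (pfst (G y)) (psnd (G y))" "G z = opair (pfst (G z)) (psnd (G z))"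
          using inA Gz y that(1) by blast+
        then have "G y = G z" using y that by simp
        then show "y = z" using Gz y that(1) by metis
      qed (use that in auto)
      have "H j \<epsilon> k" for j
      proof (cases "\<exists>z. z \<epsilon> k \<and> pfst (G z) = i \<and> psnd (G z) = j")
        case True
        then show ?thesis using Hz by auto
      next
        case False
        then have "H j = zer" unfolding H_def tht_def by auto
        then show ?thesis using k by simp
      qed
      then obtain g where g: "g \<epsilon> k" "\<forall>j. j \<epsilon> b \<longrightarrow> H j \<epsilon> g" using bounded[OF dH b] by blast
      have "Q i g" unfolding Q_def
      proof (intro allI impI)
        fix z assume z: "z \<epsilon> k" "pfst (G z) = i"
        then have "H (psnd (G z)) = z" using Hz by blast
        then show "z \<epsilon> g" using g(2) Gz[OF z(1)] by metis
      qed
      with g show "\<exists>g. g \<epsilon> k \<and> Q i g" by blast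
    next
      fix i g h assume "Q i g" "g \<epsilon> h" "h \<epsilon> k"
      then show "Q i h" unfolding Q_def using Ord_trans[OF k_Ord[of h]] by blast
    qed
    then obtain g where g: "g \<epsilon> k" "\<forall>i. i \<epsilon> b \<longrightarrow> Q i g" by blast
    then have "g \<epsilon> g" using Gz[OF g(1)] unfolding Q_def by blast
    then show False using mem_irrefl g(1) by simp
  qed
  have inA2: "opair a b \<epsilon> A" if "a \<epsilon> k" "b \<epsilon> k" for a b unfolding mA using that by blast
  have ge: "\<not> c (opair a b) \<epsilon> b" if ab: "a \<epsilon> k" "b \<epsilon> k" for a b
  proof
    assume n: "c (opair a b) \<epsilon> b"
    \<comment> \<open>Take the least \<open>x\<close> whose code lies below it and let
      \<open>y\<close> be that code. The code of the pair of \<open>a\<close> and \<open>y\<close>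
      is below that of \<open>a\<close> and \<open>x\<close>, hence below \<open>y\<close>, against
      the choice of \<open>x\<close>.\<close>
    have d: "dpred (\<lambda>x. x \<epsilon> k \<and> c (opair a x) \<epsilon> x)" using ab by (intro dfn Dt_comp1[OF c(1)] kM) simp
    from Ord_min[of "\<lambda>x. x \<epsilon> k \<and> c (opair a x) \<epsilon> x", OF d k_Ord[OF ab(2)]] n ab(2) obtain x where
      x: "x \<epsilon> k" "c (opair a x) \<epsilon> x" "\<And>y. y \<epsilon> x \<Longrightarrow> \<not> (y \<epsilon> k \<and> c (opair a y) \<epsilon> y)" by blast
    define y where "y = c (opair a x)"
    have y: "y \<epsilon> x" "y \<epsilon> k" using x k_down unfolding y_def by blast+
    have "R (opair a y) (opair a x)"
      unfolding R_def f1_def using ab(1) x(1) y Ord_trans[OF k_Ord[OF x(1)] y(1), of a] by (auto simp: mx_def)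
    from cm[OF inA2[OF ab(1) y(2)] inA2[OF ab(1) x(1)] this] have "c (opair a y) \<epsilon> y" by (simp add: y_def)
    with x(3)[OF y(1)] y(2) show False by blast
  qed
  show thesis
  \<comment> \<open>The collapse puts \<open>b\<close> at most at the code of its pair; the
    successor makes \<open>b\<close> strictly smaller, as a recursion on codes requires.\<close>
  proof (rule that[of "\<lambda>a b. suc (c (opair a b))"])
    show "dfun2 (\<lambda>a b. suc (c (opair a b)))" by (intro dfn Dt_comp1[OF c(1)])
    fix a b assume ab: "a \<epsilon> k" "b \<epsilon> k"
    note cab = cb[OF inA2[OF ab]]
    show "suc (c (opair a b)) \<epsilon> k" by (rule k(3)[OF cab])
    show "b \<epsilon> suc (c (opair a b))"
      using ge[OF ab] Ord_linear[OF k_Ord[OF cab] k_Ord[OF ab(2)]] cab by auto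
    fix a' b' assume ab': "a' \<epsilon> k" "b' \<epsilon> k" and e: "suc (c (opair a b)) = suc (c (opair a' b'))"
    from suc_inj[OF _ _ e] have "c (opair a b) = c (opair a' b')" using cab cb[OF inA2[OF ab']] by simp
    then have "opair a b = opair a' b'" using inj_onD[OF cinj] inA2 ab ab' by simp
    then show "a = a' \<and> b = b'" using ab ab' by simp
  qed
qed

section \<open>End segments of unbounded subsets of a regular cardinal\<close>

definition unb :: "'a \<Rightarrow> bool" where
  "unb H \<longleftrightarrow> H \<in> M \<and> (\<forall>x. x \<epsilon> H \<longrightarrow> x \<epsilon> k) \<and> (\<forall>g. g \<epsilon> k \<longrightarrow> (\<exists>x. x \<epsilon> H \<and> g \<epsilon> x))"

text \<open>The filter of end segments of \<open>H\<close>, which takes the place of an ultrafilter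
  on \<open>k\<close>.\<close>

definition ev :: "'a \<Rightarrow> ('a \<Rightarrow> bool) \<Rightarrow> bool" where
  "ev H Q \<longleftrightarrow> (\<exists>g. g \<epsilon> k \<and> (\<forall>a. a \<epsilon> H \<longrightarrow> g \<epsilon> a \<longrightarrow> Q a))"

lemma D_ev [dfn]:
  assumes "Dt H" "D (\<lambda>v. Q (v 0) (\<lambda>n. v (Suc n)))"
  shows "D (\<lambda>v. ev (H v) (\<lambda>a. Q a v))"
  unfolding ev_def by (intro dfn kM Dt_shift assms(1) D_lift[OF assms(2)])

lemma k_mx: "x \<epsilon> k \<Longrightarrow> y \<epsilon> k \<Longrightarrow> mx x y \<epsilon> k"
  by (simp add: mx_def)

lemma mx_less: "x \<epsilon> k \<Longrightarrow> y \<epsilon> k \<Longrightarrow> a \<epsilon> k \<Longrightarrow> mx x y \<epsilon> a \<Longrightarrow> x \<epsilon> a \<and> y \<epsilon> a"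
  using Ord_trans[OF k_Ord, of a] Ord_linear[OF k_Ord k_Ord, of x y] by (auto simp: mx_def split: if_splits)

lemma unbD: "unb H \<Longrightarrow> H \<in> M" "unb H \<Longrightarrow> x \<epsilon> H \<Longrightarrow> x \<epsilon> k" "unb H \<Longrightarrow> g \<epsilon> k \<Longrightarrow> \<exists>x. x \<epsilon> H \<and> g \<epsilon> x"
  unfolding unb_def by blast+

lemma ev_mono: "ev H P \<Longrightarrow> (\<And>a. a \<epsilon> H \<Longrightarrow> P a \<Longrightarrow> Q a) \<Longrightarrow> ev H Q"
  unfolding ev_def by blast

lemma ev_conj:
  assumes "unb H" "ev H P" "ev H Q" shows "ev H (\<lambda>a. P a \<and> Q a)"
proof -
  obtain g where g: "g \<epsilon> k" "\<And>a. a \<epsilon> H \<Longrightarrow> g \<epsilon> a \<Longrightarrow> P a" using assms(2) unfolding ev_def by blast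
  obtain h where h: "h \<epsilon> k" "\<And>a. a \<epsilon> H \<Longrightarrow> h \<epsilon> a \<Longrightarrow> Q a" using assms(3) unfolding ev_def by blast
  show ?thesis unfolding ev_def
    by (rule exI[of _ "mx g h"]) (use g h k_mx mx_less[OF g(1) h(1)] unbD(2)[OF assms(1)] in blast)
qed

lemma ev_gt: "g \<epsilon> k \<Longrightarrow> ev H (\<lambda>a. g \<epsilon> a)"
  unfolding ev_def by blast

lemma ev_ex: "unb H \<Longrightarrow> ev H Q \<Longrightarrow> \<exists>a. a \<epsilon> H \<and> Q a"
  unfolding ev_def using unbD(3) by blast

text \<open>The filter is closed under fewer than \<open>k\<close> intersections, because the
  thresholds of the single conditions have a common bound by regularity.\<close>

lemma ev_all:
  assumes H: "unb H" and Q: "dpred2 Q" and b: "b \<epsilon> k" and e: "\<And>i. i \<epsilon> b \<Longrightarrow> ev H (Q i)"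
  shows "ev H (\<lambda>a. \<forall>i. i \<epsilon> b \<longrightarrow> Q i a)"
proof -
  have "\<exists>g. g \<epsilon> k \<and> (\<forall>i. i \<epsilon> b \<longrightarrow> (\<forall>a. a \<epsilon> H \<longrightarrow> g \<epsilon> a \<longrightarrow> Q i a))"
  proof (rule reg_all[where Q = "\<lambda>i g. \<forall>a. a \<epsilon> H \<longrightarrow> g \<epsilon> a \<longrightarrow> Q i a"])
    show "dpred2 (\<lambda>i g. \<forall>a. a \<epsilon> H \<longrightarrow> g \<epsilon> a \<longrightarrow> Q i a)"
      by (intro dfn D_comp2[OF Q] unbD(1)[OF H])
    show "b \<epsilon> k" by fact
    fix i assume "i \<epsilon> b"
    then show "\<exists>g. g \<epsilon> k \<and> (\<forall>a. a \<epsilon> H \<longrightarrow> g \<epsilon> a \<longrightarrow> Q i a)" using e unfolding ev_def by blast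
  next
    fix i g h assume *: "\<forall>a. a \<epsilon> H \<longrightarrow> g \<epsilon> a \<longrightarrow> Q i a" "g \<epsilon> h"
    show "\<forall>a. a \<epsilon> H \<longrightarrow> h \<epsilon> a \<longrightarrow> Q i a"
    proof (intro allI impI)
      fix a assume a: "a \<epsilon> H" "h \<epsilon> a"
      then have "g \<epsilon> a" using *(2) Ord_trans[OF k_Ord[OF unbD(2)[OF H]]] by blast
      then show "Q i a" using *(1) a by blast
    qed
  qed
  then show ?thesis unfolding ev_def by blast
qed

end

context zf
begin

lemma is_two_iff: "t \<in> M \<Longrightarrow> is_two t \<longleftrightarrow> t = suc (suc zer)"
proof -
  assume t: "t \<in> M"
  have e: "is_empty z \<longleftrightarrow> z = zer" if "z \<in> M" for z
  proof
    assume "is_empty z"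
    then show "z = zer" using trans[OF that] by (intro set_ext that zer) (auto simp: is_empty_def)
  qed (simp add: is_empty_def)
  have "is_two t \<longleftrightarrow> (\<exists>z\<in>M. \<exists>u\<in>M. z = zer \<and> u = suc z \<and> t = suc u)"
    unfolding is_two_def by (intro bex_cong refl) (simp add: e is_succ_iff t)
  then show ?thesis by simp
qed

end

section \<open>Weakly compact cardinals\<close>

locale wc = zf +
  fixes k :: 'a
  assumes wcM: "k \<in> M" and wc: "weakly_compact k"
begin

lemma wc_Ord: "Ord k" and wc_card: "is_card k"
  using wcM wc unfolding weakly_compact_def uncountable_card_def is_card_def Ord_def by blast+

lemma wc_omega:
  obtains w where "w \<epsilon> k" "is_omega w" "zer \<epsilon> w" "\<And>x. x \<epsilon> w \<Longrightarrow> suc x \<epsilon> w"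
proof -
  obtain w where w: "w \<in> M" "is_omega w" "w \<epsilon> k" using wc unfolding weakly_compact_def uncountable_card_def by blast
  have o: "Ord w" using w unfolding Ord_def is_omega_def is_limit_def by blast
  have l: "\<not> is_empty w" "\<And>y. y \<epsilon> w \<Longrightarrow> \<exists>s\<in>M. is_succ s y \<and> s \<epsilon> w"
    using w(2) trans[OF w(1)] unfolding is_omega_def is_limit_def by blast+
  have "zer \<epsilon> w"
  proof -
    have "\<exists>x. x \<epsilon> w" using l(1) unfolding is_empty_def by blast
    then show ?thesis using Ord_linear[OF o Ord_zer] by auto
  qed
  moreover have "suc x \<epsilon> w" if "x \<epsilon> w" for x
    using l(2)[OF that] is_succ_iff trans[OF w(1) that] by blast
  ultimately show thesis using that w by blast
qed

text \<open>An infinite successor ordinal is no cardinal: \<open>F\<close> moves the last element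
  \<open>x\<close> to \<open>zer\<close> and shifts \<omega> up by one, which injects
  \<open>k\<close> into \<open>x\<close>.\<close>

lemma wc_suc: assumes x: "x \<epsilon> k" shows "suc x \<epsilon> k"
proof (rule ccontr)
  assume n: "\<not> suc x \<epsilon> k"
  have ox: "Ord x" by (rule Ord_elem[OF wc_Ord x])
  have "suc x = k"
  proof -
    have "y \<epsilon> k" if "y \<epsilon> suc x" for y using that x Ord_trans[OF wc_Ord x] ox by auto
    then show ?thesis using Ord_subset[OF Ord_suc[OF ox] wc_Ord] n by blast
  qed
  obtain w where w: "w \<epsilon> k" "zer \<epsilon> w" "\<And>x. x \<epsilon> w \<Longrightarrow> suc x \<epsilon> w" using wc_omega by metis
  have wM: "w \<in> M" by (rule trans[OF wcM w(1)])
  have "w = x \<or> w \<epsilon> x" using w(1) mem_suc[OF Ord_in[OF ox]] unfolding \<open>suc x = k\<close>[symmetric] by blast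
  then have wx: "y \<epsilon> x" if "y \<epsilon> w" for y using that Ord_trans[OF ox] by blast
  define F where "F y = (if y = x then zer else if y \<epsilon> w then suc y else y)" for y
  show False
  proof (rule card_no_inj[OF wcM wc_card x])
    show "dfun F" unfolding F_def by (intro dfn wM zer Ord_in[OF ox])
    fix y assume "y \<epsilon> k"
    then show "F y \<epsilon> x" using ox wx w unfolding \<open>suc x = k\<close>[symmetric] F_def by auto
  next
    show "inj_on F (el k)"
    proof (rule inj_onI)
      fix y z assume "y \<in> el k" "z \<in> el k" and e: "F y = F z"
      then have o: "Ord y" "Ord z" using Ord_elem[OF wc_Ord] by simp_all
      have nz: "zer \<noteq> suc u" if "Ord u" for u using mem_suc[of u u] that zer(2) Ord_in by metis
      have nw: "\<not> u \<epsilon> w \<Longrightarrow> v \<epsilon> w \<Longrightarrow> suc v \<noteq> u" for u v using w(3) by blast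
      have nw0: "\<not> u \<epsilon> w \<Longrightarrow> zer \<noteq> u" for u using w(2) by blast
      show "y = z" using e nz[OF o(1)] nz[OF o(2)] nw[of y z] nw[of z y] nw0[of y] nw0[of z] suc_inj[OF o]
        unfolding F_def by (auto split: if_splits)
    qed
  qed
qed

text \<open>The colour of a doubleton tells whether \<open>C\<close> holds from its smaller to its
  larger element. A homogeneous set of size \<open>k\<close> is unbounded, since a bounded one would
  inject \<open>k\<close> into a smaller ordinal. The enumeration \<open>f\<close> is kept because
  regularity is yet to be derived from this statement.\<close>

lemma partition:
  assumes C: "dpred2 C"
  obtains H f where "H \<in> M" "\<And>x. x \<epsilon> H \<Longrightarrow> x \<epsilon> k" "\<And>g. g \<epsilon> k \<Longrightarrow> \<exists>x. x \<epsilon> H \<and> g \<epsilon> x"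
    "f \<in> M" "bij_betw (ap f) (el k) (el H)"
    "(\<forall>x y. x \<epsilon> H \<longrightarrow> y \<epsilon> H \<longrightarrow> x \<epsilon> y \<longrightarrow> C x y) \<or> (\<forall>x y. x \<epsilon> H \<longrightarrow> y \<epsilon> H \<longrightarrow> x \<epsilon> y \<longrightarrow> \<not> C x y)"
proof -
  define P where "P = collect (pow k) (\<lambda>p. \<exists>x. x \<epsilon> k \<and> (\<exists>y. y \<epsilon> k \<and> x \<noteq> y \<and> p = upair x y))"
  have PM: "P \<in> M" by (simp add: P_def)
  have kin: "x \<in> M" "Ord x" if "x \<epsilon> k" for x using that trans[OF wcM] Ord_elem[OF wc_Ord] by blast+
  have "dpred (\<lambda>p. \<exists>x. x \<epsilon> k \<and> (\<exists>y. y \<epsilon> k \<and> x \<noteq> y \<and> p = upair x y))" by (intro dfn wcM)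
  note mP = mem_collect[OF this, of "pow k", folded P_def]
  have mP: "p \<epsilon> P \<longleftrightarrow> (\<exists>x. x \<epsilon> k \<and> (\<exists>y. y \<epsilon> k \<and> x \<noteq> y \<and> p = upair x y))" for p
    unfolding mP[OF in_M(4)] mem_pow[OF wcM] using kin by auto
  have P: "is_doubletons P k" unfolding is_doubletons_def
  proof (intro ballI)
    fix p assume p: "p \<in> M"
    show "p \<epsilon> P \<longleftrightarrow> (\<exists>x\<in>M. \<exists>y\<in>M. x \<epsilon> k \<and> y \<epsilon> k \<and> x \<noteq> y \<and> is_upair p x y)"
      unfolding mP using is_upair_iff[OF p] kin(1) by blast
  qed
  define t where "t = suc (suc zer)"
  have t: "is_two t" "t \<in> M" unfolding t_def by (simp_all add: is_two_iff)
  define F where "F p = (if \<exists>x. x \<epsilon> p \<and> (\<exists>y. y \<epsilon> p \<and> x \<epsilon> y \<and> C x y) then suc zer else zer)" for p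
  have dF: "dfun F" unfolding F_def by (intro dfn D_comp2[OF C] in_M zer)
  have F: "is_fun (lam P F) P t" by (rule is_fun_lam[OF dF PM t(2)]) (simp add: F_def t_def)
  obtain H where H: "H \<in> M" "sub H k" "has_card H k" "homogeneous (lam P F) H"
    using wc P t F PM in_M(9) unfolding weakly_compact_def by blast
  have Hk: "x \<epsilon> k" if "x \<epsilon> H" for x using H(2) that trans[OF H(1)] unfolding sub_def by blast
  from H(3) have "equipotent k H" unfolding has_card_def using equipotent_sym H(1) wcM by blast
  then obtain f where f: "f \<in> M" "bij_betw (ap f) (el k) (el H)" using equipotentE wcM H(1) by blast
  have fH: "ap f x \<epsilon> H" if "x \<epsilon> k" for x using bij_betwE[OF f(2)] that by simp
  have unbd: "\<exists>x. x \<epsilon> H \<and> g \<epsilon> x" if g: "g \<epsilon> k" for g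
  proof (rule ccontr)
    assume n: "\<not> (\<exists>x. x \<epsilon> H \<and> g \<epsilon> x)"
    show False
    proof (rule card_no_inj[OF wcM wc_card wc_suc[OF g]])
      show "dfun (ap f)" by (intro dfn f)
      show "inj_on (ap f) (el k)" using f(2) by (rule bij_betw_imp_inj_on)
      fix x assume "x \<epsilon> k"
      then have "\<not> g \<epsilon> ap f x" "Ord (ap f x)" using n fH Hk kin(2) by blast+
      then show "ap f x \<epsilon> suc g" using Ord_linear[of g "ap f x"] kin[OF g] by auto
    qed
  qed
  from H(4) obtain i where i: "\<And>x y p. x \<in> M \<Longrightarrow> y \<in> M \<Longrightarrow> p \<in> M \<Longrightarrow> x \<epsilon> H \<Longrightarrow> y \<epsilon> H \<Longrightarrow> x \<noteq> y \<Longrightarrow> is_upair p x y \<Longrightarrow> app (lam P F) p i"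
    "i \<in> M" unfolding homogeneous_def by blast
  have Ci: "C x y \<longleftrightarrow> i = suc zer" if xy: "x \<epsilon> H" "y \<epsilon> H" "x \<epsilon> y" for x y
  proof -
    have M: "x \<in> M" "y \<in> M" "Ord x" "Ord y" using kin Hk xy by blast+
    have ne: "x \<noteq> y" using mem_irrefl M xy by blast
    have "app (lam P F) (upair x y) i" using i(1)[OF M(1,2) _ xy(1,2) ne] is_upair_iff M by auto
    then have "i = F (upair x y)" using app_lam[OF dF PM in_M(3) i(2)] by blast
    moreover have "(\<exists>u. u \<epsilon> upair x y \<and> (\<exists>v. v \<epsilon> upair x y \<and> u \<epsilon> v \<and> C u v)) \<longleftrightarrow> C x y"
      using M xy(3) Ord_asym[OF M(4) xy(3)] mem_irrefl[OF M(1)] mem_irrefl[OF M(2)] by auto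
    moreover have "zer \<noteq> suc zer" using mem_suc[of zer zer] zer by metis
    ultimately show ?thesis unfolding F_def by simp
  qed
  show thesis
    by (rule that[OF H(1) Hk unbd f]) (use Ci in blast)+
qed

text \<open>
  Were \<open>F : b \<rightarrow> k\<close> unbounded, colour \<open>{x, y}\<close> by whether the least \<open>i\<close> with \<open>x \<le> F i\<close> is that for \<open>y\<close>.
\<close>

lemma wc_regular:
  assumes F: "dfun F" and b: "b \<epsilon> k" and Fk: "\<And>x. x \<epsilon> b \<Longrightarrow> F x \<epsilon> k"
  shows "\<exists>g. g \<epsilon> k \<and> (\<forall>x. x \<epsilon> b \<longrightarrow> F x \<epsilon> g)"
proof (rule ccontr)
  assume "\<not> ?thesis"
  then have n: "\<exists>x. x \<epsilon> b \<and> \<not> F x \<epsilon> g" if "g \<epsilon> k" for g using that by blast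
  have kin: "x \<in> M" "Ord x" if "x \<epsilon> k" for x using that trans[OF wcM] Ord_elem[OF wc_Ord] by blast+
  have bk: "x \<epsilon> k" if "x \<epsilon> b" for x by (rule Ord_trans[OF wc_Ord b that])
  define \<rho> where "\<rho> x = tht (\<lambda>i. i \<epsilon> b \<and> \<not> F i \<epsilon> x \<and> (\<forall>j. j \<epsilon> i \<longrightarrow> F j \<epsilon> x))" for x
  have d\<rho>: "dfun \<rho>" unfolding \<rho>_def by (intro dfn Dt_comp1[OF F] kin(1) b)
  have \<rho>: "\<rho> x \<epsilon> b \<and> \<not> F (\<rho> x) \<epsilon> x" if x: "x \<epsilon> k" for x
  proof -
    obtain i0 where i0: "i0 \<epsilon> b" "\<not> F i0 \<epsilon> x" using n[OF x] by blast
    have d: "dpred (\<lambda>i. i \<epsilon> b \<and> \<not> F i \<epsilon> x)" by (intro dfn Dt_comp1[OF F] kin(1) b x)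
    from Ord_min[of "\<lambda>i. i \<epsilon> b \<and> \<not> F i \<epsilon> x", OF d kin(2)[OF bk[OF i0(1)]]] i0 obtain i where
      i: "i \<epsilon> b" "\<not> F i \<epsilon> x" "\<forall>c. c \<epsilon> i \<longrightarrow> \<not> (c \<epsilon> b \<and> \<not> F c \<epsilon> x)" by blast
    have i3: "F j \<epsilon> x" if "j \<epsilon> i" for j using i(3) Ord_trans[OF kin(2)[OF b] i(1) that] that by blast
    have "\<rho> x = i" unfolding \<rho>_def
    proof (rule tht_eq)
      fix y assume y: "y \<epsilon> b \<and> \<not> F y \<epsilon> x \<and> (\<forall>j. j \<epsilon> y \<longrightarrow> F j \<epsilon> x)"
      then show "y = i" using i(2) i3 Ord_linear[OF kin(2)[OF bk] kin(2)[OF bk[OF i(1)]], of y] by blast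
    qed (use i i3 kin bk in blast)+
    with i show ?thesis by simp
  qed
  have dC: "dpred2 (\<lambda>x y. \<rho> x = \<rho> y)" by (intro dfn Dt_comp1[OF d\<rho>])
  obtain H f where H: "H \<in> M" "\<And>x. x \<epsilon> H \<Longrightarrow> x \<epsilon> k" "\<And>g. g \<epsilon> k \<Longrightarrow> \<exists>x. x \<epsilon> H \<and> g \<epsilon> x"
    and f: "f \<in> M" "bij_betw (ap f) (el k) (el H)" and
    C: "(\<forall>x y. x \<epsilon> H \<longrightarrow> y \<epsilon> H \<longrightarrow> x \<epsilon> y \<longrightarrow> \<rho> x = \<rho> y) \<or> (\<forall>x y. x \<epsilon> H \<longrightarrow> y \<epsilon> H \<longrightarrow> x \<epsilon> y \<longrightarrow> \<rho> x \<noteq> \<rho> y)"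
    by (rule partition[OF dC], rule that)
  from C show False
  proof
    \<comment> \<open>With \<open>\<rho>\<close> constant on \<open>H\<close>, the single ordinal
      \<open>F (\<rho> x0)\<close> would bound \<open>H\<close>.\<close>
    assume C: "\<forall>x y. x \<epsilon> H \<longrightarrow> y \<epsilon> H \<longrightarrow> x \<epsilon> y \<longrightarrow> \<rho> x = \<rho> y"
    obtain x0 where x0: "x0 \<epsilon> H" using H(3)[OF b] by blast
    note x0k = H(2)[OF x0]
    have Fi: "F (\<rho> x0) \<epsilon> k" using \<rho>[OF x0k] Fk by blast
    have "\<exists>y. y \<epsilon> H \<and> x0 \<epsilon> y \<and> F (\<rho> x0) \<epsilon> y"
    proof (cases "x0 \<epsilon> F (\<rho> x0)")
      case True
      obtain y where "y \<epsilon> H" "F (\<rho> x0) \<epsilon> y" using H(3)[OF Fi] by blast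
      then show ?thesis using True Ord_trans[OF kin(2)[OF H(2)]] by blast
    next
      case False
      obtain y where "y \<epsilon> H" "x0 \<epsilon> y" using H(3)[OF x0k] by blast
      moreover have "F (\<rho> x0) = x0 \<or> F (\<rho> x0) \<epsilon> x0" using False Ord_linear[OF kin(2)[OF x0k] kin(2)[OF Fi]] by auto
      ultimately show ?thesis using Ord_trans[OF kin(2)[OF H(2)], of y x0] by auto
    qed
    then obtain y where y: "y \<epsilon> H" "x0 \<epsilon> y" "F (\<rho> x0) \<epsilon> y" by blast
    then have "\<rho> x0 = \<rho> y" using C x0 by blast
    then show False using \<rho>[OF H(2)[OF y(1)]] y(3) by simp
  next
    \<comment> \<open>With \<open>\<rho>\<close> injective on \<open>H\<close>, the enumeration of
      \<open>H\<close> would inject \<open>k\<close> into \<open>b\<close>.\<close>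
    assume C: "\<forall>x y. x \<epsilon> H \<longrightarrow> y \<epsilon> H \<longrightarrow> x \<epsilon> y \<longrightarrow> \<rho> x \<noteq> \<rho> y"
    have fH: "ap f x \<epsilon> H" if "x \<epsilon> k" for x using bij_betwE[OF f(2)] that by simp
    show False
    proof (rule card_no_inj[OF wcM wc_card b])
      show "dfun (\<lambda>x. \<rho> (ap f x))" by (intro dfn Dt_comp1[OF d\<rho>] f)
      show "\<rho> (ap f x) \<epsilon> b" if "x \<epsilon> k" for x using \<rho> H(2) fH that by blast
      show "inj_on (\<lambda>x. \<rho> (ap f x)) (el k)"
      proof (rule inj_onI)
        fix x y assume x: "x \<in> el k" and y: "y \<in> el k" and e: "\<rho> (ap f x) = \<rho> (ap f y)"
        then have fx: "ap f x \<epsilon> H" "ap f y \<epsilon> H" using fH by simp_all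
        have "ap f x = ap f y"
          using Ord_linear[OF kin(2)[OF H(2)[OF fx(1)]] kin(2)[OF H(2)[OF fx(2)]]] C fx e by metis
        then show "x = y" using inj_onD[OF bij_betw_imp_inj_on[OF f(2)]] x y by blast
      qed
    qed
  qed
qed

lemma wc_zer: "zer \<epsilon> k"
proof -
  obtain w where "w \<epsilon> k" "zer \<epsilon> w" using wc_omega by metis
  then show ?thesis using Ord_trans[OF wc_Ord] by blast
qed

end

sublocale wc \<subseteq> reg
  by unfold_locales (rule wc_Ord wc_zer wc_suc wc_regular; assumption)+

context wc
begin

lemma partition_unb:
  assumes dC: "dpred2 C"
  obtains H where "unb H"
    "(\<forall>x y. x \<epsilon> H \<longrightarrow> y \<epsilon> H \<longrightarrow> x \<epsilon> y \<longrightarrow> C x y) \<or> (\<forall>x y. x \<epsilon> H \<longrightarrow> y \<epsilon> H \<longrightarrow> x \<epsilon> y \<longrightarrow> \<not> C x y)"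
proof -
  obtain H f where H: "H \<in> M" "\<And>x. x \<epsilon> H \<Longrightarrow> x \<epsilon> k" "\<And>g. g \<epsilon> k \<Longrightarrow> \<exists>x. x \<epsilon> H \<and> g \<epsilon> x"
    and f: "f \<in> M" "bij_betw (ap f) (el k) (el H)" and
    C: "(\<forall>x y. x \<epsilon> H \<longrightarrow> y \<epsilon> H \<longrightarrow> x \<epsilon> y \<longrightarrow> C x y) \<or> (\<forall>x y. x \<epsilon> H \<longrightarrow> y \<epsilon> H \<longrightarrow> x \<epsilon> y \<longrightarrow> \<not> C x y)"
    by (rule partition[OF dC], rule that)
  have "unb H" unfolding unb_def using H by blast
  then show thesis using C by (rule that)
qed

text \<open>
  A set homogeneous for the lexicographic order of the 0-1-sequences \<open>\<lambda>i. A i a\<close> is monotone, so each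
  coordinate stabilizes, by induction on the coordinate.
\<close>

lemma eventually_decided:
  assumes A: "dpred2 A"
  obtains H where "unb H" "\<And>i. i \<epsilon> k \<Longrightarrow> ev H (A i) \<or> ev H (\<lambda>a. \<not> A i a)"
proof -
  \<comment> \<open>\<open>C x y\<close>: the sequence of \<open>x\<close> precedes that of
    \<open>y\<close> lexicographically, with the first difference at \<open>i\<close>.\<close>
  define C where "C x y \<longleftrightarrow> (\<exists>i. i \<epsilon> k \<and> (\<forall>j. j \<epsilon> i \<longrightarrow> (A j x \<longleftrightarrow> A j y)) \<and> \<not> A i x \<and> A i y)" for x y
  have dC: "dpred2 C" unfolding C_def by (intro dfn D_comp2[OF A] kM)
  obtain H where H: "unb H" and
    C: "(\<forall>x y. x \<epsilon> H \<longrightarrow> y \<epsilon> H \<longrightarrow> x \<epsilon> y \<longrightarrow> C x y) \<or> (\<forall>x y. x \<epsilon> H \<longrightarrow> y \<epsilon> H \<longrightarrow> x \<epsilon> y \<longrightarrow> \<not> C x y)"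
    by (rule partition_unb[OF dC], rule that)
  have HM: "H \<in> M" by (rule unbD(1)[OF H])
  have Hk: "x \<epsilon> k" if "x \<epsilon> H" for x using unbD(2)[OF H that] .
  have up: "g \<epsilon> b" if "g \<epsilon> a" "a \<epsilon> b" "b \<epsilon> H" for g a b
    by (rule Ord_trans[OF k_Ord[OF Hk[OF that(3)]] that(2,1)])
  have "i \<epsilon> k \<longrightarrow> ev H (A i) \<or> ev H (\<lambda>a. \<not> A i a)" if "Ord i" for i
  proof (rule Ord_induct[where P = "\<lambda>i. i \<epsilon> k \<longrightarrow> ev H (A i) \<or> ev H (\<lambda>a. \<not> A i a)"])
    show "dpred (\<lambda>i. i \<epsilon> k \<longrightarrow> ev H (A i) \<or> ev H (\<lambda>a. \<not> A i a))"
      by (intro dfn D_comp2[OF A] kM HM)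
    show "Ord i" by fact
    fix i assume IH: "\<And>j. j \<epsilon> i \<Longrightarrow> j \<epsilon> k \<longrightarrow> ev H (A j) \<or> ev H (\<lambda>a. \<not> A j a)"
    show "i \<epsilon> k \<longrightarrow> ev H (A i) \<or> ev H (\<lambda>a. \<not> A i a)"
    proof
      assume i: "i \<epsilon> k"
      \<comment> \<open>\<open>S j g\<close>: coordinate \<open>j\<close> is constant on
        \<open>H\<close> beyond \<open>g\<close>. By regularity one threshold serves all coordinates
        below \<open>i\<close>.\<close>
      define S where "S j g \<longleftrightarrow> (\<forall>a. a \<epsilon> H \<longrightarrow> (\<forall>b. b \<epsilon> H \<longrightarrow> g \<epsilon> a \<longrightarrow> g \<epsilon> b \<longrightarrow> (A j a \<longleftrightarrow> A j b)))" for j g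
      have dS: "dpred2 S" unfolding S_def by (intro dfn D_comp2[OF A] HM)
      have "\<exists>g. g \<epsilon> k \<and> (\<forall>j. j \<epsilon> i \<longrightarrow> S j g)"
      proof (rule reg_all[OF dS i])
        fix j assume j: "j \<epsilon> i"
        then have "ev H (A j) \<or> ev H (\<lambda>a. \<not> A j a)" using IH k_down[OF i] by blast
        then show "\<exists>g. g \<epsilon> k \<and> S j g" unfolding ev_def S_def by blast
      next
        fix j g h assume "S j g" "g \<epsilon> h"
        then show "S j h" unfolding S_def using up by blast
      qed
      then obtain g where g: "g \<epsilon> k" "\<And>j. j \<epsilon> i \<Longrightarrow> S j g" by blast
      have agree: "A j a \<longleftrightarrow> A j b" if "j \<epsilon> i" "a \<epsilon> H" "b \<epsilon> H" "g \<epsilon> a" "g \<epsilon> b" for j a b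
        using g(2)[OF that(1)] that(2-) unfolding S_def by blast
      from C show "ev H (A i) \<or> ev H (\<lambda>a. \<not> A i a)"
      proof
        assume C: "\<forall>x y. x \<epsilon> H \<longrightarrow> y \<epsilon> H \<longrightarrow> x \<epsilon> y \<longrightarrow> C x y"
        \<comment> \<open>Beyond \<open>g\<close> the sequences agree below \<open>i\<close>, so the
          first difference is at \<open>i\<close> or later, and coordinate \<open>i\<close> never
          falls from true to false.\<close>
        have m: "A i b" if ab: "a \<epsilon> H" "b \<epsilon> H" "g \<epsilon> a" "a \<epsilon> b" and Aa: "A i a" for a b
        proof -
          from C ab obtain i' where i': "i' \<epsilon> k" "\<forall>j. j \<epsilon> i' \<longrightarrow> (A j a \<longleftrightarrow> A j b)" "\<not> A i' a" "A i' b"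
            unfolding C_def by blast
          have "\<not> i' \<epsilon> i" using agree[of i' a b] ab up i' by blast
          then have "i' = i \<or> i \<epsilon> i'" using Ord_linear[OF k_Ord[OF i'(1)] k_Ord[OF i]] by blast
          then show ?thesis using i' Aa by blast
        qed
        show ?thesis
        proof (cases "\<exists>a. a \<epsilon> H \<and> g \<epsilon> a \<and> A i a")
          case True
          then obtain a where "a \<epsilon> H" "g \<epsilon> a" "A i a" by blast
          then have "ev H (A i)" unfolding ev_def using m Hk by blast
          then show ?thesis ..
        next
          case False
          then show ?thesis unfolding ev_def using g(1) by blast
        qed
      next
        assume C: "\<forall>x y. x \<epsilon> H \<longrightarrow> y \<epsilon> H \<longrightarrow> x \<epsilon> y \<longrightarrow> \<not> C x y"
        \<comment> \<open>A rise of coordinate \<open>i\<close> from false to true beyond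
          \<open>g\<close> would be a first difference and give \<open>C a b\<close>.\<close>
        have m: "\<not> A i b" if ab: "a \<epsilon> H" "b \<epsilon> H" "g \<epsilon> a" "a \<epsilon> b" and Aa: "\<not> A i a" for a b
        proof
          assume "A i b"
          moreover have "\<forall>j. j \<epsilon> i \<longrightarrow> (A j a \<longleftrightarrow> A j b)" using agree ab up by blast
          ultimately have "C a b" unfolding C_def using i Aa by blast
          then show False using C ab by blast
        qed
        show ?thesis
        proof (cases "\<exists>a. a \<epsilon> H \<and> g \<epsilon> a \<and> \<not> A i a")
          case True
          then obtain a where "a \<epsilon> H" "g \<epsilon> a" "\<not> A i a" by blast
          then have "ev H (\<lambda>a. \<not> A i a)" unfolding ev_def using m Hk by blast
          then show ?thesis ..
        next
          case False
          then show ?thesis unfolding ev_def using g(1) by blast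
        qed
      qed
    qed
  qed
  then show thesis using that[OF H] k_Ord by blast
qed

section \<open>Functions that represent the cardinal modulo end segments\<close>

lemma omega_cases:
  assumes w: "w \<in> M" "is_omega w" and n: "n \<epsilon> w" and n0: "n \<noteq> zer"
  obtains m where "m \<epsilon> n" "m \<epsilon> w" "n = suc m"
proof -
  have o: "Ord w" using w unfolding Ord_def is_omega_def is_limit_def by blast
  have on: "Ord n" by (rule Ord_elem[OF o n])
  have nM: "n \<in> M" using on by simp
  have "\<not> is_limit n" using w(2) n nM unfolding is_omega_def by blast
  moreover have "\<not> is_empty n" using set_ext[OF nM zer(1)] n0 trans[OF nM] by (auto simp: is_empty_def)
  ultimately obtain y where y: "y \<in> M" "y \<epsilon> n" "\<not> (\<exists>s\<in>M. is_succ s y \<and> s \<epsilon> n)"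
    using on unfolding is_limit_def Ord_def by blast
  have "is_succ (suc y) y" by (simp add: is_succ_iff y(1))
  then have sy: "\<not> suc y \<epsilon> n" using y(3) in_M(6)[of y] by blast
  have "x \<epsilon> n" if "x \<epsilon> suc y" for x using that y(1,2) Ord_trans[OF on y(2), of x] by auto
  then have "suc y = n" using Ord_subset[OF Ord_suc[OF Ord_elem[OF on y(2)]] on] sy by blast
  then show thesis using that[OF y(2) Ord_trans[OF o n y(2)]] by simp
qed

text \<open>
  An infinite descent would consist of countably many eventual inequalities, which by regularity
  hold at one common \<open>a\<close>.
\<close>

lemma eventually_minimal:
  assumes w: "w \<epsilon> k" "is_omega w" "zer \<epsilon> w" "\<And>x. x \<epsilon> w \<Longrightarrow> suc x \<epsilon> w"
    and H: "unb H" and g: "dfun2 g" "\<And>i a. i \<epsilon> k \<Longrightarrow> a \<epsilon> k \<Longrightarrow> g i a \<epsilon> k"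
    and N: "dpred N" "\<And>i. N i \<Longrightarrow> i \<epsilon> k" "N i0"
  obtains i where "N i" "\<And>j. N j \<Longrightarrow> \<not> ev H (\<lambda>a. g j a \<epsilon> g i a)"
proof (rule ccontr)
  note minimal = that
  assume n: "\<not> thesis"
  have HM: "H \<in> M" by (rule unbD(1)[OF H])
  have wM: "w \<in> M" using w by simp
  have wO: "Ord w" using w by simp
  define S where "S i j \<longleftrightarrow> N j \<and> ev H (\<lambda>a. g j a \<epsilon> g i a)" for i j
  have dS: "dpred2 S" unfolding S_def by (intro dfn D_comp1[OF N(1)] Dt_comp2[OF g(1)] HM)
  have ex: "\<exists>j. S i j" if i: "N i" for i
  proof (rule ccontr)
    assume "\<not> (\<exists>j. S i j)"
    then have "\<not> ev H (\<lambda>a. g j a \<epsilon> g i a)" if "N j" for j using that unfolding S_def by blast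
    from minimal[OF i this] n show False by blast
  qed
  \<comment> \<open>Indices are ordinals, so always taking the least next one makes the descent
    definable by recursion.\<close>
  define nx where "nx i = tht (\<lambda>j. S i j \<and> (\<forall>l. l \<epsilon> j \<longrightarrow> \<not> S i l))" for i
  have dnx: "dfun nx" unfolding nx_def by (intro dfn D_comp2[OF dS])
  have nx: "S i (nx i)" if i: "N i" for i
  proof -
    obtain j0 where j0: "S i j0" using ex[OF i] by blast
    have iM: "i \<in> M" using N(2)[OF i] by simp
    have d: "dpred (\<lambda>j. S i j)" by (intro D_comp2[OF dS] dfn iM)
    have SO: "Ord j" if "S i j" for j using that N(2) unfolding S_def by auto
    from Ord_min[of "S i", OF d SO[OF j0] j0] obtain j where
      j: "Ord j" "S i j" "\<forall>c. c \<epsilon> j \<longrightarrow> \<not> S i c" by blast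
    have "nx i = j" unfolding nx_def
    proof (rule tht_eq)
      fix y assume "S i y \<and> (\<forall>l. l \<epsilon> y \<longrightarrow> \<not> S i l)"
      then show "y = j" using Ord_linear[OF SO j(1), of y] j(2,3) by blast
    qed (use j in auto)
    with j show ?thesis by simp
  qed
  define pd where "pd n = tht (\<lambda>m. m \<epsilon> n \<and> n = suc m)" for n
  have dpd: "dfun pd" unfolding pd_def by (intro dfn)
  have pd: "pd (suc m) = m" if m: "Ord m" for m unfolding pd_def
  proof (rule tht_eq)
    fix y assume y: "y \<epsilon> suc m \<and> suc m = suc y"
    then have "Ord y" using Ord_elem[OF Ord_suc[OF m]] by blast
    from suc_inj[OF m this] y show "y = m" by simp
  qed (use m in simp_all)
  define G where "G n f = (if n = zer then i0 else nx (ap f (pd n)))" for n f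
  have i0M: "i0 \<in> M" using N(2)[OF N(3)] by simp
  have dG: "dfun2 G" unfolding G_def by (intro dfn Dt_comp1[OF dnx] Dt_comp1[OF dpd] i0M zer)
  have dE: "dpred2 (\<lambda>x y. x \<epsilon> y)" by (intro dfn)
  have trE: "x \<epsilon> z" if "x \<epsilon> w" "y \<epsilon> w" "z \<epsilon> w" "x \<epsilon> y" "y \<epsilon> z" for x y z
    by (rule Ord_trans[OF Ord_elem[OF wO that(3)] that(5,4)])
  obtain s where s: "dfun s" "\<And>n. n \<epsilon> w \<Longrightarrow> s n = G n (lam (collect w (\<lambda>y. y \<epsilon> n)) s)"
    by (rule wf_recursion[OF wM dE wf_epsilon trE dG], assumption+, rule that)
  have s0: "s zer = i0" using s(2)[OF w(3)] by (simp add: G_def)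
  have ss: "s (suc m) = nx (s m)" if m: "m \<epsilon> w" for m
  proof -
    have mO: "Ord m" by (rule Ord_elem[OF wO m])
    then have mM: "m \<in> M" by simp
    have "dpred (\<lambda>y. y \<epsilon> suc m)" by (intro dfn in_M)
    note mc = mem_collect[OF this wM]
    have "suc m \<noteq> zer" using mem_suc[OF mM, of m] zer by metis
    then have "s (suc m) = nx (ap (lam (collect w (\<lambda>y. y \<epsilon> suc m)) s) m)"
      using s(2)[OF w(4)[OF m]] pd[OF mO] by (simp add: G_def)
    also have "ap (lam (collect w (\<lambda>y. y \<epsilon> suc m)) s) m = s m"
      by (rule ap_lam[OF s(1) in_M(1)]) (use mc m mM in simp)
    finally show ?thesis .
  qed
  have Ns: "N (s n)" if n: "n \<epsilon> w" for n
  proof -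
    have "n \<epsilon> w \<longrightarrow> N (s n)"
    proof (rule Ord_induct[where P = "\<lambda>n. n \<epsilon> w \<longrightarrow> N (s n)"])
      show "dpred (\<lambda>n. n \<epsilon> w \<longrightarrow> N (s n))" by (intro dfn wM D_comp1[OF N(1)] s(1))
      show "Ord n" by (rule Ord_elem[OF wO n])
      fix n assume IH: "\<And>m. m \<epsilon> n \<Longrightarrow> m \<epsilon> w \<longrightarrow> N (s m)"
      show "n \<epsilon> w \<longrightarrow> N (s n)"
      proof
        assume n: "n \<epsilon> w"
        show "N (s n)"
        proof (cases "n = zer")
          case True
          then show ?thesis using s0 N(3) by simp
        next
          case False
          obtain m where m: "m \<epsilon> n" "m \<epsilon> w" "n = suc m" by (rule omega_cases[OF wM w(2) n False])
          then have "N (s m)" using IH by blast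
          then show ?thesis using nx ss[OF m(2)] m(3) unfolding S_def by simp
        qed
      qed
    qed
    then show ?thesis using n by blast
  qed
  have "ev H (\<lambda>a. \<forall>n. n \<epsilon> w \<longrightarrow> g (s (suc n)) a \<epsilon> g (s n) a)"
  proof (rule ev_all[OF H _ w(1)])
    show "dpred2 (\<lambda>n a. g (s (suc n)) a \<epsilon> g (s n) a)" by (intro dfn Dt_comp2[OF g(1)] Dt_comp1[OF s(1)])
    fix n assume "n \<epsilon> w"
    then show "ev H (\<lambda>a. g (s (suc n)) a \<epsilon> g (s n) a)" using nx[OF Ns] ss unfolding S_def by simp
  qed
  from ev_ex[OF H this] obtain a where a: "a \<epsilon> H" "\<And>n. n \<epsilon> w \<Longrightarrow> g (s (suc n)) a \<epsilon> g (s n) a" by blast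
  have ak: "a \<epsilon> k" by (rule unbD(2)[OF H a(1)])
  have dg: "dfun (\<lambda>n. g (s n) a)" by (intro Dt_comp2[OF g(1)] s dfn k_in[OF ak])
  have "Ord (g (s n) a)" if "n \<epsilon> w" for n using g(2)[OF N(2)[OF Ns[OF that]] ak] by simp
  from min_on[OF wM w(3) dg this] obtain m where m: "m \<epsilon> w" "\<And>y. y \<epsilon> w \<Longrightarrow> \<not> g (s y) a \<epsilon> g (s m) a" by blast
  show False using m(2)[OF w(4)[OF m(1)]] a(2)[OF m(1)] by blast
qed

text \<open>
  An enumeration \<open>g\<close> of a family that contains the identity and is closed under composition with all
  \<open>h \<xi>\<close>, so that a minimal nonconstant member exists.
\<close>

lemma composition_family:
  assumes h: "dfun2 h" "\<And>\<xi> a. \<xi> \<epsilon> k \<Longrightarrow> a \<epsilon> k \<Longrightarrow> h \<xi> a \<epsilon> k"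
    and p: "dfun2 p" "\<And>a b. a \<epsilon> k \<Longrightarrow> b \<epsilon> k \<Longrightarrow> p a b \<epsilon> k" "\<And>a b. a \<epsilon> k \<Longrightarrow> b \<epsilon> k \<Longrightarrow> b \<epsilon> p a b"
      "\<And>a b a' b'. a \<epsilon> k \<Longrightarrow> b \<epsilon> k \<Longrightarrow> a' \<epsilon> k \<Longrightarrow> b' \<epsilon> k \<Longrightarrow> p a b = p a' b' \<Longrightarrow> a = a' \<and> b = b'"
  obtains g where "dfun2 g" "\<And>i a. i \<epsilon> k \<Longrightarrow> a \<epsilon> k \<Longrightarrow> g i a \<epsilon> k" "\<And>a. a \<epsilon> k \<Longrightarrow> g zer a = a"
    "\<And>\<xi> i a. \<xi> \<epsilon> k \<Longrightarrow> i \<epsilon> k \<Longrightarrow> a \<epsilon> k \<Longrightarrow> g (p \<xi> i) a = h \<xi> (g i a)"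
proof -
  note p' = Dt_comp2[OF p(1)]
  define dec where "dec i \<longleftrightarrow> (\<exists>\<xi>. \<xi> \<epsilon> k \<and> (\<exists>j. j \<epsilon> k \<and> i = p \<xi> j))" for i
  define d1 where "d1 i = tht (\<lambda>\<xi>. \<xi> \<epsilon> k \<and> (\<exists>j. j \<epsilon> k \<and> i = p \<xi> j))" for i
  define d2 where "d2 i = tht (\<lambda>j. j \<epsilon> k \<and> (\<exists>\<xi>. \<xi> \<epsilon> k \<and> i = p \<xi> j))" for i
  have ddec: "dpred dec" unfolding dec_def by (intro dfn p' kM)
  have dd1: "dfun d1" unfolding d1_def by (intro dfn p' kM)
  have dd2: "dfun d2" unfolding d2_def by (intro dfn p' kM)
  have d1: "d1 (p \<xi> j) = \<xi>" if "\<xi> \<epsilon> k" "j \<epsilon> k" for \<xi> j unfolding d1_def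
    by (rule tht_eq) (use that p(4)[OF that] in auto)
  have d2: "d2 (p \<xi> j) = j" if "\<xi> \<epsilon> k" "j \<epsilon> k" for \<xi> j unfolding d2_def
    by (rule tht_eq) (use that p(4)[OF that] in auto)
  \<comment> \<open>At the code of a pair \<xi>, j the function is \<open>h \<xi>\<close> after the
    one with index \<open>j\<close>, which is available since \<open>j\<close> lies below the code.
    All indices that are not codes, \<open>zer\<close> among them, give the identity.\<close>
  define G where "G i f = (if dec i then lam k (\<lambda>a. h (d1 i) (ap (ap f (d2 i)) a)) else lam k (\<lambda>a. a))" for i f
  have dG: "dfun2 G" unfolding G_def
    by (intro dfn D_comp1[OF ddec] Dt_comp1[OF dd1] Dt_comp1[OF dd2] Dt_comp2[OF h(1)] kM)
  have dE: "dpred2 (\<lambda>x y. x \<epsilon> y)" by (intro dfn)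
  have trE: "x \<epsilon> z" if "x \<epsilon> k" "y \<epsilon> k" "z \<epsilon> k" "x \<epsilon> y" "y \<epsilon> z" for x y z
    by (rule Ord_trans[OF k_Ord[OF that(3)] that(5,4)])
  obtain F where F: "dfun F" "\<And>i. i \<epsilon> k \<Longrightarrow> F i = G i (lam (collect k (\<lambda>y. y \<epsilon> i)) F)"
    by (rule wf_recursion[OF kM dE wf_epsilon trE dG], assumption+, rule that)
  define g where "g i a = ap (F i) a" for i a
  have dg: "dfun2 g" unfolding g_def by (intro dfn Dt_comp1[OF F(1)])
  have step: "g (p \<xi> j) a = h \<xi> (g j a)" if \<xi>: "\<xi> \<epsilon> k" and j: "j \<epsilon> k" and a: "a \<epsilon> k" for \<xi> j a
  proof -
    let ?s = "collect k (\<lambda>y. y \<epsilon> p \<xi> j)"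
    have pk: "p \<xi> j \<epsilon> k" by (rule p(2)[OF \<xi> j])
    have "dpred (\<lambda>y. y \<epsilon> p \<xi> j)" by (intro dfn k_in[OF pk])
    note mc = mem_collect[OF this kM]
    have "ap (lam ?s F) j = F j" by (rule ap_lam[OF F(1) in_M(1)]) (use mc j p(3)[OF \<xi> j] in blast)
    moreover have "dec (p \<xi> j)" unfolding dec_def using \<xi> j by blast
    ultimately have "F (p \<xi> j) = lam k (\<lambda>a. h \<xi> (ap (F j) a))"
      using F(2)[OF pk] d1[OF \<xi> j] d2[OF \<xi> j] by (simp add: G_def)
    moreover have "dfun (\<lambda>a. h \<xi> (ap (F j) a))"
      by (intro dfn Dt_comp2[OF h(1)] k_in[OF \<xi>] dfun_in[OF F(1) k_in[OF j]])
    ultimately show ?thesis unfolding g_def using ap_lam[OF _ kM a] by simp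
  qed
  have nodec: "g i a = a" if i: "i \<epsilon> k" "\<not> dec i" and a: "a \<epsilon> k" for i a
  proof -
    have "F i = lam k (\<lambda>a. a)" using F(2)[OF i(1)] i(2) by (simp add: G_def)
    moreover have "dfun (\<lambda>a. a)" by (intro dfn)
    ultimately show ?thesis unfolding g_def using ap_lam[OF _ kM a] by simp
  qed
  have "\<not> dec zer" unfolding dec_def using p(3) zer(2) by metis
  then have g0: "g zer a = a" if "a \<epsilon> k" for a using nodec[OF k(2) _ that] by blast
  have gk: "g i a \<epsilon> k" if i: "i \<epsilon> k" and a: "a \<epsilon> k" for i a
  proof -
    have "i \<epsilon> k \<longrightarrow> g i a \<epsilon> k"
    proof (rule Ord_induct[where P = "\<lambda>i. i \<epsilon> k \<longrightarrow> g i a \<epsilon> k"])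
      show "dpred (\<lambda>i. i \<epsilon> k \<longrightarrow> g i a \<epsilon> k)" by (intro dfn kM Dt_comp2[OF dg] k_in[OF a])
      show "Ord i" using i by simp
      fix i assume IH: "\<And>j. j \<epsilon> i \<Longrightarrow> j \<epsilon> k \<longrightarrow> g j a \<epsilon> k"
      show "i \<epsilon> k \<longrightarrow> g i a \<epsilon> k"
      proof
        assume i: "i \<epsilon> k"
        show "g i a \<epsilon> k"
        proof (cases "dec i")
          case True
          then obtain \<xi> j where x: "\<xi> \<epsilon> k" "j \<epsilon> k" "i = p \<xi> j" unfolding dec_def by blast
          then have "g j a \<epsilon> k" using IH p(3) by blast
          then show ?thesis using step[OF x(1,2) a] h(2)[OF x(1)] x(3) by simp
        next
          case False
          then show ?thesis using nodec[OF i False a] a by simp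
        qed
      qed
    qed
    then show ?thesis using i by blast
  qed
  from dg gk g0 step show thesis by (rule that)
qed

text \<open>\<open>g\<close> is minimal, modulo end segments of \<open>H\<close>, among the members
  of the composition family that exceed all constants. Composing with \<open>h \<xi>\<close> stays
  in the family, so a composite that falls below \<open>g\<close> no longer exceeds all constants,
  and it is then constant because \<open>H\<close> decides its equality with each constant.\<close>

lemma normal_function:
  assumes h: "dfun2 h" "\<And>\<xi> a. \<xi> \<epsilon> k \<Longrightarrow> a \<epsilon> k \<Longrightarrow> h \<xi> a \<epsilon> k"
  obtains H g where "unb H" "dfun g" "\<And>a. a \<epsilon> k \<Longrightarrow> g a \<epsilon> k" "\<And>b. b \<epsilon> k \<Longrightarrow> ev H (\<lambda>a. b \<epsilon> g a)"
    "\<And>\<xi>. \<xi> \<epsilon> k \<Longrightarrow> ev H (\<lambda>a. \<not> h \<xi> (g a) \<epsilon> g a) \<or> (\<exists>b. b \<epsilon> k \<and> ev H (\<lambda>a. h \<xi> (g a) = b))"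
proof -
  obtain p where p: "dfun2 p" "\<And>a b. a \<epsilon> k \<Longrightarrow> b \<epsilon> k \<Longrightarrow> p a b \<epsilon> k" "\<And>a b. a \<epsilon> k \<Longrightarrow> b \<epsilon> k \<Longrightarrow> b \<epsilon> p a b"
      "\<And>a b a' b'. a \<epsilon> k \<Longrightarrow> b \<epsilon> k \<Longrightarrow> a' \<epsilon> k \<Longrightarrow> b' \<epsilon> k \<Longrightarrow> p a b = p a' b' \<Longrightarrow> a = a' \<and> b = b'"
    by (rule pairing_injection, rule that)
  obtain g where g: "dfun2 g" "\<And>i a. i \<epsilon> k \<Longrightarrow> a \<epsilon> k \<Longrightarrow> g i a \<epsilon> k" "\<And>a. a \<epsilon> k \<Longrightarrow> g zer a = a"
    "\<And>\<xi> i a. \<xi> \<epsilon> k \<Longrightarrow> i \<epsilon> k \<Longrightarrow> a \<epsilon> k \<Longrightarrow> g (p \<xi> i) a = h \<xi> (g i a)"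
    by (rule composition_family[OF h p], assumption+, rule that)
  \<comment> \<open>Two kinds of statements have to be decided by the same \<open>H\<close>, namely
    \<open>g i a \<epsilon> g j a\<close> and \<open>g i a = j\<close>. The selector
    \<open>c\<close> and the pairing put both into one sequence.\<close>
  define B where "B c i j a \<longleftrightarrow> (c = zer \<and> g i a \<epsilon> g j a) \<or> (c \<noteq> zer \<and> g i a = j)" for c i j a
  define A where "A n a \<longleftrightarrow> (\<exists>c. c \<epsilon> k \<and> (\<exists>i. i \<epsilon> k \<and> (\<exists>j. j \<epsilon> k \<and> n = p c (p i j) \<and> B c i j a)))" for n a
  have dA: "dpred2 A" unfolding A_def B_def
    by (intro dfn Dt_comp2[OF p(1)] Dt_comp2[OF g(1)] kM zer)
  have A: "A (p c (p i j)) a \<longleftrightarrow> B c i j a" if "c \<epsilon> k" "i \<epsilon> k" "j \<epsilon> k" for c i j a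
  proof
    assume "A (p c (p i j)) a"
    then obtain c' i' j' where *: "c' \<epsilon> k" "i' \<epsilon> k" "j' \<epsilon> k" "p c (p i j) = p c' (p i' j')" "B c' i' j' a"
      unfolding A_def by blast
    then have "c = c'" "p i j = p i' j'" using p(4)[OF that(1) p(2)[OF that(2,3)]] p(2) by blast+
    moreover from this have "i = i' \<and> j = j'" using p(4) that * by blast
    ultimately show "B c i j a" using * by blast
  qed (use that in \<open>unfold A_def, blast\<close>)
  obtain H where H: "unb H" "\<And>i. i \<epsilon> k \<Longrightarrow> ev H (A i) \<or> ev H (\<lambda>a. \<not> A i a)"
    by (rule eventually_decided[OF dA], rule that)
  have HM: "H \<in> M" by (rule unbD(1)[OF H(1)])
  have dec: "ev H (\<lambda>a. B c i j a) \<or> ev H (\<lambda>a. \<not> B c i j a)" if "c \<epsilon> k" "i \<epsilon> k" "j \<epsilon> k" for c i j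
    using H(2)[OF p(2)[OF that(1) p(2)[OF that(2,3)]]] unfolding A[OF that] .
  have dec1: "ev H (\<lambda>a. g i a \<epsilon> g j a) \<or> ev H (\<lambda>a. \<not> g i a \<epsilon> g j a)" if "i \<epsilon> k" "j \<epsilon> k" for i j
    using dec[OF k(2) that] unfolding B_def by simp
  have "suc zer \<noteq> zer" using mem_suc[of zer zer] zer by metis
  then have dec2: "ev H (\<lambda>a. g i a = j) \<or> ev H (\<lambda>a. g i a \<noteq> j)" if "i \<epsilon> k" "j \<epsilon> k" for i j
    using dec[OF k(3)[OF k(2)] that] unfolding B_def by simp
  define N where "N i \<longleftrightarrow> i \<epsilon> k \<and> (\<forall>b. b \<epsilon> k \<longrightarrow> ev H (\<lambda>a. b \<epsilon> g i a))" for i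
  have dN: "dpred N" unfolding N_def by (intro dfn kM HM Dt_comp2[OF g(1)])
  have dich: "N i \<or> (\<exists>b. b \<epsilon> k \<and> ev H (\<lambda>a. g i a = b))" if i: "i \<epsilon> k" for i
  proof (rule ccontr)
    assume n: "\<not> ?thesis"
    \<comment> \<open>A function that eventually takes no fixed value eventually avoids each one;
      completeness applied to all values up to \<open>b\<close> puts it above
      \<open>b\<close>.\<close>
    have "ev H (\<lambda>a. b \<epsilon> g i a)" if b: "b \<epsilon> k" for b
    proof -
      have "ev H (\<lambda>a. \<forall>j. j \<epsilon> suc b \<longrightarrow> g i a \<noteq> j)"
      proof (rule ev_all[OF H(1) _ k(3)[OF b]])
        show "dpred2 (\<lambda>j a. g i a \<noteq> j)" by (intro dfn Dt_comp2[OF g(1)] k_in[OF i])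
        fix j assume "j \<epsilon> suc b"
        then have "j \<epsilon> k" by (rule k_down[OF k(3)[OF b]])
        then show "ev H (\<lambda>a. g i a \<noteq> j)" using dec2[OF i] n by blast
      qed
      then show ?thesis
      proof (rule ev_mono)
        fix a assume a: "a \<epsilon> H" "\<forall>j. j \<epsilon> suc b \<longrightarrow> g i a \<noteq> j"
        have "Ord (g i a)" using g(2)[OF i unbD(2)[OF H(1) a(1)]] by simp
        then show "b \<epsilon> g i a" using Ord_linear[OF k_Ord[OF b], of "g i a"] a(2) k_in[OF b] by auto
      qed
    qed
    with n i show False unfolding N_def by blast
  qed
  have N0: "N zer" unfolding N_def
  proof (intro conjI allI impI)
    fix b assume "b \<epsilon> k"
    then show "ev H (\<lambda>a. b \<epsilon> g zer a)" by (rule ev_mono[OF ev_gt]) (use g(3) unbD(2)[OF H(1)] in simp)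
  qed (rule k)
  obtain w where w: "w \<epsilon> k" "is_omega w" "zer \<epsilon> w" "\<And>x. x \<epsilon> w \<Longrightarrow> suc x \<epsilon> w" by (rule wc_omega, rule that)
  have Nk: "i \<epsilon> k" if "N i" for i using that unfolding N_def by blast
  obtain i where i: "N i" "\<And>j. N j \<Longrightarrow> \<not> ev H (\<lambda>a. g j a \<epsilon> g i a)"
    by (rule eventually_minimal[OF w H(1) g(1,2) dN Nk N0], assumption+, rule that)
  have ik: "i \<epsilon> k" by (rule Nk[OF i(1)])
  show thesis
  proof (rule that[OF H(1), of "g i"])
    show "dfun (g i)" by (intro Dt_comp2[OF g(1)] dfn k_in[OF ik])
    show "g i a \<epsilon> k" if "a \<epsilon> k" for a by (rule g(2)[OF ik that])
    show "ev H (\<lambda>a. b \<epsilon> g i a)" if "b \<epsilon> k" for b using i(1) that unfolding N_def by blast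
    fix \<xi> assume \<xi>: "\<xi> \<epsilon> k"
    let ?j = "p \<xi> i"
    have j: "?j \<epsilon> k" by (rule p(2)[OF \<xi> ik])
    have e: "g ?j a = h \<xi> (g i a)" if "a \<epsilon> H" for a using g(4)[OF \<xi> ik] unbD(2)[OF H(1) that] by blast
    from dec1[OF j ik] show "ev H (\<lambda>a. \<not> h \<xi> (g i a) \<epsilon> g i a) \<or> (\<exists>b. b \<epsilon> k \<and> ev H (\<lambda>a. h \<xi> (g i a) = b))"
    proof
      assume "ev H (\<lambda>a. g ?j a \<epsilon> g i a)"
      \<comment> \<open>Minimality of \<open>i\<close> is used here: the composite is below
        \<open>g i\<close>, so it belongs to the eventually constant side of the dichotomy.\<close>
      then have "\<not> N ?j" using i(2) by blast
      then obtain b where b: "b \<epsilon> k" "ev H (\<lambda>a. g ?j a = b)" using dich[OF j] by blast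
      from b(2) have "ev H (\<lambda>a. h \<xi> (g i a) = b)" by (rule ev_mono) (simp add: e)
      with b(1) show ?thesis by blast
    next
      assume "ev H (\<lambda>a. \<not> g ?j a \<epsilon> g i a)"
      then have "ev H (\<lambda>a. \<not> h \<xi> (g i a) \<epsilon> g i a)" by (rule ev_mono) (simp add: e)
      then show ?thesis ..
    qed
  qed
qed

end

section \<open>Least witnesses, and descriptions suited to absoluteness\<close>

context zf
begin

text \<open>Without a witness the value is \<open>t\<close>, which is not a member of itself; so
  membership of the value in \<open>t\<close> records whether a witness exists.\<close>

definition least_in :: "'a \<Rightarrow> ('a \<Rightarrow> bool) \<Rightarrow> 'a" where
  "least_in t P = (if \<exists>b. b \<epsilon> t \<and> P b then tht (\<lambda>b. b \<epsilon> t \<and> P b \<and> (\<forall>c. c \<epsilon> b \<longrightarrow> \<not> P c)) else t)"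

lemma Dt_least_in [dfn]:
  assumes "Dt A" "D (\<lambda>v. P (v 0) (\<lambda>n. v (Suc n)))"
  shows "Dt (\<lambda>v. least_in (A v) (\<lambda>x. P x v))"
  unfolding least_in_def by (intro dfn Dt_shift assms D_lift[OF assms(2)])

lemma least_in:
  assumes t: "Ord t" and P: "dpred P" and b: "b \<epsilon> t" "P b"
  shows "least_in t P \<epsilon> t" "P (least_in t P)"
proof -
  have d: "dpred (\<lambda>b. b \<epsilon> t \<and> P b)" by (intro dfn P Ord_in t)
  from Ord_min[of "\<lambda>b. b \<epsilon> t \<and> P b", OF d Ord_elem[OF t b(1)]] b obtain m where
    m: "m \<epsilon> t" "P m" "\<forall>c. c \<epsilon> m \<longrightarrow> \<not> (c \<epsilon> t \<and> P c)" by blast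
  have m3: "\<not> P c" if "c \<epsilon> m" for c using m(3) that Ord_trans[OF t m(1) that] by blast
  have "tht (\<lambda>b. b \<epsilon> t \<and> P b \<and> (\<forall>c. c \<epsilon> b \<longrightarrow> \<not> P c)) = m"
  proof (rule tht_eq)
    fix y assume y: "y \<epsilon> t \<and> P y \<and> (\<forall>c. c \<epsilon> y \<longrightarrow> \<not> P c)"
    then show "y = m" using Ord_linear[OF Ord_elem[OF t] Ord_elem[OF t m(1)], of y] m(2) m3 by blast
  qed (use m m3 Ord_elem[OF t m(1)] in auto)
  then have "least_in t P = m" unfolding least_in_def using b by auto
  with m show "least_in t P \<epsilon> t" "P (least_in t P)" by simp_all
qed

text \<open>Least preimages provide a definable right inverse of \<open>e\<close> on the image of
  \<open>t\<close>.\<close>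

lemma least_preimage:
  assumes t: "Ord t" and e: "dfun e"
  obtains P where "dfun P" "\<And>i. i \<epsilon> t \<Longrightarrow> P (e i) \<epsilon> t" "\<And>i. i \<epsilon> t \<Longrightarrow> e (P (e i)) = e i"
proof -
  define P where "P y = least_in t (\<lambda>i. e i = y)" for y
  have "dfun P" unfolding P_def by (intro dfn Dt_comp1[OF e] Ord_in t)
  moreover have "P (e i) \<epsilon> t \<and> e (P (e i)) = e i" if i: "i \<epsilon> t" for i
  proof -
    have eM: "e i \<in> M" using dfun_in[OF e] Ord_elem[OF t i] by simp
    have d: "dpred (\<lambda>j. e j = e i)" by (intro dfn Dt_comp1[OF e] eM)
    show ?thesis unfolding P_def using least_in[of t "\<lambda>j. e j = e i", OF t d i] by simp
  qed
  ultimately show thesis using that by blast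
qed

lemma size_less_surj:
  assumes "A \<in> M" and d: "Ord d" "t \<epsilon> d" and e: "dfun e" and sur: "\<And>x. x \<epsilon> A \<Longrightarrow> \<exists>i. i \<epsilon> t \<and> x = e i"
  shows "size_less A d"
proof -
  obtain P where P: "dfun P" "\<And>i. i \<epsilon> t \<Longrightarrow> P (e i) \<epsilon> t" "\<And>i. i \<epsilon> t \<Longrightarrow> e (P (e i)) = e i"
    by (rule least_preimage[OF Ord_elem[OF d] e], rule that)
  show ?thesis
  proof (rule size_lessI[OF assms(1) d P(1)])
    show "inj_on P (el A)"
    proof (rule inj_onI)
      fix x y assume x: "x \<in> el A" and y: "y \<in> el A" and eq: "P x = P y"
      obtain i where i: "i \<epsilon> t" "x = e i" using sur x by auto
      obtain j where j: "j \<epsilon> t" "y = e j" using sur y by auto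
      have "e (P x) = x" "e (P y) = y" unfolding i(2) j(2) by (rule P(3)[OF i(1)], rule P(3)[OF j(1)])
      with eq show "x = y" by metis
    qed
    fix x assume "x \<epsilon> A"
    then obtain i where "i \<epsilon> t" "x = e i" using sur by blast
    then show "P x \<epsilon> t" using P(2) by simp
  qed
qed

abbreviation dpred3 :: "('a \<Rightarrow> 'a \<Rightarrow> 'a \<Rightarrow> bool) \<Rightarrow> bool" where
  "dpred3 R \<equiv> D (\<lambda>v. R (v 0) (v (Suc 0)) (v (Suc (Suc 0))))"

text \<open>A form with quantifiers bounded by sets, for comparing the two models.\<close>

lemma is_limit_iff:
  assumes x: "x \<in> M"
  shows "is_limit x \<longleftrightarrow> Ord x \<and> (\<exists>y. y \<epsilon> x) \<and>
    (\<forall>y. y \<epsilon> x \<longrightarrow> (\<exists>s. s \<epsilon> x \<and> (\<forall>z. z \<epsilon> s \<longleftrightarrow> z \<epsilon> y \<or> z = y)))"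
proof -
  have s: "is_succ s y \<longleftrightarrow> (\<forall>z. z \<epsilon> s \<longleftrightarrow> z \<epsilon> y \<or> z = y)" if "y \<epsilon> x" "s \<epsilon> x" for y s
    unfolding is_succ_def using trans[OF x that(1)] trans[OF x that(2)] trans[OF trans[OF x that(1)]]
      trans[OF trans[OF x that(2)]] by blast
  have "(\<exists>s\<in>M. is_succ s y \<and> s \<epsilon> x) \<longleftrightarrow> (\<exists>s. s \<epsilon> x \<and> (\<forall>z. z \<epsilon> s \<longleftrightarrow> z \<epsilon> y \<or> z = y))" if "y \<epsilon> x" for y
    using s[OF that] trans[OF x] by blast
  moreover have "\<not> is_empty x \<longleftrightarrow> (\<exists>y. y \<epsilon> x)" unfolding is_empty_def using trans[OF x] by blast
  ultimately show ?thesis unfolding is_limit_def Ord_def using x trans[OF x] by auto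
qed

text \<open>The codes used later store an ordinal as the domain of a function; this is what allows
  it to be read off again.\<close>

lemma is_fun_dom_unique:
  assumes f: "f \<in> M" and A: "A \<in> M" "A' \<in> M" and B: "B \<in> M" "B' \<in> M"
    and "is_fun f A B" "is_fun f A' B'"
  shows "A = A'"
proof (rule set_ext[OF A])
  have *: "x \<epsilon> A'" if "is_fun f A B" "is_fun f A' B'" "A \<in> M" "A' \<in> M" "B \<in> M" "B' \<in> M" "x \<epsilon> A" for x A A' B B'
    using is_fun_dom(1)[OF that(2) f trans[OF that(3,7)] in_M(8)[of f x] is_fun_app(1)[OF that(1) f that(3,7)] that(4,6)] .
  show "x \<epsilon> A \<longleftrightarrow> x \<epsilon> A'" for x using *[OF assms(6,7) A B] *[OF assms(7,6) A(2,1) B(2,1)] by blast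
qed

end

context wc
begin

text \<open>
  A ternary relation is read as the family of partial regressive functions \<open>a \<mapsto> b\<close> given by \<open>q \<xi> a b\<close>.
\<close>

definition normal_for :: "('a \<Rightarrow> 'a \<Rightarrow> 'a \<Rightarrow> bool) \<Rightarrow> 'a \<Rightarrow> ('a \<Rightarrow> 'a) \<Rightarrow> bool" where
  "normal_for q H g \<longleftrightarrow> unb H \<and> dfun g \<and> (\<forall>a. a \<epsilon> k \<longrightarrow> g a \<epsilon> k) \<and>
    (\<forall>b. b \<epsilon> k \<longrightarrow> ev H (\<lambda>a. b \<epsilon> g a)) \<and>
    (\<forall>\<xi>. \<xi> \<epsilon> k \<longrightarrow> ev H (\<lambda>a. \<forall>b. b \<epsilon> g a \<longrightarrow> \<not> q \<xi> (g a) b) \<or>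
      (\<exists>b. b \<epsilon> k \<and> ev H (\<lambda>a. b \<epsilon> g a \<and> q \<xi> (g a) b)))"

lemma normal_forD:
  assumes "normal_for q H g"
  shows "unb H" "dfun g" "\<And>a. a \<epsilon> k \<Longrightarrow> g a \<epsilon> k" "\<And>b. b \<epsilon> k \<Longrightarrow> ev H (\<lambda>a. b \<epsilon> g a)"
    "\<And>\<xi>. \<xi> \<epsilon> k \<Longrightarrow> ev H (\<lambda>a. \<forall>b. b \<epsilon> g a \<longrightarrow> \<not> q \<xi> (g a) b) \<or> (\<exists>b. b \<epsilon> k \<and> ev H (\<lambda>a. b \<epsilon> g a \<and> q \<xi> (g a) b))"
  using assms unfolding normal_for_def by blast+

text \<open>Both families must share one \<open>H\<close> and one \<open>g\<close>, so they are
  merged, the first component of the index \<open>p c \<xi>\<close> selecting the family. The least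
  witness below \<open>a\<close>, or \<open>a\<close> itself if there is none, turns each relation
  into a function to which \<open>normal_function\<close> applies.\<close>

lemma normal_families:
  assumes r: "dpred3 r" and q: "dpred3 q"
  obtains H g where "normal_for r H g" "normal_for q H g"
proof -
  obtain p where p: "dfun2 p" "\<And>a b. a \<epsilon> k \<Longrightarrow> b \<epsilon> k \<Longrightarrow> p a b \<epsilon> k" "\<And>a b. a \<epsilon> k \<Longrightarrow> b \<epsilon> k \<Longrightarrow> b \<epsilon> p a b"
      "\<And>a b a' b'. a \<epsilon> k \<Longrightarrow> b \<epsilon> k \<Longrightarrow> a' \<epsilon> k \<Longrightarrow> b' \<epsilon> k \<Longrightarrow> p a b = p a' b' \<Longrightarrow> a = a' \<and> b = b'"
    by (rule pairing_injection, rule that)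
  note p' = Dt_comp2[OF p(1)]
  define R where "R n a b \<longleftrightarrow> (\<exists>c. c \<epsilon> k \<and> (\<exists>\<xi>. \<xi> \<epsilon> k \<and> n = p c \<xi> \<and> ((c = zer \<and> r \<xi> a b) \<or> (c \<noteq> zer \<and> q \<xi> a b))))" for n a b
  have dR: "dpred3 R" unfolding R_def by (intro dfn p' kM zer D_comp3[OF r] D_comp3[OF q])
  have R: "R (p c \<xi>) a b \<longleftrightarrow> ((c = zer \<and> r \<xi> a b) \<or> (c \<noteq> zer \<and> q \<xi> a b))" if "c \<epsilon> k" "\<xi> \<epsilon> k" for c \<xi> a b
    unfolding R_def using that p(4)[OF that] by blast
  define h where "h n a = least_in a (R n a)" for n a
  have dh: "dfun2 h" unfolding h_def by (intro dfn D_comp3[OF dR])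
  have dRna: "dpred (R n a)" if "n \<epsilon> k" "a \<epsilon> k" for n a by (intro D_comp3[OF dR] dfn k_in that)
  have h: "h n a \<epsilon> a \<and> R n a (h n a)" if "n \<epsilon> k" "a \<epsilon> k" "b \<epsilon> a" "R n a b" for n a b
    unfolding h_def using least_in[OF k_Ord[OF that(2)] dRna[OF that(1,2)] that(3,4)] by blast
  have h': "h n a = a" if "\<not> (\<exists>b. b \<epsilon> a \<and> R n a b)" for n a unfolding h_def least_in_def if_not_P[OF that] ..
  have hk: "h n a \<epsilon> k" if "n \<epsilon> k" "a \<epsilon> k" for n a
    using h[OF that] h'[of a n] k_down[OF that(2)] that by metis
  obtain H g where H: "unb H" "dfun g" "\<And>a. a \<epsilon> k \<Longrightarrow> g a \<epsilon> k" "\<And>b. b \<epsilon> k \<Longrightarrow> ev H (\<lambda>a. b \<epsilon> g a)"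
    "\<And>\<xi>. \<xi> \<epsilon> k \<Longrightarrow> ev H (\<lambda>a. \<not> h \<xi> (g a) \<epsilon> g a) \<or> (\<exists>b. b \<epsilon> k \<and> ev H (\<lambda>a. h \<xi> (g a) = b))"
    by (rule normal_function[OF dh hk], assumption+, rule that)
  have Hk: "g a \<epsilon> k" if "a \<epsilon> H" for a using H(3) unbD(2)[OF H(1) that] by blast
  have main: "ev H (\<lambda>a. \<forall>b. b \<epsilon> g a \<longrightarrow> \<not> R n (g a) b) \<or> (\<exists>b. b \<epsilon> k \<and> ev H (\<lambda>a. b \<epsilon> g a \<and> R n (g a) b))" if n: "n \<epsilon> k" for n
    using H(5)[OF n]
  proof
    assume "ev H (\<lambda>a. \<not> h n (g a) \<epsilon> g a)"
    then have "ev H (\<lambda>a. \<forall>b. b \<epsilon> g a \<longrightarrow> \<not> R n (g a) b)" by (rule ev_mono) (use h[OF n Hk] in blast)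
    then show ?thesis ..
  next
    assume "\<exists>b. b \<epsilon> k \<and> ev H (\<lambda>a. h n (g a) = b)"
    then obtain b where b: "b \<epsilon> k" "ev H (\<lambda>a. h n (g a) = b)" by blast
    have "ev H (\<lambda>a. b \<epsilon> g a \<and> R n (g a) b)"
    proof (rule ev_mono[OF ev_conj[OF H(1) b(2) H(4)[OF b(1)]]])
      fix a assume a: "a \<epsilon> H" "h n (g a) = b \<and> b \<epsilon> g a"
      have "\<exists>b. b \<epsilon> g a \<and> R n (g a) b"
      proof (rule ccontr)
        assume "\<not> ?thesis"
        then have "h n (g a) = g a" by (rule h')
        then show False using a mem_irrefl[OF k_in[OF b(1)]] by simp
      qed
      then show "b \<epsilon> g a \<and> R n (g a) b" using h[OF n Hk[OF a(1)]] a(2) by blast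
    qed
    with b(1) show ?thesis by blast
  qed
  have s: "suc zer \<noteq> zer" using mem_suc[of zer zer] zer by metis
  have "normal_for r H g" unfolding normal_for_def
  proof (intro conjI allI impI)
    fix \<xi> assume \<xi>: "\<xi> \<epsilon> k"
    show "ev H (\<lambda>a. \<forall>b. b \<epsilon> g a \<longrightarrow> \<not> r \<xi> (g a) b) \<or> (\<exists>b. b \<epsilon> k \<and> ev H (\<lambda>a. b \<epsilon> g a \<and> r \<xi> (g a) b))"
      using main[OF p(2)[OF k(2) \<xi>]] unfolding R[OF k(2) \<xi>] by simp
  qed (use H in blast)+
  moreover have "normal_for q H g" unfolding normal_for_def
  proof (intro conjI allI impI)
    fix \<xi> assume \<xi>: "\<xi> \<epsilon> k"
    show "ev H (\<lambda>a. \<forall>b. b \<epsilon> g a \<longrightarrow> \<not> q \<xi> (g a) b) \<or> (\<exists>b. b \<epsilon> k \<and> ev H (\<lambda>a. b \<epsilon> g a \<and> q \<xi> (g a) b))"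
      using main[OF p(2)[OF k(3)[OF k(2)] \<xi>]] unfolding R[OF k(3)[OF k(2)] \<xi>] using s by simp
  qed (use H in blast)+
  ultimately show thesis by (rule that)
qed

end

section \<open>The ground model\<close>

locale ground = wc M E k + G: zf N E
  for M :: "'a set" and E (infix "\<epsilon>" 50) and k :: 'a and N :: "'a set" +
  assumes NM: "N \<subseteq> M" and kN: "k \<in> N"
begin

lemma NM' [simp]: "x \<in> N \<Longrightarrow> x \<in> M" using NM by blast

section \<open>Absoluteness between the ground model and the larger model\<close>

lemma abs_zer: "G.zer = zer" by (rule set_ext) simp_all

lemma abs_upair: "x \<in> N \<Longrightarrow> y \<in> N \<Longrightarrow> G.upair x y = upair x y"
  by (rule set_ext) (simp_all add: G.mem_upair)

lemma abs_opair: "x \<in> N \<Longrightarrow> y \<in> N \<Longrightarrow> G.opair x y = opair x y"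
  unfolding G.opair_def opair_def using abs_upair G.in_M(3) by metis

lemma abs_suc: "x \<in> N \<Longrightarrow> G.suc x = suc x"
  by (rule set_ext) (simp_all add: G.mem_suc)

lemma abs_Ord: "x \<in> N \<Longrightarrow> G.Ord x \<longleftrightarrow> Ord x"
  unfolding Ord_iff G.Ord_iff by simp

text \<open>Transitivity is followed from \<open>f\<close> through the pair down to its components.
  With it, application agrees in both models, default value included.\<close>

lemma abs_app_in: "f \<in> N \<Longrightarrow> x \<in> M \<Longrightarrow> y \<in> M \<Longrightarrow> app f x y \<Longrightarrow> x \<in> N \<and> y \<in> N"
proof -
  assume *: "f \<in> N" "x \<in> M" "y \<in> M" "app f x y"
  then have "opair x y \<epsilon> f" using app_iff by simp
  then have "opair x y \<in> N" by (rule G.trans[OF *(1)])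
  then have "upair x y \<in> N" unfolding opair_def by (rule G.trans) simp
  then show ?thesis using G.trans[OF \<open>upair x y \<in> N\<close>] * by simp
qed

lemma abs_app: "f \<in> N \<Longrightarrow> x \<in> N \<Longrightarrow> y \<in> N \<Longrightarrow> G.app f x y \<longleftrightarrow> app f x y"
  by (simp add: app_iff G.app_iff abs_opair)

lemma abs_ap: "f \<in> N \<Longrightarrow> x \<in> N \<Longrightarrow> G.ap f x = ap f x"
proof -
  assume *: "f \<in> N" "x \<in> N"
  have "(y \<in> N \<and> G.app f x y) \<longleftrightarrow> (y \<in> M \<and> app f x y)" for y
    using abs_app[OF *] abs_app_in[OF *(1), of x y] * by auto
  then show ?thesis unfolding G.ap_def ap_def G.tht_def tht_def abs_zer by simp
qed

lemma abs_is_fun: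
  assumes "f \<in> N" "A \<in> N" "B \<in> N" shows "G.is_fun f A B \<longleftrightarrow> is_fun f A B"
proof -
  have 1: "G.is_opair p x y \<longleftrightarrow> is_opair p x y" if "p \<epsilon> f" "x \<epsilon> A" "y \<epsilon> B" for p x y
  proof -
    have "p \<in> N" "x \<in> N" "y \<in> N" using that G.trans assms by blast+
    then show ?thesis by (simp add: G.is_opair_iff is_opair_iff abs_opair)
  qed
  have 2: "(\<forall>p\<in>N. p \<epsilon> f \<longrightarrow> (\<exists>x\<in>N. \<exists>y\<in>N. x \<epsilon> A \<and> y \<epsilon> B \<and> G.is_opair p x y)) \<longleftrightarrow>
     (\<forall>p\<in>M. p \<epsilon> f \<longrightarrow> (\<exists>x\<in>M. \<exists>y\<in>M. x \<epsilon> A \<and> y \<epsilon> B \<and> is_opair p x y))"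
    using 1 G.trans[OF assms(1)] G.trans[OF assms(2)] G.trans[OF assms(3)] NM' by meson
  have "(y \<in> N \<and> G.app f x y) \<longleftrightarrow> (y \<in> M \<and> app f x y)" if "x \<epsilon> A" for x y
    using abs_app[OF assms(1) G.trans[OF assms(2) that]] abs_app_in[OF assms(1), of x y] G.trans[OF assms(2) that] by auto
  then have 3: "(\<forall>x\<in>N. x \<epsilon> A \<longrightarrow> (\<exists>!y. y \<in> N \<and> G.app f x y)) \<longleftrightarrow> (\<forall>x\<in>M. x \<epsilon> A \<longrightarrow> (\<exists>!y. y \<in> M \<and> app f x y))"
    using G.trans[OF assms(2)] NM' by auto
  show ?thesis unfolding G.is_fun_def is_fun_def by (simp only: 2 3)
qed

lemma abs_repl:
  assumes "A \<in> N" "dfun F" "G.dfun F'" "\<And>x. x \<epsilon> A \<Longrightarrow> F' x = F x"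
  shows "G.repl A F' = repl A F"
  by (rule set_ext) (use assms in \<open>auto simp: mem_repl G.mem_repl\<close>)

lemma abs_lam:
  assumes "A \<in> N" "dfun F" "G.dfun F'" "\<And>x. x \<epsilon> A \<Longrightarrow> F' x = F x"
  shows "G.lam A F' = lam A F"
  unfolding G.lam_def lam_def
proof (rule abs_repl[OF assms(1)])
  show "dfun (\<lambda>x. opair x (F x))" by (intro dfn assms)
  show "G.dfun (\<lambda>x. G.opair x (F' x))" by (intro G.Dt_opair G.Dt_var' assms)
  fix x assume x: "x \<epsilon> A"
  then have "x \<in> N" by (rule G.trans[OF assms(1)])
  then show "G.opair x (F' x) = opair x (F x)"
    unfolding assms(4)[OF x, symmetric] by (intro abs_opair G.dfun_in[OF assms(3)])
qed

lemma abs_is_limit: "x \<in> N \<Longrightarrow> G.is_limit x \<longleftrightarrow> is_limit x"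
  by (simp add: is_limit_iff G.is_limit_iff abs_Ord)

lemma dap: "f \<in> N \<Longrightarrow> dfun (ap f)" by (intro dfn) simp
lemma abs_bij:
  assumes "f \<in> N" "A \<in> N" "bij_betw (G.ap f) (el A) B" shows "bij_betw (ap f) (el A) B"
  using assms(3) by (rule bij_betw_cong[THEN iffD1, rotated]) (use abs_ap assms(1) G.trans[OF assms(2)] in auto)

text \<open>A bijection of the ground model is one of the larger model, so \<open>k\<close> acquires
  no smaller equipotent ordinal; being \<omega> is absolute.\<close>

lemma uncountable_ground: "G.uncountable_card k"
proof -
  obtain w where w: "w \<epsilon> k" "is_omega w" by (rule wc_omega, rule that)
  have wN: "w \<in> N" by (rule G.trans[OF kN w(1)])
  have "G.is_omega w" using w(2) abs_is_limit[OF wN] abs_is_limit[OF G.trans[OF wN]]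
    unfolding is_omega_def G.is_omega_def by simp
  moreover have "G.is_card k" unfolding G.is_card_def
  proof (intro conjI ballI impI notI)
    show "G.is_ord k" using abs_Ord[OF kN] k(1) by (simp add: G.Ord_def)
    fix a assume a: "a \<in> N" "a \<epsilon> k" "G.equipotent a k"
    obtain f where f: "f \<in> N" "bij_betw (G.ap f) (el a) (el k)" by (rule G.equipotentE[OF a(3,1) kN], rule that)
    have "equipotent a k"
      by (rule equipotentI[OF dap[OF f(1)] _ _ abs_bij[OF f(1) a(1) f(2)]]) (use a kN in auto)
    then show False using wc_card a unfolding is_card_def by simp
  qed
  ultimately show ?thesis unfolding G.uncountable_card_def using w(1) wN by blast
qed

text \<open>A class function given by a formula over the ground model is restricted to
  \<open>b\<close>, which makes it a set. That set is a parameter in the larger model, where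
  \<open>bounded\<close> applies.\<close>

lemma ground_regular: "reg N E k"
proof (unfold_locales)
  show "G.Ord k" using abs_Ord[OF kN] k(1) by simp
  show "G.zer \<epsilon> k" using k(2) abs_zer by simp
  show "G.suc x \<epsilon> k" if "x \<epsilon> k" for x using k(3)[OF that] abs_suc[OF G.trans[OF kN that]] by simp
  fix F b assume F: "G.dfun F" and b: "b \<epsilon> k" and Fk: "\<And>x. x \<epsilon> b \<Longrightarrow> F x \<epsilon> k"
  have bN: "b \<in> N" by (rule G.trans[OF kN b])
  define f where "f = G.lam b F"
  have fN: "f \<in> N" by (simp add: f_def)
  have fx: "ap f x = F x" if "x \<epsilon> b" for x
    using G.ap_lam[OF F bN that] abs_ap[OF fN G.trans[OF bN that]] by (simp add: f_def)
  have "\<exists>g. g \<epsilon> k \<and> (\<forall>x. x \<epsilon> b \<longrightarrow> ap f x \<epsilon> g)"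
    by (rule bounded[OF dap[OF fN] b]) (simp add: fx Fk)
  then show "\<exists>g. g \<epsilon> k \<and> (\<forall>x. x \<epsilon> b \<longrightarrow> F x \<epsilon> g)" using fx by auto
qed

section \<open>Normal fine measures from functions tending to the cardinal\<close>

text \<open>Completeness comes from regularity through \<open>ev_all\<close>, fineness from
  \<open>g\<close> tending to \<open>k\<close> and \<open>e\<close> being onto \<open>A\<close>,
  normality from \<open>h1\<close>. The dichotomy \<open>h2\<close> serves twice, for the
  ultrafilter property and for \<open>U\<close> being in the ground model.\<close>

lemma measure_from_function:
  assumes \<delta>: "\<delta> \<epsilon> k" and approx: "approximation_property E \<delta> N M"
    and A: "A \<in> N" and S: "S \<in> N" "\<And>x. x \<epsilon> S \<longleftrightarrow> x \<in> N \<and> (\<forall>z. z \<epsilon> x \<longrightarrow> z \<epsilon> A) \<and> G.size_less x k"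
    and e: "dfun e" "\<And>a. a \<epsilon> A \<Longrightarrow> \<exists>b. b \<epsilon> k \<and> e b = a" "\<And>b. b \<epsilon> k \<Longrightarrow> e b \<epsilon> A"
    and H: "unb H" and g: "dfun g" "\<And>a. a \<epsilon> k \<Longrightarrow> g a \<epsilon> k" "\<And>b. b \<epsilon> k \<Longrightarrow> ev H (\<lambda>a. b \<epsilon> g a)"
    and small: "ev H (\<lambda>a. repl (g a) e \<epsilon> S)"
    and h1: "\<And>f. f \<in> N \<Longrightarrow> G.is_fun f S A \<Longrightarrow> ev H (\<lambda>a. ap f (repl (g a) e) \<epsilon> repl (g a) e) \<Longrightarrow>
      \<exists>b. b \<epsilon> A \<and> ev H (\<lambda>a. ap f (repl (g a) e) = b)"
    and h2: "\<And>X. X \<in> N \<Longrightarrow> (\<And>s. s \<epsilon> X \<Longrightarrow> s \<epsilon> S) \<Longrightarrow> ev H (\<lambda>a. repl (g a) e \<epsilon> X) \<or> ev H (\<lambda>a. \<not> repl (g a) e \<epsilon> X)"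
  shows "\<exists>U\<in>N. G.normal_fine_measure k A U"
proof -
  define s where "s a = repl (g a) e" for a
  have ds: "dfun s" unfolding s_def by (intro dfn Dt_comp1[OF g(1)] Dt_comp1[OF e(1)])
  note ds' = Dt_comp1[OF ds]
  note small = small[folded s_def] and h1 = h1[folded s_def] and h2 = h2[folded s_def]
  have HM: "H \<in> M" by (rule unbD(1)[OF H])
  have Hk: "g a \<epsilon> k" if "a \<epsilon> H" for a using g(2) unbD(2)[OF H that] by blast
  have ms: "y \<epsilon> s a \<longleftrightarrow> (\<exists>b. b \<epsilon> g a \<and> y = e b)" if "a \<epsilon> H" for a y
    unfolding s_def by (rule mem_repl[OF e(1) k_in[OF Hk[OF that]]])
  define PS where "PS = G.pow S"
  have PSN: "PS \<in> N" by (simp add: PS_def)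
  have PS: "X \<epsilon> PS \<longleftrightarrow> X \<in> N \<and> (\<forall>y. y \<epsilon> X \<longrightarrow> y \<epsilon> S)" for X
    unfolding PS_def by (rule G.mem_pow[OF S(1)])
  define U where "U = collect PS (\<lambda>X. ev H (\<lambda>a. s a \<epsilon> X))"
  have dU: "dpred (\<lambda>X. ev H (\<lambda>a. s a \<epsilon> X))" by (intro D_ev D_mem ds' dfn HM)
  have U: "X \<epsilon> U \<longleftrightarrow> X \<in> N \<and> (\<forall>y. y \<epsilon> X \<longrightarrow> y \<epsilon> S) \<and> ev H (\<lambda>a. s a \<epsilon> X)" for X
    unfolding U_def mem_collect[OF dU NM'[OF PSN]] PS by blast
  have UM: "U \<in> M" by (simp add: U_def)
  have UN: "U \<in> N"
  proof (rule approx[unfolded approximation_property_def, rule_format, OF UM], intro conjI allI impI ballI)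
    show "x \<in> N" if "x \<epsilon> U" for x using that U by blast
    fix a assume a: "a \<in> N" "G.size_less a \<delta>"
    obtain m f where m: "m \<in> N" "m \<epsilon> \<delta>" "f \<in> N" "bij_betw (G.ap f) (el m) (el a)"
      by (rule G.size_lessE[OF a(2,1)], rule that)
    have mk: "m \<epsilon> k" by (rule k_down[OF \<delta> m(2)])
    have fa: "\<exists>i. i \<epsilon> m \<and> X = ap f i" if "X \<epsilon> a" for X
    proof -
      have "X \<in> ap f ` el m" using bij_betw_imp_surj_on[OF abs_bij[OF m(3,1,4)]] that by simp
      then show ?thesis by auto
    qed
    \<comment> \<open>Fewer than \<open>k\<close> sets are involved, so at a single \<open>t\<close>
      membership of \<open>s t\<close> agrees with membership in \<open>U\<close> for all of them.
      The trace of \<open>U\<close> on \<open>a\<close> is then read off from \<open>s t\<close>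
      inside the ground model.\<close>
    have "ev H (\<lambda>t. \<forall>i. i \<epsilon> m \<longrightarrow> ap f i \<epsilon> PS \<longrightarrow> (s t \<epsilon> ap f i \<longleftrightarrow> ev H (\<lambda>a. s a \<epsilon> ap f i)))"
    proof (rule ev_all[OF H _ mk])
      show "dpred2 (\<lambda>i t. ap f i \<epsilon> PS \<longrightarrow> (s t \<epsilon> ap f i \<longleftrightarrow> ev H (\<lambda>a. s a \<epsilon> ap f i)))"
        by (intro dfn ds' HM NM'[OF m(3)] NM'[OF PSN])
      fix i assume "i \<epsilon> m"
      show "ev H (\<lambda>t. ap f i \<epsilon> PS \<longrightarrow> (s t \<epsilon> ap f i \<longleftrightarrow> ev H (\<lambda>a. s a \<epsilon> ap f i)))"
      proof (cases "ap f i \<epsilon> PS")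
        case True
        then have "ap f i \<in> N" "\<And>y. y \<epsilon> ap f i \<Longrightarrow> y \<epsilon> S" using PS by blast+
        from h2[OF this] show ?thesis
        proof
          assume *: "ev H (\<lambda>a. s a \<epsilon> ap f i)"
          then show ?thesis by (rule ev_mono) (use * in blast)
        next
          assume *: "ev H (\<lambda>a. \<not> s a \<epsilon> ap f i)"
          have n: "\<not> ev H (\<lambda>a. s a \<epsilon> ap f i)"
            using ev_ex[OF H ev_conj[OF H *, of "\<lambda>a. s a \<epsilon> ap f i"]] by blast
          from * show ?thesis by (rule ev_mono) (use n in blast)
        qed
      next
        case False
        show ?thesis by (rule ev_mono[OF ev_gt[OF k(2)]]) (use False in blast)
      qed
    qed
    from ev_ex[OF H ev_conj[OF H this small]] obtain t where
      t: "\<And>i. i \<epsilon> m \<Longrightarrow> ap f i \<epsilon> PS \<Longrightarrow> (s t \<epsilon> ap f i \<longleftrightarrow> ev H (\<lambda>a. s a \<epsilon> ap f i))" "s t \<epsilon> S" by blast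
    have stN: "s t \<in> N" by (rule G.trans[OF S(1) t(2)])
    have dG: "G.dpred (\<lambda>X. X \<epsilon> PS \<and> s t \<epsilon> X)" by (intro dfn PSN stN)
    show "\<exists>b\<in>N. \<forall>x. x \<epsilon> b \<longleftrightarrow> x \<epsilon> U \<and> x \<epsilon> a"
    proof (rule bexI[of _ "G.collect a (\<lambda>X. X \<epsilon> PS \<and> s t \<epsilon> X)"], intro allI)
      fix X
      have "X \<epsilon> G.collect a (\<lambda>X. X \<epsilon> PS \<and> s t \<epsilon> X) \<longleftrightarrow> X \<epsilon> a \<and> X \<epsilon> PS \<and> s t \<epsilon> X"
        by (rule G.mem_collect[OF dG a(1)])
      also have "\<dots> \<longleftrightarrow> X \<epsilon> U \<and> X \<epsilon> a"
      proof (cases "X \<epsilon> a \<and> X \<epsilon> PS")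
        case True
        then obtain i where i: "i \<epsilon> m" "X = ap f i" using fa by blast
        then have "s t \<epsilon> X \<longleftrightarrow> ev H (\<lambda>a. s a \<epsilon> X)" using t(1)[OF i(1)] True by simp
        then show ?thesis using True PS U by blast
      next
        case False
        then show ?thesis using PS U by blast
      qed
      finally show "X \<epsilon> G.collect a (\<lambda>X. X \<epsilon> PS \<and> s t \<epsilon> X) \<longleftrightarrow> X \<epsilon> U \<and> X \<epsilon> a" .
    qed simp
  qed
  have Pk: "G.is_Pk S k A" unfolding G.is_Pk_def
    using S(2) G.sub_iff by blast
  have ult: "G.ultrafilter_on S U" unfolding G.ultrafilter_on_def
  proof (intro conjI ballI impI)
    show "S \<epsilon> U" unfolding U using S(1) small by blast
  next
    fix X assume X: "X \<in> N" "X \<epsilon> U"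
    then show "G.sub X S" using U G.sub_iff by blast
    show "\<not> G.is_empty X"
    proof -
      have "ev H (\<lambda>a. s a \<epsilon> X)" using X U by blast
      then obtain a where "s a \<epsilon> X" using ev_ex[OF H] by blast
      then show ?thesis unfolding G.is_empty_def using G.trans[OF X(1)] by blast
    qed
  next
    fix X Y assume *: "X \<in> N" "Y \<in> N" "X \<epsilon> U \<and> G.sub X Y \<and> G.sub Y S"
    then have sub: "\<And>z. z \<epsilon> X \<Longrightarrow> z \<epsilon> Y" "\<And>z. z \<epsilon> Y \<Longrightarrow> z \<epsilon> S" using G.sub_iff by blast+
    have "ev H (\<lambda>a. s a \<epsilon> X)" using * U by blast
    then have "ev H (\<lambda>a. s a \<epsilon> Y)" by (rule ev_mono) (rule sub)
    then show "Y \<epsilon> U" unfolding U using sub(2) *(2) by blast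
  next
    fix X Y Z assume *: "X \<in> N" "Y \<in> N" "Z \<in> N" "X \<epsilon> U \<and> Y \<epsilon> U \<and> (\<forall>s\<in>N. s \<epsilon> Z \<longleftrightarrow> s \<epsilon> X \<and> s \<epsilon> Y)"
    have Z: "t \<epsilon> Z \<longleftrightarrow> t \<epsilon> X \<and> t \<epsilon> Y" for t using * G.trans[OF *(1)] G.trans[OF *(3)] by blast
    have "ev H (\<lambda>a. s a \<epsilon> X \<and> s a \<epsilon> Y)" using * U by (intro ev_conj[OF H]) blast+
    then have "ev H (\<lambda>a. s a \<epsilon> Z)" unfolding Z .
    then show "Z \<epsilon> U" using * U Z by blast
  next
    fix X Y assume *: "X \<in> N" "Y \<in> N" "G.sub X S \<and> (\<forall>s\<in>N. s \<epsilon> Y \<longleftrightarrow> s \<epsilon> S \<and> \<not> s \<epsilon> X)"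
    have X: "\<And>t. t \<epsilon> X \<Longrightarrow> t \<epsilon> S" using * G.sub_iff by blast
    have Y: "t \<epsilon> Y \<longleftrightarrow> t \<epsilon> S \<and> \<not> t \<epsilon> X" for t using * G.trans[OF S(1)] G.trans[OF *(2)] by blast
    from h2[OF *(1) X] show "X \<epsilon> U \<or> Y \<epsilon> U"
    proof
      assume "ev H (\<lambda>a. s a \<epsilon> X)"
      then show ?thesis using U X *(1) by blast
    next
      assume "ev H (\<lambda>a. \<not> s a \<epsilon> X)"
      then have "ev H (\<lambda>a. s a \<epsilon> Y)" unfolding Y by (intro ev_conj[OF H] small)
      then show ?thesis using U Y *(2) by blast
    qed
  qed
  have comp: "G.complete k S U" unfolding G.complete_def
  proof (intro ballI impI)
    fix F X assume F: "F \<in> N" and X: "X \<in> N" and *: "G.sub F U \<and> G.size_less F k \<and>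
      (\<forall>s\<in>N. s \<epsilon> X \<longleftrightarrow> s \<epsilon> S \<and> (\<forall>Y\<in>N. Y \<epsilon> F \<longrightarrow> s \<epsilon> Y))"
    have FU: "Y \<epsilon> U" if "Y \<epsilon> F" for Y using * that G.sub_iff[OF F] by blast
    have Xm: "t \<epsilon> X \<longleftrightarrow> t \<epsilon> S \<and> (\<forall>Y. Y \<epsilon> F \<longrightarrow> t \<epsilon> Y)" for t
      using * G.trans[OF S(1)] G.trans[OF X] G.trans[OF F] by blast
    obtain m f where m: "m \<in> N" "m \<epsilon> k" "f \<in> N" "bij_betw (G.ap f) (el m) (el F)"
      by (rule G.size_lessE[OF conjunct1[OF conjunct2[OF *]] F], rule that)
    note bij = abs_bij[OF m(3,1,4)]
    have "ev H (\<lambda>a. \<forall>i. i \<epsilon> m \<longrightarrow> s a \<epsilon> ap f i)"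
    proof (rule ev_all[OF H _ m(2)])
      show "dpred2 (\<lambda>i a. s a \<epsilon> ap f i)" by (intro dfn ds' NM'[OF m(3)])
      fix i assume "i \<epsilon> m"
      then have "ap f i \<epsilon> F" using bij_betwE[OF bij] by simp
      then show "ev H (\<lambda>a. s a \<epsilon> ap f i)" using FU U by blast
    qed
    from ev_conj[OF H this small] have "ev H (\<lambda>a. s a \<epsilon> X)"
    proof (rule ev_mono)
      fix a assume a: "(\<forall>i. i \<epsilon> m \<longrightarrow> s a \<epsilon> ap f i) \<and> s a \<epsilon> S"
      have "s a \<epsilon> Y" if "Y \<epsilon> F" for Y
      proof -
        have "Y \<in> ap f ` el m" using bij_betw_imp_surj_on[OF bij] that by simp
        then show ?thesis using a by auto
      qed
      then show "s a \<epsilon> X" unfolding Xm using a by blast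
    qed
    then show "X \<epsilon> U" unfolding U using X Xm by blast
  qed
  have fine: "G.fine A S U" unfolding G.fine_def
  proof (intro ballI impI)
    fix a X assume a: "a \<in> N" and X: "X \<in> N" and *: "a \<epsilon> A \<and> (\<forall>s\<in>N. s \<epsilon> X \<longleftrightarrow> s \<epsilon> S \<and> a \<epsilon> s)"
    have Xm: "t \<epsilon> X \<longleftrightarrow> t \<epsilon> S \<and> a \<epsilon> t" for t using * G.trans[OF S(1)] G.trans[OF X] by blast
    obtain b where b: "b \<epsilon> k" "e b = a" using e(2) * by blast
    from ev_conj[OF H g(3)[OF b(1)] small] have "ev H (\<lambda>a. s a \<epsilon> X)"
      by (rule ev_mono) (use b ms Xm in blast)
    then show "X \<epsilon> U" unfolding U using X Xm by blast
  qed
  have normal: "G.normal A S U" unfolding G.normal_def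
  proof (intro ballI impI)
    fix f X assume f: "f \<in> N" and X: "X \<in> N" and *: "G.is_fun f S A \<and> X \<epsilon> U \<and>
        (\<forall>s\<in>N. s \<epsilon> X \<longleftrightarrow> s \<epsilon> S \<and> (\<exists>a\<in>N. G.app f s a \<and> a \<epsilon> s))"
    have ff: "G.is_fun f S A" using * by blast
    have fa: "G.app f t a \<longleftrightarrow> a = ap f t" if "t \<epsilon> S" "a \<in> N" for t a
      using G.is_fun_app(2)[OF ff f S(1) that] abs_ap[OF f G.trans[OF S(1) that(1)]] by simp
    have "ev H (\<lambda>a. s a \<epsilon> X)" using * U by blast
    then have "ev H (\<lambda>a. ap f (s a) \<epsilon> s a)"
    proof (rule ev_mono)
      fix a assume "s a \<epsilon> X"
      then have "s a \<epsilon> S \<and> (\<exists>b\<in>N. G.app f (s a) b \<and> b \<epsilon> s a)" using * G.trans[OF X] by blast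
      then show "ap f (s a) \<epsilon> s a" using fa by blast
    qed
    from h1[OF f ff this] obtain b where b: "b \<epsilon> A" "ev H (\<lambda>a. ap f (s a) = b)" by blast
    have bN: "b \<in> N" by (rule G.trans[OF A b(1)])
    define Y where "Y = G.collect S (\<lambda>t. G.app f t b)"
    have "G.dpred (\<lambda>t. G.app f t b)" by (intro dfn f bN)
    note Y = G.mem_collect[OF this S(1), folded Y_def]
    have YN: "Y \<in> N" by (simp add: Y_def)
    from ev_conj[OF H b(2) small] have "ev H (\<lambda>a. s a \<epsilon> Y)"
      by (rule ev_mono) (use Y fa bN in blast)
    then have "Y \<epsilon> U" unfolding U using Y YN by blast
    then show "\<exists>a\<in>N. \<exists>Y\<in>N. a \<epsilon> A \<and> Y \<epsilon> U \<and> (\<forall>s\<in>N. s \<epsilon> Y \<longleftrightarrow> s \<epsilon> S \<and> G.app f s a)"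
      using bN YN b(1) Y by blast
  qed
  show ?thesis
    by (rule bexI[OF _ UN]) (unfold G.normal_fine_measure_def, use S(1) Pk ult comp fine normal in blast)
qed

text \<open>
  Here \<open>r\<close> represents every binary relation between \<open>s \<in> S\<close> and elements of \<open>A\<close> that is definable in the
  ground model; functions and subsets of \<open>S\<close> are instances.
\<close>

lemma measure_from_families:
  assumes \<delta>: "\<delta> \<epsilon> k" and approx: "approximation_property E \<delta> N M"
    and A: "A \<in> N" and S: "S \<in> N" "\<And>x. x \<epsilon> S \<longleftrightarrow> x \<in> N \<and> (\<forall>z. z \<epsilon> x \<longrightarrow> z \<epsilon> A) \<and> G.size_less x k"
    and e: "dfun e" "\<And>a. a \<epsilon> A \<Longrightarrow> \<exists>b. b \<epsilon> k \<and> e b = a" "\<And>b. b \<epsilon> k \<Longrightarrow> e b \<epsilon> A"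
    and r: "dpred3 r" and q: "dpred3 q"
    and rep: "\<And>P. G.dpred2 P \<Longrightarrow> \<exists>\<xi>. \<xi> \<epsilon> k \<and>
      (\<forall>a b. a \<epsilon> k \<longrightarrow> b \<epsilon> a \<longrightarrow> repl a e \<epsilon> S \<longrightarrow> (r \<xi> a b \<longleftrightarrow> P (repl a e) (e b)))"
    and small: "\<And>H g. normal_for q H g \<Longrightarrow> ev H (\<lambda>a. repl (g a) e \<epsilon> S)"
  shows "\<exists>U\<in>N. G.normal_fine_measure k A U"
proof -
  obtain H g where rH: "normal_for r H g" and qH: "normal_for q H g"
    by (rule normal_families[OF r q], rule that)
  note H = normal_forD(1-4)[OF rH] and rd = normal_forD(5)[OF rH]
  have sm: "ev H (\<lambda>a. repl (g a) e \<epsilon> S)" by (rule small[OF qH])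
  have Hk: "g a \<epsilon> k" if "a \<epsilon> H" for a using H(3) unbD(2)[OF H(1) that] by blast
  show ?thesis
  proof (rule measure_from_function[OF \<delta> approx A S e H sm])
    fix f assume f: "f \<in> N" "G.is_fun f S A" and reg: "ev H (\<lambda>a. ap f (repl (g a) e) \<epsilon> repl (g a) e)"
    have fa: "G.app f t a \<longleftrightarrow> a = ap f t" if "t \<epsilon> S" "a \<in> N" for t a
      using G.is_fun_app(2)[OF f(2,1) S(1) that] abs_ap[OF f(1) G.trans[OF S(1) that(1)]] by simp
    have "G.dpred2 (G.app f)" by (intro dfn f)
    from rep[OF this] obtain \<xi> where \<xi>: "\<xi> \<epsilon> k"
      "\<And>a b. a \<epsilon> k \<Longrightarrow> b \<epsilon> a \<Longrightarrow> repl a e \<epsilon> S \<Longrightarrow> r \<xi> a b \<longleftrightarrow> G.app f (repl a e) (e b)" by blast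
    have eN: "e b \<in> N" if "b \<epsilon> k" for b by (rule G.trans[OF A e(3)[OF that]])
    from rd[OF \<xi>(1)] show "\<exists>b. b \<epsilon> A \<and> ev H (\<lambda>a. ap f (repl (g a) e) = b)"
    proof
      \<comment> \<open>This alternative is void: a regressive value is \<open>e b\<close> for some
        \<open>b\<close> below \<open>g a\<close>.\<close>
      assume "ev H (\<lambda>a. \<forall>b. b \<epsilon> g a \<longrightarrow> \<not> r \<xi> (g a) b)"
      from ev_ex[OF H(1) ev_conj[OF H(1) this ev_conj[OF H(1) reg sm]]] obtain a where
        a: "a \<epsilon> H" "\<And>b. b \<epsilon> g a \<Longrightarrow> \<not> r \<xi> (g a) b" "ap f (repl (g a) e) \<epsilon> repl (g a) e" "repl (g a) e \<epsilon> S" by blast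
      note ga = Hk[OF a(1)]
      obtain b where b: "b \<epsilon> g a" "ap f (repl (g a) e) = e b" using a(3) mem_repl[OF e(1) k_in[OF ga]] by auto
      then have "r \<xi> (g a) b" using \<xi>(2)[OF ga b(1) a(4)] fa[OF a(4) eN[OF k_down[OF ga b(1)]]] by simp
      then show ?thesis using a(2)[OF b(1)] by blast
    next
      assume "\<exists>b. b \<epsilon> k \<and> ev H (\<lambda>a. b \<epsilon> g a \<and> r \<xi> (g a) b)"
      then obtain b where b: "b \<epsilon> k" "ev H (\<lambda>a. b \<epsilon> g a \<and> r \<xi> (g a) b)" by blast
      have "ev H (\<lambda>a. ap f (repl (g a) e) = e b)"
      proof (rule ev_mono[OF ev_conj[OF H(1) b(2) sm]])
        fix a assume a: "a \<epsilon> H" "(b \<epsilon> g a \<and> r \<xi> (g a) b) \<and> repl (g a) e \<epsilon> S"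
        then have "G.app f (repl (g a) e) (e b)" using \<xi>(2)[OF Hk] by blast
        then show "ap f (repl (g a) e) = e b" using fa[OF _ eN[OF b(1)]] a(2) by simp
      qed
      then show ?thesis using e(3)[OF b(1)] by blast
    qed
  next
    fix X assume X: "X \<in> N"
    \<comment> \<open>A subset of \<open>S\<close> is treated as a relation that ignores its second
      argument.\<close>
    have "G.dpred2 (\<lambda>s b. s \<epsilon> X)" by (intro dfn X)
    from rep[OF this] obtain \<xi> where \<xi>: "\<xi> \<epsilon> k"
      "\<And>a b. a \<epsilon> k \<Longrightarrow> b \<epsilon> a \<Longrightarrow> repl a e \<epsilon> S \<Longrightarrow> r \<xi> a b \<longleftrightarrow> repl a e \<epsilon> X" by blast
    from rd[OF \<xi>(1)] show "ev H (\<lambda>a. repl (g a) e \<epsilon> X) \<or> ev H (\<lambda>a. \<not> repl (g a) e \<epsilon> X)"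
    proof
      assume "ev H (\<lambda>a. \<forall>b. b \<epsilon> g a \<longrightarrow> \<not> r \<xi> (g a) b)"
      \<comment> \<open>Eventually \<open>zer\<close> lies in \<open>g a\<close> and so is one of
        the \<open>b\<close> for which the relation fails.\<close>
      from ev_conj[OF H(1) this ev_conj[OF H(1) H(4)[OF k(2)] sm]] have "ev H (\<lambda>a. \<not> repl (g a) e \<epsilon> X)"
        by (rule ev_mono) (use \<xi>(2)[OF Hk] in blast)
      then show ?thesis ..
    next
      assume "\<exists>b. b \<epsilon> k \<and> ev H (\<lambda>a. b \<epsilon> g a \<and> r \<xi> (g a) b)"
      then obtain b where "ev H (\<lambda>a. b \<epsilon> g a \<and> r \<xi> (g a) b)" by blast
      from ev_conj[OF H(1) this sm] have "ev H (\<lambda>a. repl (g a) e \<epsilon> X)"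
        by (rule ev_mono) (use \<xi>(2)[OF Hk] in blast)
      then show ?thesis ..
    qed
  qed
qed

section \<open>Ordinals below the cardinal as codes for sets of the ground model\<close>

text \<open>In the ground model \<open>F\<close> has size \<mu> and its subsets have size \<nu>,
  which in turn has size \<open>k\<close> in the larger model; \<open>code\<close> is the resulting
  enumeration of these subsets along \<open>k\<close>. That distinct ordinals code distinct subsets
  serves later to exclude an empty \<theta>.\<close>

lemma code_relation:
  assumes \<theta>: "\<theta> \<in> N" and \<mu>: "\<mu> \<in> N" "G.card_exp_less \<theta> k \<mu>" and \<nu>: "\<nu> \<in> N" "G.two_exp \<mu> \<nu>" and c: "has_card \<nu> k"
  obtains F code where "F \<in> N" "\<And>f. f \<epsilon> F \<longleftrightarrow> f \<in> N \<and> (\<exists>b. b \<epsilon> k \<and> G.is_fun f b \<theta>)" "dpred2 code"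
    "\<And>Y. Y \<in> N \<Longrightarrow> \<forall>y. y \<epsilon> Y \<longrightarrow> y \<epsilon> F \<Longrightarrow> \<exists>\<xi>. \<xi> \<epsilon> k \<and> (\<forall>x. x \<epsilon> F \<longrightarrow> (code \<xi> x \<longleftrightarrow> x \<epsilon> Y))"
    "\<And>\<xi> \<xi>'. \<xi> \<epsilon> k \<Longrightarrow> \<xi>' \<epsilon> k \<Longrightarrow> \<forall>x. x \<epsilon> F \<longrightarrow> (code \<xi> x \<longleftrightarrow> code \<xi>' x) \<Longrightarrow> \<xi> = \<xi>'"
proof -
  from \<mu>(2) obtain F where F: "F \<in> N" "\<forall>f\<in>N. f \<epsilon> F \<longleftrightarrow> (\<exists>b\<in>N. b \<epsilon> k \<and> G.is_fun f b \<theta>)" "G.has_card F \<mu>"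
    unfolding G.card_exp_less_def by blast
  from \<nu>(2) obtain t F2 where t: "t \<in> N" "G.is_two t" and
    F2: "F2 \<in> N" "\<forall>f\<in>N. f \<epsilon> F2 \<longleftrightarrow> G.is_fun f \<mu> t" "G.has_card F2 \<nu>"
    unfolding G.two_exp_def G.card_exp_def by blast
  have Fm: "f \<epsilon> F \<longleftrightarrow> f \<in> N \<and> (\<exists>b. b \<epsilon> k \<and> G.is_fun f b \<theta>)" for f
    using F(2) G.trans[OF F(1)] G.trans[OF kN] by blast
  have F2m: "f \<epsilon> F2 \<longleftrightarrow> f \<in> N \<and> G.is_fun f \<mu> t" for f
    using F2(2) G.trans[OF F2(1)] by blast
  have te: "t = G.suc (G.suc G.zer)" using t G.is_two_iff by blast
  have "G.equipotent F \<mu>" using F(3) unfolding G.has_card_def by blast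
  then obtain b1 where b1: "b1 \<in> N" "bij_betw (G.ap b1) (el F) (el \<mu>)" using G.equipotentE[OF _ F(1) \<mu>(1)] by blast
  have "G.equipotent F2 \<nu>" using F2(3) unfolding G.has_card_def by blast
  then obtain b2 where b2: "b2 \<in> N" "bij_betw (G.ap b2) (el F2) (el \<nu>)" using G.equipotentE[OF _ F2(1) \<nu>(1)] by blast
  have "equipotent \<nu> k" using c unfolding has_card_def by blast
  then obtain b3 where b3: "b3 \<in> M" "bij_betw (ap b3) (el \<nu>) (el k)" using equipotentE[OF _ NM'[OF \<nu>(1)] kM] by blast
  note b1' = abs_bij[OF b1(1) F(1) b1(2)] and b2' = abs_bij[OF b2(1) F2(1) b2(2)]
  \<comment> \<open>A bijection of the ground model followed by one of the larger model:
    \<open>d\<close> indexes the characteristic functions by the ordinals below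
    \<open>k\<close>.\<close>
  define d where "d f = ap b3 (ap b2 f)" for f
  have dd: "dfun d" unfolding d_def by (intro dfn b3 NM'[OF b2(1)])
  have d: "bij_betw d (el F2) (el k)" unfolding d_def using bij_betw_trans[OF b2' b3(2)] by (simp add: comp_def)
  have dinj: "f = f'" if "f \<epsilon> F2" "f' \<epsilon> F2" "d f = d f'" for f f'
    using inj_onD[OF bij_betw_imp_inj_on[OF d] that(3)] that by simp
  have dk: "d f \<epsilon> k" if "f \<epsilon> F2" for f using bij_betwE[OF d] that by simp
  have dsurj: "\<exists>f. f \<epsilon> F2 \<and> d f = \<xi>" if "\<xi> \<epsilon> k" for \<xi>
  proof -
    have "\<xi> \<in> d ` el F2" using bij_betw_imp_surj_on[OF d] that by simp
    then show ?thesis by auto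
  qed
  define code where "code \<xi> x \<longleftrightarrow> (\<exists>f. f \<epsilon> F2 \<and> d f = \<xi> \<and> ap f (ap b1 x) = suc zer)" for \<xi> x
  have dcode: "dpred2 code" unfolding code_def
    by (intro dfn Dt_comp1[OF dd] NM'[OF F2(1)] NM'[OF b1(1)] in_M)
  have code: "code (d f) x \<longleftrightarrow> ap f (ap b1 x) = suc zer" if "f \<epsilon> F2" for f x
    unfolding code_def using dinj that by blast
  have b1m: "ap b1 x \<epsilon> \<mu>" if "x \<epsilon> F" for x using bij_betwE[OF b1'] that by simp
  show thesis
  proof (rule that[OF F(1) Fm dcode])
    fix Y assume "Y \<in> N" "\<forall>y. y \<epsilon> Y \<longrightarrow> y \<epsilon> F"
    then have Y: "Y \<in> N" "\<And>y. y \<epsilon> Y \<Longrightarrow> y \<epsilon> F" by blast+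
    \<comment> \<open>The characteristic function of \<open>Y\<close>, transported along
      \<open>b1\<close> from \<open>F\<close> to \<mu>.\<close>
    define h where "h i = (if \<exists>x. x \<epsilon> Y \<and> G.ap b1 x = i then G.suc G.zer else G.zer)" for i
    have dh: "G.dfun h" unfolding h_def by (intro dfn Y(1) b1(1) G.in_M G.zer)
    define f where "f = G.lam \<mu> h"
    have fN: "f \<in> N" by (simp add: f_def)
    have "G.is_fun f \<mu> t" unfolding f_def by (rule G.is_fun_lam[OF dh \<mu>(1) t(1)]) (simp add: h_def te)
    then have f: "f \<epsilon> F2" unfolding F2m using fN by blast
    have "code (d f) x \<longleftrightarrow> x \<epsilon> Y" if x: "x \<epsilon> F" for x
    proof -
      have i: "ap b1 x \<epsilon> \<mu>" by (rule b1m[OF x])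
      have "ap f (ap b1 x) = h (ap b1 x)"
        using G.ap_lam[OF dh \<mu>(1) i] abs_ap[OF fN G.trans[OF \<mu>(1) i]] by (simp add: f_def)
      moreover have "G.suc G.zer = suc zer" "suc zer \<noteq> G.zer"
        using abs_suc[OF G.zer(1)] abs_zer mem_suc[of zer zer] zer by (simp, metis)
      ultimately have "ap f (ap b1 x) = suc zer \<longleftrightarrow> (\<exists>y. y \<epsilon> Y \<and> G.ap b1 y = ap b1 x)"
        unfolding h_def by simp
      also have "\<dots> \<longleftrightarrow> x \<epsilon> Y"
      proof
        assume "\<exists>y. y \<epsilon> Y \<and> G.ap b1 y = ap b1 x"
        then obtain y where y: "y \<epsilon> Y" "G.ap b1 y = ap b1 x" by blast
        then have "ap b1 y = ap b1 x" using abs_ap[OF b1(1) G.trans[OF Y(1) y(1)]] by simp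
        then have "y = x" using inj_onD[OF bij_betw_imp_inj_on[OF b1']] Y(2)[OF y(1)] x by simp
        then show "x \<epsilon> Y" using y by simp
      next
        assume "x \<epsilon> Y"
        then show "\<exists>y. y \<epsilon> Y \<and> G.ap b1 y = ap b1 x" using abs_ap[OF b1(1) G.trans[OF F(1) x]] by blast
      qed
      finally show ?thesis unfolding code[OF f] .
    qed
    then show "\<exists>\<xi>. \<xi> \<epsilon> k \<and> (\<forall>x. x \<epsilon> F \<longrightarrow> (code \<xi> x \<longleftrightarrow> x \<epsilon> Y))" using dk[OF f] by blast
  next
    fix \<xi> \<xi>' assume "\<xi> \<epsilon> k" "\<xi>' \<epsilon> k" and eq': "\<forall>x. x \<epsilon> F \<longrightarrow> (code \<xi> x \<longleftrightarrow> code \<xi>' x)"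
    note eq = eq'[rule_format]
    obtain f where f: "f \<epsilon> F2" "d f = \<xi>" using dsurj \<open>\<xi> \<epsilon> k\<close> by blast
    obtain f' where f': "f' \<epsilon> F2" "d f' = \<xi>'" using dsurj \<open>\<xi>' \<epsilon> k\<close> by blast
    have fN: "f \<in> N" "G.is_fun f \<mu> t" and fN': "f' \<in> N" "G.is_fun f' \<mu> t" using f f' F2m by blast+
    have two: "ap g i = zer \<or> ap g i = suc zer" if "g \<in> N" "G.is_fun g \<mu> t" "i \<epsilon> \<mu>" for g i
    proof -
      have "G.ap g i \<epsilon> t" by (rule G.is_fun_ap[OF that(2,1) \<mu>(1) t(1) that(3)])
      then show ?thesis unfolding abs_ap[OF that(1) G.trans[OF \<mu>(1) that(3)]] te
        using abs_suc[OF G.zer(1)] abs_zer by auto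
    qed
    have "G.lam \<mu> (G.ap f) = G.lam \<mu> (G.ap f')"
    proof (rule G.lam_cong[OF _ _ \<mu>(1)])
      show "G.dfun (G.ap f)" "G.dfun (G.ap f')" by (intro dfn fN fN')+
      fix i assume i: "i \<epsilon> \<mu>"
      then have "i \<in> ap b1 ` el F" using bij_betw_imp_surj_on[OF b1'] by simp
      then obtain x where x: "x \<epsilon> F" "i = ap b1 x" by auto
      have "ap f i = suc zer \<longleftrightarrow> ap f' i = suc zer"
        using eq[OF x(1)] code[OF f(1), of x] code[OF f'(1), of x] f(2) f'(2) x(2) by simp
      then have "ap f i = ap f' i" using two[OF fN i] two[OF fN' i] by auto
      then show "G.ap f i = G.ap f' i"
        using abs_ap[OF fN(1) G.trans[OF \<mu>(1) i]] abs_ap[OF fN'(1) G.trans[OF \<mu>(1) i]] by simp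
    qed
    then have "f = f'"
      using G.is_fun_eq_lam[OF fN(2,1) \<mu>(1) t(1)] G.is_fun_eq_lam[OF fN'(2,1) \<mu>(1) t(1)] by simp
    then show "\<xi> = \<xi>'" using f f' by simp
  qed
qed

lemma Pk_exists:
  assumes A: "A \<in> N"
  obtains S where "S \<in> N" "\<And>x. x \<epsilon> S \<longleftrightarrow> x \<in> N \<and> (\<forall>z. z \<epsilon> x \<longrightarrow> z \<epsilon> A) \<and> G.size_less x k"
proof (rule that)
  let ?S = "G.collect (G.pow A) (\<lambda>x. G.size_less x k)"
  have "G.dpred (\<lambda>x. G.size_less x k)" by (intro dfn kN)
  from G.mem_collect[OF this G.in_M(4)[of A]]
  show "x \<epsilon> ?S \<longleftrightarrow> x \<in> N \<and> (\<forall>z. z \<epsilon> x \<longrightarrow> z \<epsilon> A) \<and> G.size_less x k" for x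
    unfolding G.mem_pow[OF A] by blast
qed simp

lemma G_Ord_k: "G.Ord k" using abs_Ord[OF kN] k(1) by simp

lemma kinN: "x \<epsilon> k \<Longrightarrow> x \<in> N" by (rule G.trans[OF kN])

text \<open>
  The case \<open>\<theta> < k\<close>: the pair \<open>(a, b)\<close> is coded by the functions from the ordinal \<open>p a b\<close> to \<open>\<theta>\<close>.
\<close>

lemma measure_on_k:
  assumes \<delta>: "\<delta> \<epsilon> k" and approx: "approximation_property E \<delta> N M"
    and \<theta>: "\<theta> \<in> N" "z0 \<epsilon> \<theta>"
    and F: "F \<in> N" "\<And>f. f \<epsilon> F \<longleftrightarrow> f \<in> N \<and> (\<exists>b. b \<epsilon> k \<and> G.is_fun f b \<theta>)"
    and dcode: "dpred2 code"
    and code: "\<And>Y. Y \<in> N \<Longrightarrow> \<forall>y. y \<epsilon> Y \<longrightarrow> y \<epsilon> F \<Longrightarrow> \<exists>\<xi>. \<xi> \<epsilon> k \<and> (\<forall>x. x \<epsilon> F \<longrightarrow> (code \<xi> x \<longleftrightarrow> x \<epsilon> Y))"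
  shows "\<exists>U\<in>N. G.normal_fine_measure k k U"
proof -
  obtain S where S: "S \<in> N" "\<And>x. x \<epsilon> S \<longleftrightarrow> x \<in> N \<and> (\<forall>z. z \<epsilon> x \<longrightarrow> z \<epsilon> k) \<and> G.size_less x k"
    by (rule Pk_exists[OF kN], rule that)
  interpret R: reg N E k by (rule ground_regular)
  obtain p where p: "G.dfun2 p" "\<And>a b. a \<epsilon> k \<Longrightarrow> b \<epsilon> k \<Longrightarrow> p a b \<epsilon> k" "\<And>a b. a \<epsilon> k \<Longrightarrow> b \<epsilon> k \<Longrightarrow> b \<epsilon> p a b"
    "\<And>a b a' b'. a \<epsilon> k \<Longrightarrow> b \<epsilon> k \<Longrightarrow> a' \<epsilon> k \<Longrightarrow> b' \<epsilon> k \<Longrightarrow> p a b = p a' b' \<Longrightarrow> a = a' \<and> b = b'"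
    by (rule R.pairing_injection, rule that)
  \<comment> \<open>The pairing of the ground model is made a set: as a parameter it keeps
    \<open>r\<close> definable in the larger model, and both models evaluate it alike.\<close>
  define P where "P = G.lam (G.cprod k k) (\<lambda>z. p (G.pfst z) (G.psnd z))"
  have PN: "P \<in> N" by (simp add: P_def)
  have P: "G.ap P (G.opair a b) = p a b" "ap P (opair a b) = p a b" if ab: "a \<epsilon> k" "b \<epsilon> k" for a b
  proof -
    have d: "G.dfun (\<lambda>z. p (G.pfst z) (G.psnd z))" by (intro dfn G.Dt_comp2[OF p(1)])
    have "G.opair a b \<epsilon> G.cprod k k" unfolding G.mem_cprod[OF kN kN] using ab by blast
    from G.ap_lam[OF d _ this] show 1: "G.ap P (G.opair a b) = p a b"
      using kinN ab by (simp add: P_def)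
    then show "ap P (opair a b) = p a b"
      using abs_ap[OF PN G.in_M(7)[of a b]] abs_opair[OF kinN[OF ab(1)] kinN[OF ab(2)]] by simp
  qed
  have did: "dfun (\<lambda>x. x)" by (intro dfn)
  have id: "repl a (\<lambda>x. x) = a" if "a \<epsilon> k" for a
    by (rule set_ext) (use that mem_repl[OF did k_in[OF that]] in auto)
  define r where "r \<xi> a b \<longleftrightarrow> (\<exists>c. c \<epsilon> F \<and> code \<xi> c \<and> is_fun c (ap P (opair a b)) \<theta>)" for \<xi> a b
  have dr: "dpred3 r" unfolding r_def by (intro dfn D_comp2[OF dcode] NM'[OF F(1)] NM'[OF PN] NM'[OF \<theta>(1)])
  show ?thesis
  \<comment> \<open>With the identity for \<open>e\<close> the images are ordinals below
    \<open>k\<close> and lie in the ground model, so the second family is the void one.\<close>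
  proof (rule measure_from_families[OF \<delta> approx kN S did _ _ dr D_bool'[of False]])
    show "\<exists>b. b \<epsilon> k \<and> b = a" if "a \<epsilon> k" for a using that by blast
    show "b \<epsilon> k" if "b \<epsilon> k" for b by fact
  next
    fix Q assume Q: "G.dpred2 Q"
    define Y where "Y = G.collect F (\<lambda>c. \<exists>a. a \<epsilon> k \<and> (\<exists>b. b \<epsilon> k \<and> G.is_fun c (G.ap P (G.opair a b)) \<theta> \<and> Q a b))"
    have "G.dpred (\<lambda>c. \<exists>a. a \<epsilon> k \<and> (\<exists>b. b \<epsilon> k \<and> G.is_fun c (G.ap P (G.opair a b)) \<theta> \<and> Q a b))"
      by (intro dfn G.D_comp2[OF Q] kN PN \<theta>(1))
    note Y = G.mem_collect[OF this F(1), folded Y_def]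
    have "Y \<in> N" by (simp add: Y_def)
    moreover have "y \<epsilon> F" if "y \<epsilon> Y" for y using that Y by blast
    ultimately obtain \<xi> where \<xi>: "\<xi> \<epsilon> k" "\<And>x. x \<epsilon> F \<Longrightarrow> code \<xi> x \<longleftrightarrow> x \<epsilon> Y" using code by blast
    have "r \<xi> a b \<longleftrightarrow> Q a b" if a: "a \<epsilon> k" and ba: "b \<epsilon> a" for a b
    proof
      have b: "b \<epsilon> k" by (rule k_down[OF a ba])
      assume "r \<xi> a b"
      then obtain c where c: "c \<epsilon> F" "c \<epsilon> Y" "is_fun c (p a b) \<theta>" unfolding r_def P(2)[OF a b] using \<xi>(2) by blast
      have cN: "c \<in> N" by (rule G.trans[OF F(1) c(1)])
      obtain a' b' where ab': "a' \<epsilon> k" "b' \<epsilon> k" "G.is_fun c (p a' b') \<theta>" "Q a' b'"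
        using c(2) P(1) unfolding Y by auto
      have "is_fun c (p a' b') \<theta>"
        using ab'(3) abs_is_fun[OF cN kinN[OF p(2)[OF ab'(1,2)]] \<theta>(1)] by simp
      then have "p a b = p a' b'"
        by (rule is_fun_dom_unique[OF NM'[OF cN] k_in[OF p(2)[OF a b]] k_in[OF p(2)[OF ab'(1,2)]]
              NM'[OF \<theta>(1)] NM'[OF \<theta>(1)] c(3)])
      then show "Q a b" using p(4)[OF a b ab'(1,2)] ab'(4) by blast
    next
      have b: "b \<epsilon> k" by (rule k_down[OF a ba])
      assume Qab: "Q a b"
      note pk = p(2)[OF a b]
      have z0N: "z0 \<in> N" by (rule G.trans[OF \<theta>])
      \<comment> \<open>The code of a pair has to be the domain of some function to \<theta>; an
        element of \<theta> provides a constant one.\<close>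
      define c where "c = G.lam (p a b) (\<lambda>_. z0)"
      have cN: "c \<in> N" by (simp add: c_def)
      have dz: "G.dfun (\<lambda>_. z0)" by (intro dfn z0N)
      have cf: "G.is_fun c (p a b) \<theta>" unfolding c_def by (rule G.is_fun_lam[OF dz kinN[OF pk] \<theta>(1)]) (rule \<theta>(2))
      have cF: "c \<epsilon> F" unfolding F(2) using cN cf pk by blast
      have "G.is_fun c (G.ap P (G.opair a b)) \<theta>" unfolding P(1)[OF a b] by (rule cf)
      then have "c \<epsilon> Y" unfolding Y using cF a b Qab by blast
      then have "code \<xi> c" using \<xi>(2)[OF cF] by blast
      then show "r \<xi> a b" unfolding r_def P(2)[OF a b]
        using cF cf abs_is_fun[OF cN kinN[OF pk] \<theta>(1)] by blast
    qed
    then show "\<exists>\<xi>. \<xi> \<epsilon> k \<and> (\<forall>a b. a \<epsilon> k \<longrightarrow> b \<epsilon> a \<longrightarrow> repl a (\<lambda>x. x) \<epsilon> S \<longrightarrow> (r \<xi> a b \<longleftrightarrow> Q (repl a (\<lambda>x. x)) b))"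
      using \<xi>(1) id by metis
  next
    fix H g assume n: "normal_for (\<lambda>_ _ _. False) H g"
    note H = normal_forD(1)[OF n] and g = normal_forD(2,3)[OF n]
    show "ev H (\<lambda>a. repl (g a) (\<lambda>x. x) \<epsilon> S)"
    proof (rule ev_mono[OF ev_gt[OF k(2)]])
      fix a assume "a \<epsilon> H"
      then have ga: "g a \<epsilon> k" using g(2) unbD(2)[OF H] by blast
      have "G.size_less (g a) k"
      proof (rule G.size_lessI[OF kinN[OF ga] G_Ord_k ga])
        show "G.dfun (\<lambda>x. x)" by (intro dfn)
      qed auto
      then show "repl (g a) (\<lambda>x. x) \<epsilon> S" unfolding id[OF ga] S(2) using kinN[OF ga] k_down[OF ga] by blast
    qed
  qed
qed

section \<open>Images of the enumeration lie in the ground model\<close>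

text \<open>
  Where \<open>e ` a\<close> is not in the ground model, \<open>ga a\<close> enumerates a small set witnessing this against the
  approximation property, and \<open>q\<close> locates its entries in \<open>e ` a\<close>; normality makes the intersection of
  its range with \<open>e ` g(a)\<close> eventually equal to a fixed set \<open>B0\<close>.
\<close>

lemma images_in_ground:
  assumes \<delta>: "\<delta> \<epsilon> k" and approx: "approximation_property E \<delta> N M" and cover: "cover_property E \<delta> N M"
    and \<theta>: "\<theta> \<in> N" "Ord \<theta>"
    and S: "S \<in> N" "\<And>x. x \<epsilon> S \<longleftrightarrow> x \<in> N \<and> (\<forall>z. z \<epsilon> x \<longrightarrow> z \<epsilon> \<theta>) \<and> G.size_less x k"
    and F: "F \<in> N" "\<And>f. f \<epsilon> F \<longleftrightarrow> f \<in> N \<and> (\<exists>b. b \<epsilon> k \<and> G.is_fun f b \<theta>)"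
    and dcode: "dpred2 code"
    and code: "\<And>Y. Y \<in> N \<Longrightarrow> \<forall>y. y \<epsilon> Y \<longrightarrow> y \<epsilon> F \<Longrightarrow> \<exists>\<xi>. \<xi> \<epsilon> k \<and> (\<forall>x. x \<epsilon> F \<longrightarrow> (code \<xi> x \<longleftrightarrow> x \<epsilon> Y))"
    and e: "dfun e" "\<And>a. a \<epsilon> \<theta> \<Longrightarrow> \<exists>b. b \<epsilon> k \<and> e b = a" "\<And>b. b \<epsilon> k \<Longrightarrow> e b \<epsilon> \<theta>"
  obtains q where "dpred3 q" "\<forall>H g. normal_for q H g \<longrightarrow> ev H (\<lambda>a. repl (g a) e \<epsilon> S)"
proof -
  have \<delta>N: "\<delta> \<in> N" and \<delta>O: "Ord \<delta>" and \<delta>k: "\<And>x. x \<epsilon> \<delta> \<Longrightarrow> x \<epsilon> k" using kinN \<delta> k_down by auto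
  have \<theta>N: "x \<in> N" if "x \<epsilon> \<theta>" for x by (rule G.trans[OF \<theta>(1) that])
  note mi = mem_repl[OF e(1) k_in]
  have img\<theta>: "x \<epsilon> \<theta>" if "a \<epsilon> k" "x \<epsilon> repl a e" for a x
    using that mi[OF that(1)] e(3) k_down[OF that(1)] by auto
  define T where "T = G.pow \<theta>"
  have TN: "T \<in> N" by (simp add: T_def)
  have T: "x \<epsilon> T \<longleftrightarrow> x \<in> N \<and> (\<forall>y. y \<epsilon> x \<longrightarrow> y \<epsilon> \<theta>)" for x unfolding T_def by (rule G.mem_pow[OF \<theta>(1)])
  define inter where "inter a g = collect (repl a e) (\<lambda>y. \<exists>i\<in>M. app g i y)" for a g
  have dinter: "dfun2 inter" unfolding inter_def by (intro dfn Dt_comp1[OF e(1)])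
  have inter: "y \<epsilon> inter a g \<longleftrightarrow> y \<epsilon> repl a e \<and> (\<exists>i\<in>M. app g i y)" if "g \<in> M" for a g y
  proof -
    have "dpred (\<lambda>y. \<exists>i\<in>M. app g i y)" by (intro dfn that)
    then show ?thesis unfolding inter_def by (rule mem_collect) simp
  qed
  \<comment> \<open>Witnesses against approximation are taken as ranges of functions on ordinals
    below \<delta>, because such functions from the ground model are elements of \<open>F\<close>
    and therefore have codes.\<close>
  define bad where "bad g a \<longleftrightarrow> (\<exists>t. t \<epsilon> \<delta> \<and> is_fun g t \<theta>) \<and> \<not> inter a g \<epsilon> T" for g a
  have dbad: "dpred2 bad" unfolding bad_def
    by (intro dfn Dt_comp2[OF dinter] NM'[OF \<delta>N] NM'[OF TN] NM'[OF \<theta>(1)])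
  \<comment> \<open>The codes of singletons enumerate \<open>F\<close> along \<open>k\<close>;
    choosing the least one makes the bad function definable from \<open>a\<close>.\<close>
  define cd where "cd \<xi> g \<longleftrightarrow> g \<epsilon> F \<and> (\<forall>x. x \<epsilon> F \<longrightarrow> (code \<xi> x \<longleftrightarrow> x = g))" for \<xi> g
  have dcd: "dpred2 cd" unfolding cd_def by (intro dfn D_comp2[OF dcode] NM'[OF F(1)])
  define xi where "xi a = least_in k (\<lambda>\<xi>. \<exists>g. g \<epsilon> F \<and> cd \<xi> g \<and> bad g a)" for a
  have dxi: "dfun xi" unfolding xi_def by (intro dfn D_comp2[OF dcd] D_comp2[OF dbad] kM NM'[OF F(1)])
  define ga where "ga a = tht (\<lambda>g. cd (xi a) g \<and> bad g a)" for a
  have dga: "dfun ga" unfolding ga_def by (intro dfn D_comp2[OF dcd] D_comp2[OF dbad] Dt_comp1[OF dxi])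
  define ex where "ex a \<longleftrightarrow> (\<exists>g. g \<epsilon> F \<and> bad g a)" for a
  have dex: "dpred ex" unfolding ex_def by (intro dfn D_comp2[OF dbad] NM'[OF F(1)])
  have ga: "ga a \<epsilon> F" "bad (ga a) a" if a: "a \<epsilon> k" "ex a" for a
  proof -
    obtain g where g: "g \<epsilon> F" "bad g a" using a(2) unfolding ex_def by blast
    have gN: "g \<in> N" by (rule G.trans[OF F(1) g(1)])
    have "\<exists>\<xi>. \<xi> \<epsilon> k \<and> (\<forall>x. x \<epsilon> F \<longrightarrow> (code \<xi> x \<longleftrightarrow> x \<epsilon> G.upair g g))"
      by (rule code) (use g gN G.mem_upair in auto)
    then obtain \<xi> where \<xi>: "\<xi> \<epsilon> k" "\<exists>g. g \<epsilon> F \<and> cd \<xi> g \<and> bad g a"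
      unfolding cd_def using g gN G.mem_upair by auto
    have d: "dpred (\<lambda>\<xi>. \<exists>g. g \<epsilon> F \<and> cd \<xi> g \<and> bad g a)"
      by (intro dfn D_comp2[OF dcd] D_comp2[OF dbad] k_in[OF a(1)] NM'[OF F(1)])
    from least_in(2)[of k "\<lambda>\<xi>. \<exists>g. g \<epsilon> F \<and> cd \<xi> g \<and> bad g a", OF k(1) d \<xi>]
    obtain g' where g': "g' \<epsilon> F" "cd (xi a) g'" "bad g' a" unfolding xi_def by blast
    have "ga a = g'" unfolding ga_def
    proof (rule tht_eq)
      show "g' \<in> M" using G.trans[OF F(1) g'(1)] by simp
      fix y assume "cd (xi a) y \<and> bad y a"
      then show "y = g'" using g'(2) unfolding cd_def by blast
    qed (use g' in blast)
    then show "ga a \<epsilon> F" "bad (ga a) a" using g' by simp_all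
  qed
  define q where "q i a b \<longleftrightarrow> ex a \<and> app (ga a) i (e b)" for i a b
  have dq: "dpred3 q" unfolding q_def by (intro dfn D_comp1[OF dex] Dt_comp1[OF dga] Dt_comp1[OF e(1)])
  have bad_ex: "ex a" if a: "a \<epsilon> k" and nT: "\<not> repl a e \<epsilon> T" for a
  proof -
    let ?A = "repl a e"
    have AN: "x \<in> N" if "x \<epsilon> ?A" for x using img\<theta>[OF a that] \<theta>N by blast
    have "?A \<notin> N" using nT img\<theta>[OF a] unfolding T by blast
    then obtain d where d: "d \<in> N" "G.size_less d \<delta>" "\<not> (\<exists>b\<in>N. \<forall>x. x \<epsilon> b \<longleftrightarrow> x \<epsilon> ?A \<and> x \<epsilon> d)"
      using approx[unfolded approximation_property_def, rule_format, OF in_M(2), of a e] AN by blast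
    obtain m f where m: "m \<in> N" "m \<epsilon> \<delta>" "f \<in> N" "G.is_fun f m d" "bij_betw (G.ap f) (el m) (el d)"
      by (rule G.size_lessE[OF d(2,1)], rule that)
    \<comment> \<open>An empty intersection would be a set of the ground model. The element found
      here replaces the entries of the enumeration of \<open>d\<close> that fall outside \<theta>,
      so that its range becomes the part of \<open>d\<close> within \<theta>.\<close>
    have "\<exists>x. x \<epsilon> ?A \<and> x \<epsilon> d"
    proof (rule ccontr)
      assume "\<not> ?thesis"
      then have "\<forall>x. x \<epsilon> G.zer \<longleftrightarrow> x \<epsilon> ?A \<and> x \<epsilon> d" by simp
      then show False using d(3) G.zer(1) by blast
    qed
    then obtain x0 where x0: "x0 \<epsilon> ?A" "x0 \<epsilon> d" by blast
    have x0\<theta>: "x0 \<epsilon> \<theta>" by (rule img\<theta>[OF a x0(1)])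
    define h where "h i = (if G.ap f i \<epsilon> \<theta> then G.ap f i else x0)" for i
    have dh: "G.dfun h" unfolding h_def by (intro dfn m(3) \<theta>(1) \<theta>N x0\<theta>)
    define g where "g = G.lam m h"
    have gN: "g \<in> N" by (simp add: g_def)
    have gf: "G.is_fun g m \<theta>" unfolding g_def
      by (rule G.is_fun_lam[OF dh m(1) \<theta>(1)]) (simp add: h_def x0\<theta>)
    have gF: "g \<epsilon> F" unfolding F(2) using gN gf \<delta>k[OF m(2)] by blast
    have gf': "is_fun g m \<theta>" using gf abs_is_fun[OF gN m(1) \<theta>(1)] by simp
    have sur: "\<exists>i. i \<epsilon> m \<and> y = G.ap f i" if "y \<epsilon> d" for y
    proof -
      have "y \<in> G.ap f ` el m" using bij_betw_imp_surj_on[OF m(5)] that by simp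
      then show ?thesis by auto
    qed
    have fd: "G.ap f i \<epsilon> d" if "i \<epsilon> m" for i using bij_betwE[OF m(5)] that by simp
    have rg: "(\<exists>i\<in>M. app g i y) \<longleftrightarrow> y \<epsilon> d" if y: "y \<epsilon> \<theta>" for y
    proof
      assume "\<exists>i\<in>M. app g i y"
      then obtain i where i: "i \<in> M" "app g i y" by blast
      have iN: "i \<in> N" using abs_app_in[OF gN i(1) _ i(2)] \<theta>N[OF y] by simp
      have "G.app g i y" using abs_app[OF gN iN \<theta>N[OF y]] i(2) by simp
      then have "i \<epsilon> m" "y = h i" unfolding g_def G.app_lam[OF dh m(1) iN \<theta>N[OF y]] by blast+
      then show "y \<epsilon> d" unfolding h_def using fd x0(2) by auto
    next
      assume "y \<epsilon> d"
      then obtain i where i: "i \<epsilon> m" "y = G.ap f i" using sur by blast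
      have iN: "i \<in> N" by (rule G.trans[OF m(1) i(1)])
      have "y = h i" unfolding h_def using i(2) y by simp
      then have "G.app g i y" unfolding g_def G.app_lam[OF dh m(1) iN \<theta>N[OF y]] using i(1) by blast
      then show "\<exists>i\<in>M. app g i y" using abs_app[OF gN iN \<theta>N[OF y]] NM'[OF iN] by blast
    qed
    have "y \<epsilon> inter a g \<longleftrightarrow> y \<epsilon> ?A \<and> y \<epsilon> d" for y
      unfolding inter[OF NM'[OF gN]] using rg img\<theta>[OF a] by blast
    then have "\<not> inter a g \<epsilon> T" using d(3) unfolding T by blast
    then have "bad g a" unfolding bad_def using m(2) gf' by blast
    then show ?thesis unfolding ex_def using gF by blast
  qed
  have main: "ev H (\<lambda>a. repl (g a) e \<epsilon> S)"
    if n: "normal_for q H g" for H g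
  proof -
    note H = normal_forD(1)[OF n] and g = normal_forD(2-4)[OF n] and qd = normal_forD(5)[OF n]
    have HM: "H \<in> M" by (rule unbD(1)[OF H])
    have Hk: "g a \<epsilon> k" if "a \<epsilon> H" for a using g(2) unbD(2)[OF H that] by blast
    \<comment> \<open>\<open>Z i y\<close>: eventually the entry at \<open>i\<close> is
      \<open>y\<close> and is located in the image. \<open>W i a\<close> says that entry
      \<open>i\<close> shows this limit behaviour already at \<open>a\<close>.\<close>
    define Z where "Z i y \<longleftrightarrow> (\<exists>b. b \<epsilon> k \<and> y = e b \<and> ev H (\<lambda>a. b \<epsilon> g a \<and> q i (g a) b))" for i y
    have dZ: "dpred2 Z" unfolding Z_def
      by (intro dfn kM HM D_comp3[OF dq] Dt_comp1[OF g(1)] Dt_comp1[OF e(1)])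
    define W where "W i a \<longleftrightarrow> (\<forall>y. y \<epsilon> \<theta> \<longrightarrow> ((\<exists>b. b \<epsilon> g a \<and> y = e b \<and> q i (g a) b) \<longleftrightarrow> Z i y))" for i a
    have dW: "dpred2 W" unfolding W_def
      by (intro dfn D_comp2[OF dZ] NM'[OF \<theta>(1)] D_comp3[OF dq] Dt_comp1[OF g(1)] Dt_comp1[OF e(1)])
    have qfun: "e b = e b'" if a: "a \<epsilon> k" and qq: "q i a b" "q i a b'" and bk: "b \<epsilon> k" "b' \<epsilon> k" and i: "i \<in> M" for i a b b'
    proof -
      have ex: "ex a" using qq unfolding q_def by blast
      obtain t where t: "t \<epsilon> \<delta>" "is_fun (ga a) t \<theta>" using ga(2)[OF a ex] unfolding bad_def by blast
      have gM: "ga a \<in> M" using G.trans[OF F(1) ga(1)[OF a ex]] by simp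
      have tM: "t \<in> M" using \<delta>k[OF t(1)] by simp
      have eM: "e b \<in> M" "e b' \<in> M" using \<theta>N e(3) bk by simp_all
      have it: "i \<epsilon> t" using is_fun_dom(1)[OF t(2) gM i eM(1) _ tM NM'[OF \<theta>(1)]] qq(1) unfolding q_def by blast
      from qq is_fun_app(2)[OF t(2) gM tM it eM(1)] is_fun_app(2)[OF t(2) gM tM it eM(2)]
      show ?thesis unfolding q_def by simp
    qed
    \<comment> \<open>By normality each entry is eventually either outside the image or constant;
      since \<delta> is below \<open>k\<close>, completeness treats all entries together.\<close>
    have "ev H (\<lambda>a. \<forall>i. i \<epsilon> \<delta> \<longrightarrow> W i a)"
    proof (rule ev_all[OF H dW \<delta>])
      fix i assume "i \<epsilon> \<delta>"
      then have ik: "i \<epsilon> k" by (rule \<delta>k)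
      from qd[OF ik] show "ev H (W i)"
      proof
        assume none: "ev H (\<lambda>a. \<forall>b. b \<epsilon> g a \<longrightarrow> \<not> q i (g a) b)"
        have "\<not> Z i y" for y
          unfolding Z_def using ev_ex[OF H ev_conj[OF H none]] by blast
        with none show ?thesis unfolding W_def by (intro ev_mono[OF none]) blast
      next
        assume "\<exists>b. b \<epsilon> k \<and> ev H (\<lambda>a. b \<epsilon> g a \<and> q i (g a) b)"
        then obtain b where b: "b \<epsilon> k" "ev H (\<lambda>a. b \<epsilon> g a \<and> q i (g a) b)" by blast
        have Zi: "Z i y \<longleftrightarrow> y = e b" for y
        proof
          assume "Z i y"
          then obtain b' where b': "b' \<epsilon> k" "y = e b'" "ev H (\<lambda>a. b' \<epsilon> g a \<and> q i (g a) b')" unfolding Z_def by blast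
          from ev_ex[OF H ev_conj[OF H b(2) b'(3)]] obtain a where "a \<epsilon> H" "q i (g a) b" "q i (g a) b'" by blast
          then show "y = e b" using qfun[OF Hk _ _ b(1) b'(1) k_in[OF ik]] b'(2) by simp
        next
          assume "y = e b"
          then show "Z i y" unfolding Z_def using b by blast
        qed
        from b(2) show ?thesis
        proof (rule ev_mono)
          fix a assume a: "a \<epsilon> H" "b \<epsilon> g a \<and> q i (g a) b"
          show "W i a" unfolding W_def Zi
            using a qfun[OF Hk[OF a(1)] _ _ _ b(1) k_in[OF ik]] k_down[OF Hk[OF a(1)]] by blast
        qed
      qed
    qed
    note Wev = this
    define B0 where "B0 = collect \<theta> (\<lambda>y. \<exists>i. i \<epsilon> \<delta> \<and> Z i y)"
    have "dpred (\<lambda>y. \<exists>i. i \<epsilon> \<delta> \<and> Z i y)" by (intro dfn D_comp2[OF dZ] NM'[OF \<delta>N])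
    note B0 = mem_collect[OF this NM'[OF \<theta>(1)], folded B0_def]
    have B0M: "B0 \<in> M" by (simp add: B0_def)
    have iB: "y \<epsilon> inter (g a) (ga (g a)) \<longleftrightarrow> y \<epsilon> B0"
      if a: "a \<epsilon> H" "\<forall>i. i \<epsilon> \<delta> \<longrightarrow> W i a" "ex (g a)" for a y
    proof -
      note gak = Hk[OF a(1)]
      obtain t where t: "t \<epsilon> \<delta>" "is_fun (ga (g a)) t \<theta>" using ga(2)[OF gak a(3)] unfolding bad_def by blast
      have gM: "ga (g a) \<in> M" using G.trans[OF F(1) ga(1)[OF gak a(3)]] by simp
      have tM: "t \<in> M" using \<delta>k[OF t(1)] by simp
      have *: "i \<epsilon> \<delta>" if "i \<in> M" "app (ga (g a)) i y" "y \<epsilon> \<theta>" for i y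
      proof -
        have "y \<in> M" using \<theta>N[OF that(3)] by simp
        then have "i \<epsilon> t" using is_fun_dom(1)[OF t(2) gM that(1) _ that(2) tM NM'[OF \<theta>(1)]] by blast
        then show ?thesis by (rule Ord_trans[OF \<delta>O t(1)])
      qed
      have "y \<epsilon> inter (g a) (ga (g a)) \<longleftrightarrow> y \<epsilon> repl (g a) e \<and> (\<exists>i\<in>M. app (ga (g a)) i y)"
        by (rule inter[OF gM])
      also have "\<dots> \<longleftrightarrow> y \<epsilon> \<theta> \<and> (\<exists>i. i \<epsilon> \<delta> \<and> (\<exists>b. b \<epsilon> g a \<and> y = e b \<and> q i (g a) b))"
      proof
        assume y: "y \<epsilon> repl (g a) e \<and> (\<exists>i\<in>M. app (ga (g a)) i y)"
        then obtain i where i: "i \<in> M" "app (ga (g a)) i y" by blast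
        obtain b where b: "b \<epsilon> g a" "y = e b" using y mi[OF gak] by blast
        have y\<theta>: "y \<epsilon> \<theta>" using img\<theta>[OF gak] y by blast
        have "q i (g a) b" unfolding q_def using a(3) i(2) b(2) by blast
        then show "y \<epsilon> \<theta> \<and> (\<exists>i. i \<epsilon> \<delta> \<and> (\<exists>b. b \<epsilon> g a \<and> y = e b \<and> q i (g a) b))"
          using y\<theta> *[OF i y\<theta>] b by blast
      next
        assume "y \<epsilon> \<theta> \<and> (\<exists>i. i \<epsilon> \<delta> \<and> (\<exists>b. b \<epsilon> g a \<and> y = e b \<and> q i (g a) b))"
        then obtain i b where "i \<epsilon> \<delta>" "b \<epsilon> g a" "y = e b" "app (ga (g a)) i (e b)" unfolding q_def by blast
        then show "y \<epsilon> repl (g a) e \<and> (\<exists>i\<in>M. app (ga (g a)) i y)"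
          using mi[OF gak] \<delta>k k_in by blast
      qed
      also have "\<dots> \<longleftrightarrow> y \<epsilon> B0" unfolding B0 using a(2) unfolding W_def by blast
      finally show ?thesis .
    qed
    have T_ev: "ev H (\<lambda>a. repl (g a) e \<epsilon> T)"
    proof (rule ccontr)
      assume n: "\<not> ev H (\<lambda>a. repl (g a) e \<epsilon> T)"
      \<comment> \<open>Bad functions occur beyond every threshold, so any eventual property holds
        at some \<open>a\<close> that has one.\<close>
      have many: "\<exists>a. a \<epsilon> H \<and> ex (g a) \<and> Q a" if "ev H Q" for Q
      proof (rule ccontr)
        assume c: "\<not> ?thesis"
        have "ev H (\<lambda>a. repl (g a) e \<epsilon> T)"
          by (rule ev_mono[OF that]) (use c bad_ex[OF Hk] in blast)
        with n show False by blast
      qed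
      obtain a0 where a0: "a0 \<epsilon> H" "ex (g a0)" "\<forall>i. i \<epsilon> \<delta> \<longrightarrow> W i a0" using many[OF Wev] by blast
      note i0 = iB[OF a0(1,3,2)]
      note gak = Hk[OF a0(1)]
      obtain t where t: "t \<epsilon> \<delta>" "is_fun (ga (g a0)) t \<theta>" using ga(2)[OF gak a0(2)] unfolding bad_def by blast
      have gM: "ga (g a0) \<in> M" using G.trans[OF F(1) ga(1)[OF gak a0(2)]] by simp
      have tM: "t \<in> M" using \<delta>k[OF t(1)] by simp
      \<comment> \<open>\<open>B0\<close> equals the intersection at \<open>a0\<close> and so lies
        in the range of a function on an ordinal below \<delta>. Its size is taken in the larger
        model, as the cover property requires.\<close>
      have "size_less B0 \<delta>"
      proof (rule size_less_surj[OF B0M \<delta>O t(1)])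
        show "dfun (ap (ga (g a0)))" by (intro dfn gM)
        fix y assume y: "y \<epsilon> B0"
        then obtain i where i: "i \<in> M" "app (ga (g a0)) i y" using i0 inter[OF gM] by blast
        have yM: "y \<in> M" by (rule trans[OF B0M y])
        have it: "i \<epsilon> t" using is_fun_dom(1)[OF t(2) gM i(1) yM i(2) tM NM'[OF \<theta>(1)]] .
        then show "\<exists>i. i \<epsilon> t \<and> y = ap (ga (g a0)) i" using is_fun_app(2)[OF t(2) gM tM it yM] i(2) by blast
      qed
      moreover have "\<forall>x. x \<epsilon> B0 \<longrightarrow> x \<in> N" using B0 \<theta>N by blast
      ultimately obtain B where B: "B \<in> N" "\<And>x. x \<epsilon> B0 \<Longrightarrow> x \<epsilon> B" "G.size_less B \<delta>"
        using cover[unfolded cover_property_def, rule_format, OF B0M] by blast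
      obtain m f where m: "m \<in> N" "m \<epsilon> \<delta>" "f \<in> N" "bij_betw (G.ap f) (el m) (el B)"
        by (rule G.size_lessE[OF B(3,1)], rule that)
      \<comment> \<open>The cover \<open>B\<close> has fewer than \<open>k\<close> elements, so by
        regularity those in \<theta> all have preimages under \<open>e\<close> below one \<gamma>.
        Once \<gamma> is in \<open>g a\<close>, the image contains them.\<close>
      have "\<exists>\<gamma>. \<gamma> \<epsilon> k \<and> (\<forall>i. i \<epsilon> m \<longrightarrow> (ap f i \<epsilon> \<theta> \<longrightarrow> (\<exists>b. b \<epsilon> \<gamma> \<and> e b = ap f i)))"
      proof (rule reg_all[where Q = "\<lambda>i \<gamma>. ap f i \<epsilon> \<theta> \<longrightarrow> (\<exists>b. b \<epsilon> \<gamma> \<and> e b = ap f i)"])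
        show "dpred2 (\<lambda>i \<gamma>. ap f i \<epsilon> \<theta> \<longrightarrow> (\<exists>b. b \<epsilon> \<gamma> \<and> e b = ap f i))"
          by (intro dfn Dt_comp1[OF e(1)] NM'[OF m(3)] NM'[OF \<theta>(1)])
        show "m \<epsilon> k" by (rule \<delta>k[OF m(2)])
        fix i assume "i \<epsilon> m"
        show "\<exists>\<gamma>. \<gamma> \<epsilon> k \<and> (ap f i \<epsilon> \<theta> \<longrightarrow> (\<exists>b. b \<epsilon> \<gamma> \<and> e b = ap f i))"
        proof (cases "ap f i \<epsilon> \<theta>")
          case True
          then obtain b where b: "b \<epsilon> k" "e b = ap f i" using e(2) by blast
          then have "b \<epsilon> suc b" by simp
          then show ?thesis using k(3)[OF b(1)] b(2) by blast
        qed (use k(2) in blast)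
      next
        fix i \<gamma> \<gamma>' assume *: "ap f i \<epsilon> \<theta> \<longrightarrow> (\<exists>b. b \<epsilon> \<gamma> \<and> e b = ap f i)" "\<gamma> \<epsilon> \<gamma>'" "\<gamma>' \<epsilon> k"
        then show "ap f i \<epsilon> \<theta> \<longrightarrow> (\<exists>b. b \<epsilon> \<gamma>' \<and> e b = ap f i)" using Ord_trans[OF k_Ord[OF *(3)] *(2)] by blast
      qed
      then obtain \<gamma> where \<gamma>: "\<gamma> \<epsilon> k" "\<And>i. i \<epsilon> m \<Longrightarrow> ap f i \<epsilon> \<theta> \<Longrightarrow> \<exists>b. b \<epsilon> \<gamma> \<and> e b = ap f i" by blast
      have B\<theta>: "\<exists>b. b \<epsilon> \<gamma> \<and> e b = y" if "y \<epsilon> B" "y \<epsilon> \<theta>" for y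
      proof -
        have "y \<in> ap f ` el m" using bij_betw_imp_surj_on[OF abs_bij[OF m(3,1,4)]] that(1) by simp
        then show ?thesis using \<gamma>(2) that(2) by auto
      qed
      obtain a where a: "a \<epsilon> H" "ex (g a)" "\<forall>i. i \<epsilon> \<delta> \<longrightarrow> W i a" "\<gamma> \<epsilon> g a"
        using many[OF ev_conj[OF H Wev g(3)[OF \<gamma>(1)]]] by blast
      note i1 = iB[OF a(1,3,2)]
      note gak = Hk[OF a(1)]
      have gN: "ga (g a) \<in> N" by (rule G.trans[OF F(1) ga(1)[OF gak a(2)]])
      \<comment> \<open>The range of the bad function cut down to \<open>B\<close> is a set of the
        ground model. As \<open>B\<close> contains \<open>B0\<close> while its part in \<theta> lies
        in the image, the cut is the whole intersection, against badness.\<close>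
      define C where "C = G.collect \<theta> (\<lambda>y. y \<epsilon> B \<and> (\<exists>i\<in>N. G.app (ga (g a)) i y))"
      have "G.dpred (\<lambda>y. y \<epsilon> B \<and> (\<exists>i\<in>N. G.app (ga (g a)) i y))" by (intro dfn B(1) gN)
      note C = G.mem_collect[OF this \<theta>(1), folded C_def]
      have CN: "C \<in> N" by (simp add: C_def)
      have ai: "(\<exists>i\<in>N. G.app (ga (g a)) i y) \<longleftrightarrow> (\<exists>i\<in>M. app (ga (g a)) i y)" if "y \<epsilon> \<theta>" for y
        using abs_app[OF gN _ \<theta>N[OF that]] abs_app_in[OF gN _ NM'[OF \<theta>N[OF that]]] NM' by blast
      have "inter (g a) (ga (g a)) = C"
      proof (rule set_ext)
        show "inter (g a) (ga (g a)) \<in> M" by (simp add: inter_def)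
        show "C \<in> M" using CN by simp
        fix y
        show "y \<epsilon> inter (g a) (ga (g a)) \<longleftrightarrow> y \<epsilon> C"
        proof
          assume y: "y \<epsilon> inter (g a) (ga (g a))"
          then have yB: "y \<epsilon> B0" using i1 by blast
          then have y\<theta>: "y \<epsilon> \<theta>" using B0 by blast
          have "\<exists>i\<in>M. app (ga (g a)) i y" using y unfolding inter[OF NM'[OF gN]] by simp
          then show "y \<epsilon> C" unfolding C ai[OF y\<theta>] using B(2)[OF yB] y\<theta> by simp
        next
          assume y: "y \<epsilon> C"
          then have yC: "y \<epsilon> \<theta>" "y \<epsilon> B" "\<exists>i\<in>N. G.app (ga (g a)) i y" unfolding C by blast+
          then obtain b where b: "b \<epsilon> \<gamma>" "e b = y" using B\<theta> by blast
          have "b \<epsilon> g a" by (rule Ord_trans[OF k_Ord[OF gak] a(4) b(1)])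
          then have "y \<epsilon> repl (g a) e" using mi[OF gak] b(2) by blast
          then show "y \<epsilon> inter (g a) (ga (g a))"
            unfolding inter[OF NM'[OF gN]] using yC(3) ai[OF yC(1)] by simp
        qed
      qed
      moreover have "C \<epsilon> T" unfolding T using CN C by blast
      moreover have "\<not> inter (g a) (ga (g a)) \<epsilon> T" using ga(2)[OF gak a(2)] unfolding bad_def by blast
      ultimately show False by simp
    qed
    from T_ev show ?thesis
    proof (rule ev_mono)
      fix a assume a: "a \<epsilon> H" "repl (g a) e \<epsilon> T"
      note gak = Hk[OF a(1)]
      let ?x = "repl (g a) e"
      have xN: "?x \<in> N" and x\<theta>: "\<And>y. y \<epsilon> ?x \<Longrightarrow> y \<epsilon> \<theta>" using a(2) unfolding T by blast+
      have GO: "G.Ord \<theta>" using abs_Ord[OF \<theta>(1)] \<theta>(2) by simp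
      obtain b where b: "G.Ord b" "G.equipotent ?x b"
        using G.subset_Ord_equipotent[OF GO xN x\<theta>] by metis
      obtain c where c: "G.has_card ?x c" "G.Ord c" by (rule G.has_card_le[OF xN b], rule that)
      have cN: "c \<in> N" using c(2) by simp
      have cO: "Ord c" using c(2) abs_Ord[OF cN] by simp
      \<comment> \<open>The size has to be below \<open>k\<close> in the ground model. Were the
        cardinal \<open>c\<close> computed there at least \<open>k\<close>, a bijection from
        \<open>c\<close> followed by least preimages under \<open>e\<close> would inject
        \<open>k\<close> into \<open>g a\<close>.\<close>
      have "c \<epsilon> k"
      proof (rule ccontr)
        assume n: "\<not> c \<epsilon> k"
        have kc: "y \<epsilon> c" if "y \<epsilon> k" for y using n Ord_linear[OF cO k(1)] that Ord_trans[OF cO, of k y] by auto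
        have "G.equipotent c ?x" using c(1) G.equipotent_sym[OF _ xN cN] unfolding G.has_card_def by blast
        then obtain f where f: "f \<in> N" "bij_betw (G.ap f) (el c) (el ?x)" using G.equipotentE[OF _ cN xN] by blast
        note bij = abs_bij[OF f(1) cN f(2)]
        obtain P where P: "dfun P" "\<And>i. i \<epsilon> g a \<Longrightarrow> P (e i) \<epsilon> g a" "\<And>i. i \<epsilon> g a \<Longrightarrow> e (P (e i)) = e i"
          by (rule least_preimage[OF k_Ord[OF gak] e(1)], rule that)
        have Px: "P y \<epsilon> g a \<and> e (P y) = y" if "y \<epsilon> ?x" for y using that P(2,3) mi[OF gak] by auto
        have fx: "ap f y \<epsilon> ?x" if "y \<epsilon> k" for y using bij_betwE[OF bij] kc[OF that] by simp
        show False
        proof (rule card_no_inj[OF kM wc_card gak])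
          show "dfun (\<lambda>y. P (ap f y))" by (intro dfn Dt_comp1[OF P(1)] NM'[OF f(1)])
          show "P (ap f y) \<epsilon> g a" if "y \<epsilon> k" for y using Px[OF fx[OF that]] by blast
          show "inj_on (\<lambda>y. P (ap f y)) (el k)"
          proof (rule inj_onI)
            fix y z assume y: "y \<in> el k" and z: "z \<in> el k" and eq: "P (ap f y) = P (ap f z)"
            have "e (P (ap f y)) = ap f y" "e (P (ap f z)) = ap f z" using Px fx y z by simp_all
            then have "ap f y = ap f z" using eq by metis
            then show "y = z" using inj_onD[OF bij_betw_imp_inj_on[OF bij]] kc y z by simp
          qed
        qed
      qed
      then have "G.size_less ?x k" unfolding G.size_less_def using c(1) cN by blast
      then show "?x \<epsilon> S" unfolding S(2) using xN x\<theta> by blast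
    qed
  qed
  show thesis by (rule that[OF dq]) (use main in blast)
qed

text \<open>
  The pair \<open>(s, b)\<close> with \<open>b \<in> s\<close> is coded by the functions on a successor ordinal with range \<open>s\<close> and last value \<open>b\<close>.
\<close>

lemma measure_on_ordinal:
  assumes \<delta>: "\<delta> \<epsilon> k" and approx: "approximation_property E \<delta> N M" and cover: "cover_property E \<delta> N M"
    and \<theta>: "\<theta> \<in> N" "Ord \<theta>" and k\<theta>: "\<And>x. x \<epsilon> k \<Longrightarrow> x \<epsilon> \<theta>"
    and F: "F \<in> N" "\<And>f. f \<epsilon> F \<longleftrightarrow> f \<in> N \<and> (\<exists>b. b \<epsilon> k \<and> G.is_fun f b \<theta>)"
    and dcode: "dpred2 code"
    and code: "\<And>Y. Y \<in> N \<Longrightarrow> \<forall>y. y \<epsilon> Y \<longrightarrow> y \<epsilon> F \<Longrightarrow> \<exists>\<xi>. \<xi> \<epsilon> k \<and> (\<forall>x. x \<epsilon> F \<longrightarrow> (code \<xi> x \<longleftrightarrow> x \<epsilon> Y))"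
  shows "\<exists>U\<in>N. G.normal_fine_measure k \<theta> U"
proof -
  obtain S where S: "S \<in> N" "\<And>x. x \<epsilon> S \<longleftrightarrow> x \<in> N \<and> (\<forall>z. z \<epsilon> x \<longrightarrow> z \<epsilon> \<theta>) \<and> G.size_less x k"
    by (rule Pk_exists[OF \<theta>(1)], rule that)
  have \<theta>N: "x \<in> N" if "x \<epsilon> \<theta>" for x by (rule G.trans[OF \<theta>(1) that])
  \<comment> \<open>An element \<open>a\<close> of \<theta> is represented in \<open>F\<close> by
    the function on the ordinal 1 with value \<open>a\<close>; \<open>e\<close> decodes the codes of
    singletons of such functions.\<close>
  define cf where "cf a = lam (suc zer) (\<lambda>_. a)" for a
  have dcf: "dfun cf" unfolding cf_def by (intro dfn in_M)
  have one: "suc zer \<epsilon> k" by (rule k(3)[OF k(2)])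
  have cf: "cf a \<epsilon> F" if a: "a \<epsilon> \<theta>" for a
  proof -
    have d: "dfun (\<lambda>_. a)" "G.dfun (\<lambda>_. a)" using \<theta>N[OF a] by (intro dfn; simp)+
    have e: "cf a = G.lam (suc zer) (\<lambda>_. a)" unfolding cf_def using abs_lam[OF kinN[OF one] d] by simp
    then have "cf a \<in> N" by simp
    moreover have "G.is_fun (cf a) (suc zer) \<theta>" unfolding e by (rule G.is_fun_lam[OF d(2) kinN[OF one] \<theta>(1)]) (rule a)
    ultimately show ?thesis unfolding F(2) using one by blast
  qed
  have cfi: "a = a'" if "cf a = cf a'" "a \<in> M" "a' \<in> M" for a a'
  proof -
    have "ap (cf a) zer = a" if "a \<in> M" for a unfolding cf_def
      by (rule ap_lam) (use that in \<open>intro dfn, auto\<close>)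
    then show ?thesis using that by metis
  qed
  define e where "e \<xi> = tht (\<lambda>a. a \<epsilon> \<theta> \<and> (\<forall>x. x \<epsilon> F \<longrightarrow> (code \<xi> x \<longleftrightarrow> x = cf a)))" for \<xi>
  have de: "dfun e" unfolding e_def by (intro dfn D_comp2[OF dcode] Dt_comp1[OF dcf] NM'[OF F(1)] NM'[OF \<theta>(1)])
  have e\<theta>: "e \<xi> \<epsilon> \<theta>" for \<xi>
  proof (cases "\<exists>!a. a \<in> M \<and> a \<epsilon> \<theta> \<and> (\<forall>x. x \<epsilon> F \<longrightarrow> (code \<xi> x \<longleftrightarrow> x = cf a))")
    case True
    from theI'[OF this] show ?thesis unfolding e_def tht_def if_P[OF True] by blast
  next
    case False
    \<comment> \<open>Ordinals that code no such singleton receive the default \<open>zer\<close>,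
      which lies in \<theta> because \<open>k\<close> is contained in \<theta>.\<close>
    show ?thesis unfolding e_def tht_def if_not_P[OF False] by (rule k\<theta>[OF k(2)])
  qed
  have esurj: "\<exists>b. b \<epsilon> k \<and> e b = a" if a: "a \<epsilon> \<theta>" for a
  proof -
    have cN: "cf a \<in> N" by (rule G.trans[OF F(1) cf[OF a]])
    have "\<exists>\<xi>. \<xi> \<epsilon> k \<and> (\<forall>x. x \<epsilon> F \<longrightarrow> (code \<xi> x \<longleftrightarrow> x \<epsilon> G.upair (cf a) (cf a)))"
      by (rule code) (use cf[OF a] cN in auto)
    then obtain \<xi> where \<xi>: "\<xi> \<epsilon> k" "\<And>x. x \<epsilon> F \<Longrightarrow> code \<xi> x \<longleftrightarrow> x = cf a" using cN by auto
    have "e \<xi> = a" unfolding e_def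
    proof (rule tht_eq)
      fix y assume y: "y \<in> M" "y \<epsilon> \<theta> \<and> (\<forall>x. x \<epsilon> F \<longrightarrow> (code \<xi> x \<longleftrightarrow> x = cf y))"
      then have "cf a = cf y" using \<xi>(2)[OF cf[OF a]] cf[OF a] by blast
      then show "y = a" using cfi y(1) \<theta>N[OF a] by simp
    qed (use a \<theta>N[OF a] \<xi> in auto)
    with \<xi>(1) show ?thesis by blast
  qed
  obtain q where q: "dpred3 q" "\<forall>H g. normal_for q H g \<longrightarrow> ev H (\<lambda>a. repl (g a) e \<epsilon> S)"
    by (rule images_in_ground[OF \<delta> approx cover \<theta> S F dcode code de esurj e\<theta>]; (assumption | rule that))
  define r where "r \<xi> a b \<longleftrightarrow> (\<exists>g. g \<epsilon> F \<and> code \<xi> g \<and>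
    (\<exists>t. t \<epsilon> k \<and> is_fun g (suc t) \<theta> \<and> repl (suc t) (ap g) = repl a e \<and> ap g t = e b))" for \<xi> a b
  have dr: "dpred3 r" unfolding r_def
    by (intro dfn D_comp2[OF dcode] Dt_comp1[OF de] NM'[OF F(1)] NM'[OF \<theta>(1)] kM)
  show ?thesis
  proof (rule measure_from_families[OF \<delta> approx \<theta>(1) S de esurj e\<theta> dr q(1) _ q(2)[rule_format]])
    fix Q assume Q: "G.dpred2 Q"
    let ?P = "\<lambda>g. \<exists>t. t \<epsilon> k \<and> G.is_fun g (G.suc t) \<theta> \<and> Q (G.repl (G.suc t) (G.ap g)) (G.ap g t)"
    define Y where "Y = G.collect F ?P"
    have "G.dpred ?P" by (intro dfn G.D_comp2[OF Q] kN \<theta>(1))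
    note Y = G.mem_collect[OF this F(1), folded Y_def]
    have "Y \<in> N" by (simp add: Y_def)
    moreover have "y \<epsilon> F" if "y \<epsilon> Y" for y using that Y by blast
    ultimately obtain \<xi> where \<xi>: "\<xi> \<epsilon> k" "\<And>x. x \<epsilon> F \<Longrightarrow> code \<xi> x \<longleftrightarrow> x \<epsilon> Y" using code by blast
    have sN: "suc t \<in> N" "G.suc t = suc t" if "t \<epsilon> k" for t
      using abs_suc[OF kinN[OF that]] G.in_M(6)[of t] by simp_all
    have ar: "G.repl (suc t) (G.ap g) = repl (suc t) (ap g)" if "t \<epsilon> k" "g \<in> N" for t g
    proof (rule abs_repl[OF sN(1)[OF that(1)] dap[OF that(2)]])
      show "G.dfun (G.ap g)" by (intro dfn that)
      show "G.ap g x = ap g x" if "x \<epsilon> suc t" for x by (rule abs_ap[OF \<open>g \<in> N\<close> G.trans[OF sN(1)[OF \<open>t \<epsilon> k\<close>] that]])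
    qed
    have "r \<xi> a b \<longleftrightarrow> Q (repl a e) (e b)" if a: "a \<epsilon> k" and b: "b \<epsilon> a" and s: "repl a e \<epsilon> S" for a b
    proof
      assume "r \<xi> a b"
      then obtain g t where g: "g \<epsilon> F" "code \<xi> g" and
        t: "t \<epsilon> k" "is_fun g (suc t) \<theta>" "repl (suc t) (ap g) = repl a e" "ap g t = e b" unfolding r_def by blast
      have gN: "g \<in> N" by (rule G.trans[OF F(1) g(1)])
      have "g \<epsilon> Y" using g \<xi>(2) by blast
      then obtain t' where t': "t' \<epsilon> k" "G.is_fun g (suc t') \<theta>" "Q (G.repl (suc t') (G.ap g)) (G.ap g t')"
        unfolding Y using sN(2) by auto
      have "is_fun g (suc t') \<theta>" using t'(2) abs_is_fun[OF gN sN(1)[OF t'(1)] \<theta>(1)] by simp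
      \<comment> \<open>A function determines its domain, so both readings of \<open>g\<close> use
        the same last position.\<close>
      then have "suc t = suc t'"
        by (rule is_fun_dom_unique[OF NM'[OF gN] in_M(6) in_M(6) NM'[OF \<theta>(1)] NM'[OF \<theta>(1)] t(2)])
      then have "t = t'" using suc_inj t(1) t'(1) k_Ord by blast
      then show "Q (repl a e) (e b)" using t'(3) ar[OF t(1) gN] t(3,4) abs_ap[OF gN kinN[OF t(1)]] by simp
    next
      assume Qab: "Q (repl a e) (e b)"
      let ?x = "repl a e"
      have xN: "?x \<in> N" "\<And>z. z \<epsilon> ?x \<Longrightarrow> z \<epsilon> \<theta>" "G.size_less ?x k" using s unfolding S(2) by blast+
      obtain m c where m: "m \<in> N" "m \<epsilon> k" "c \<in> N" "bij_betw (G.ap c) (el m) (el ?x)"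
        by (rule G.size_lessE[OF xN(3,1)], rule that)
      have ebN: "e b \<in> N" by (rule \<theta>N[OF e\<theta>])
      have ebx: "e b \<epsilon> ?x" using mem_repl[OF de k_in[OF a]] b by blast
      have cx: "G.ap c i \<epsilon> ?x" if "i \<epsilon> m" for i using bij_betwE[OF m(4)] that by simp
      \<comment> \<open>An enumeration of the image in the ground model, of length \<open>m\<close>
        below \<open>k\<close>, is prolonged by the value \<open>e b\<close> at position
        \<open>m\<close>. The range is unchanged, since \<open>e b\<close> is already in the
        image.\<close>
      define h where "h i = (if i = m then e b else G.ap c i)" for i
      have dh: "G.dfun h" unfolding h_def by (intro dfn m(1,3) ebN)
      have hx: "h i \<epsilon> ?x" if "i \<epsilon> suc m" for i using that ebx cx m(1) by (auto simp: h_def)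
      define g where "g = G.lam (suc m) h"
      have gN: "g \<in> N" by (simp add: g_def)
      note smN = sN(1)[OF m(2)]
      have gf: "G.is_fun g (suc m) \<theta>" unfolding g_def
        by (rule G.is_fun_lam[OF dh smN \<theta>(1)]) (use hx xN(2) in blast)
      have gF: "g \<epsilon> F" unfolding F(2) using gN gf k(3)[OF m(2)] by blast
      have gi: "ap g i = h i" if "i \<epsilon> suc m" for i
        using G.ap_lam[OF dh smN that] abs_ap[OF gN G.trans[OF smN that]] by (simp add: g_def)
      have gm: "ap g m = e b" using gi[of m] m(1) by (simp add: h_def)
      have "repl (suc m) (ap g) = ?x"
      proof (rule set_ext)
        fix y
        show "y \<epsilon> repl (suc m) (ap g) \<longleftrightarrow> y \<epsilon> ?x"
        proof
          assume "y \<epsilon> repl (suc m) (ap g)"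
          then show "y \<epsilon> ?x" unfolding mem_repl[OF dap[OF gN] in_M(6)] using gi hx by auto
        next
          assume "y \<epsilon> ?x"
          then have "y \<in> G.ap c ` el m" using bij_betw_imp_surj_on[OF m(4)] by simp
          then obtain i where i: "i \<epsilon> m" "y = G.ap c i" by auto
          have "i \<noteq> m" using i(1) mem_irrefl[OF k_in[OF m(2)]] by blast
          moreover have "i \<epsilon> suc m" using i(1) m(1) by simp
          ultimately have "i \<epsilon> suc m \<and> y = ap g i" using gi[of i] i(2) by (simp add: h_def)
          then show "y \<epsilon> repl (suc m) (ap g)" unfolding mem_repl[OF dap[OF gN] in_M(6)] by blast
        qed
      qed simp_all
      note gr = this
      have "g \<epsilon> Y" unfolding Y
        using gF m(2) gf Qab sN(2)[OF m(2)] ar[OF m(2) gN] gr gm abs_ap[OF gN m(1)] by auto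
      then have "code \<xi> g" using \<xi>(2)[OF gF] by blast
      moreover have "is_fun g (suc m) \<theta>" using gf abs_is_fun[OF gN smN \<theta>(1)] by simp
      ultimately show "r \<xi> a b" unfolding r_def using gF m(2) gr gm by blast
    qed
    then show "\<exists>\<xi>. \<xi> \<epsilon> k \<and> (\<forall>a b. a \<epsilon> k \<longrightarrow> b \<epsilon> a \<longrightarrow> repl a e \<epsilon> S \<longrightarrow> (r \<xi> a b \<longleftrightarrow> Q (repl a e) (e b)))"
      using \<xi>(1) by blast
  qed
qed

end

text \<open>Whether \<kappa> is contained in \<theta> decides on which space the measure lives. In
  the remaining case the codes need a nonempty \<theta>, and this follows from the cardinality of
  \<nu>.\<close>

theorem theorem28:
  fixes E :: "'a \<Rightarrow> 'a \<Rightarrow> bool"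
    and V Vbar :: "'a set"
    and \<delta> \<kappa> \<theta> \<mu> \<nu> :: 'a
  assumes "transitive_class E V" and "transitive_class E Vbar"
    and "model.ZFC V E" and "model.ZFC Vbar E"
    and "V \<subseteq> Vbar"
    and "\<kappa> \<in> V" and "\<theta> \<in> V" and "model.is_ord V E \<theta>"
    and "E \<delta> \<kappa>"
    and "approximation_property E \<delta> V Vbar"
    and "cover_property E \<delta> V Vbar"
    and "model.weakly_compact Vbar E \<kappa>"
    and "\<mu> \<in> V" and "model.card_exp_less V E \<theta> \<kappa> \<mu>"
    and "\<nu> \<in> V" and "model.two_exp V E \<mu> \<nu>"
    and "model.has_card Vbar E \<nu> \<kappa>"
  shows "model.supercompact V E \<theta> \<kappa>"
proof -
  interpret ground Vbar E \<kappa> V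
    using assms(1-6,12) unfolding ground_def ground_axioms_def wc_def wc_axioms_def zf_def transitive_class_def by blast
  have \<theta>O: "G.Ord \<theta>" using assms(7,8) by (simp add: G.Ord_def)
  have \<theta>O': "Ord \<theta>" using \<theta>O abs_Ord[OF assms(7)] by simp
  obtain F code where F: "F \<in> V" "\<And>f. E f F \<longleftrightarrow> f \<in> V \<and> (\<exists>b. E b \<kappa> \<and> G.is_fun f b \<theta>)" and dcode: "dpred2 code"
    and code: "\<And>Y. Y \<in> V \<Longrightarrow> \<forall>y. E y Y \<longrightarrow> E y F \<Longrightarrow> \<exists>\<xi>. E \<xi> \<kappa> \<and> (\<forall>x. E x F \<longrightarrow> (code \<xi> x \<longleftrightarrow> E x Y))"
    and code_inj: "\<And>\<xi> \<xi>'. E \<xi> \<kappa> \<Longrightarrow> E \<xi>' \<kappa> \<Longrightarrow> \<forall>x. E x F \<longrightarrow> (code \<xi> x \<longleftrightarrow> code \<xi>' x) \<Longrightarrow> \<xi> = \<xi>'"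
    by (rule code_relation[OF assms(7,13,14,15,16,17)], rule that)
  have "\<exists>U\<in>V. G.normal_fine_measure \<kappa> (if G.sub \<kappa> \<theta> then \<theta> else \<kappa>) U"
  proof (cases "G.sub \<kappa> \<theta>")
    case True
    then have "\<And>x. E x \<kappa> \<Longrightarrow> E x \<theta>" using G.sub_iff[OF assms(6)] by blast
    from measure_on_ordinal[OF assms(9,10,11,7) \<theta>O' this F dcode code] True show ?thesis by simp
  next
    case False
    have "\<exists>z. E z \<theta>"
    proof (rule ccontr)
      assume n: "\<nexists>z. E z \<theta>"
      have e: "f = zer" if "E f F" for f
      proof -
        have f: "f \<in> V" by (rule G.trans[OF F(1) that])
        from that obtain b where b: "G.is_fun f b \<theta>" unfolding F(2) by blast
        have "\<not> E p f" for p
          using b n G.trans[OF f] unfolding G.is_fun_def by blast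
        then show ?thesis using f by (intro set_ext) auto
      qed
      \<comment> \<open>For empty \<theta> the only possible element of \<open>F\<close> is the
        empty function, so the truth value of \<open>code \<xi> zer\<close> determines \<xi>; three
        distinct elements of \<kappa> contradict this.\<close>
      define z1 z2 where "z1 = suc zer" and "z2 = suc z1"
      have z: "E zer \<kappa>" "E z1 \<kappa>" "E z2 \<kappa>" unfolding z2_def z1_def using k by blast+
      have "E zer z1" "E zer z2" "E z1 z2" unfolding z2_def z1_def by simp_all
      then have ne: "zer \<noteq> z1" "zer \<noteq> z2" "z1 \<noteq> z2" using mem_irrefl[of z2] z(3) by auto
      have "\<xi> = \<xi>'" if "E \<xi> \<kappa>" "E \<xi>' \<kappa>" "code \<xi> zer \<longleftrightarrow> code \<xi>' zer" for \<xi> \<xi>'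
        using code_inj[OF that(1,2)] e that(3) by blast
      from this[OF z(1,2)] this[OF z(1,3)] this[OF z(2,3)] ne show False by blast
    qed
    then obtain z where "E z \<theta>" by blast
    from measure_on_k[OF assms(9,10,7) this F dcode code] False show ?thesis by simp
  qed
  then show ?thesis unfolding G.supercompact_def using uncountable_ground by blast
qed

end
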